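(* Consider the sequence $\{\bar x_k\}$ generated by the exact zeroth-order scheme (ZSOL$^{2s}_{cnvx}$, exact) described in the context, applied to the two-stage implicit problem $\min_{x\in\mathcal X}f^{\rm imp}(x)$, under Assumptions (B1)--(B3), (C), (U) of the context. Let $\gamma_k=\gamma_0/(k+1)^a$ and $\eta_k=\eta_0/(k+1)^b$ for all $k\ge0$, with $\gamma_0,\eta_0>0$. Then the following hold. (a) Let $a=0.5$, $b\in[0.5,1)$ and $0\le r<2(1-b)$. Then for all $K\ge2^{\frac1{1-r}}-1$, $$\mathbb E[f^{\rm imp}(\bar x_K)]-f^*\le(2-r)\Big(\tfrac{D_{\mathcal X}}{\gamma_0}+\tfrac{L_0^2n^2\gamma_0}{1-r}\Big)\tfrac1{\sqrt{K+1}}+(2-r)\Big(\tfrac{\eta_0L_0}{1-0.5r-b}\Big)\tfrac1{(K+1)^b}.$$ In particular, when $b=1-\delta$ and $r=0$, where $\delta>0$ is a small scalar, for all $K\ge1$, $$\mathbb E[f^{\rm imp}(\bar x_K)]-f^*\le2\Big(\tfrac{D_{\mathcal X}}{\gamma_0}+L_0^2n^2\gamma_0\Big)\tfrac1{\sqrt{K+1}}+\Big(\tfrac{2\eta_0L_0}{\delta}\Big)\tfrac1{(K+1)^{1-\delta}}.$$ (b) Let $a=0.5$, $b=0.5$, $r=0$, $\gamma_0=\frac{\sqrt{D_{\mathcal X}}}{nL_0}$ and $\eta_0\le\sqrt{D_{\mathcal X}}\,n$. Then the iteration complexity $K_\epsilon$ in projection steps on $\mathcal X$ for achieving $\mathbb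 E[f^{\rm imp}(\bar x_{K_\epsilon})]-f^*\le\epsilon$ for some $\epsilon>0$ is bounded as follows: it suffices that $$K_\epsilon\ge\frac{64\,n^2L_0^2D_{\mathcal X}}{\epsilon^2}.$$ (c) For any $a\in(0.5,1]$ and $b>1-a$, there exists $x^*\in\mathcal X^*$ such that $\lim_{k\to\infty}\|\bar x_k-x^*\|^2=0$ almost surely.
   Context: Notation. $\mathbb B$ and $\mathbb S$ are the Euclidean unit ball and unit sphere of $\mathbb R^n$; $\Pi_C$ is Euclidean projection onto $C$. Problem. $\mathcal X\subseteq\mathbb R^n$, $\mathcal Y\subseteq\mathbb R^m$; $\omega$ is a random variable on a probability space $(\Omega,\mathcal F,\mathbb P)$; $\tilde f(x,y,\omega)\in\mathbb R$, $G(x,y,\omega)\in\mathbb R^m$. The single-valued map $y(\cdot,\cdot)$ assigns to $(x,\omega)$ the solution $y(x,\omega)$ of VI$(\mathcal Y,G(x,\cdot,\omega))$: $y\in\mathcal Y$ and $(\tilde y-y)^TG(x,y,\omega)\ge0$ for all $\tilde y\in\mathcal Y$. The two-stage implicit problem is $\min_{x\in\mathcal X}f^{\rm imp}(x):=\mathbb E[\tilde f(x,y(x,\omega),\omega)]$; $\mathcal X^*$ and $f^*$ denote its solution set and optimal value, and $D_{\mathcal X}:=\frac12\sup_{x\in\mathcal X}{\rm dist}^2(x,\mathcal X^* )$. Assumptions. (B1) For some $\eta_0>0$ and every $\omega$, $x\mapsto\tilde f(x,y(x,\omega),\omega)$ is $L_0(\omega)$-Lipschitz on $\mathcal X+\eta_0\mathbb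 B$ with $L_0:=\sqrt{\mathbb E[L_0^2(\omega)]}<\infty$; and $\tilde f(x,\cdot,\omega)$ is $\tilde L_0(\omega)$-Lipschitz for all $x\in\mathcal X+\eta_0\mathbb B$, with $\tilde L_0:=\sqrt{\mathbb E[\tilde L_0^2(\omega)]}<\infty$. (B2) $\mathcal X,\mathcal Y$ are nonempty, closed, bounded, convex. (B3) $G(x,\cdot,\omega)$ is $\mu_F(\omega)$-strongly monotone and $L_F(\omega)$-Lipschitz on $\mathcal Y$, uniformly in $x\in\mathcal X$, for every $\omega$, with $\inf_\omega\mu_F(\omega)\ge\mu_F$ and $\sup_\omega L_F(\omega)\le L_F$ for some $\mu_F,L_F\in(0,\infty)$. (C) $f^{\rm imp}$ is convex on $\mathcal X$. (U) The $v_k$ are independent with $v_k$ uniformly distributed on $\eta_k\mathbb S$, the $\omega_k$ are iid replicates of $\omega$, and $v_k$, $\omega_k$ are independent of each other. Scheme (ZSOL$^{2s}_{cnvx}$, exact). Given $r\in[0,1)$, $x_0\in\mathcal X$, $\bar x_0=x_0$, $S_0=\gamma_0^r$. For $k=0,1,\dots$: draw $\omega_k$ and $v_k\in\eta_k\mathbb S$; evaluate $y(x_k,\omega_k)$, $y(x_k+v_k,\omega_k)$ exactly; set $$g_k=\frac{n\big(\tilde f(x_k+v_k,y(x_k+v_k,\omega_k),\omega_k)-\tilde f(x_k,y(x_k,\omega_k),\omega_k)\big)v_k}{\|v_k\|\eta_k},\quad x_{k+1}=\Pi_{\mathcal X}[x_k-\gamma_kg_k],$$ $S_{k+1}=S_k+\gamma_{k+1}^r$,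 $\bar x_{k+1}=(S_k\bar x_k+\gamma_{k+1}^rx_{k+1})/S_{k+1}$.
   Formalization: Assumption (C) is strengthened: f^imp is assumed convex on X + η_0 B, where the scheme evaluates it, not only on X; with convexity on X alone the claim fails, since iterates can be trapped at spurious minimizers of the smoothed function. In (c), x* is a random vector with values in X*. *)

theory Defs
  imports "HOL-Probability.Probability"
begin

text \<open>\<open>enlargement X \<eta>\<close> is the Minkowski sum of \<open>X\<close> and the closed ball of radius \<open>\<eta>\<close>.
  It contains every point \<open>x + v\<close> at which the scheme queries the implicit objective. Convexity of
  the implicit objective has to be required there, not just on \<open>X\<close>: the smoothed objectives average
  over points outside \<open>X\<close> and otherwise can have spurious local minimizers that trap the scheme.\<close>

definition enlargement :: "'a::real_normed_vector set \<Rightarrow> real \<Rightarrow> 'a set" where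
  "enlargement X \<eta> = {x + u | x u. x \<in> X \<and> u \<in> cball 0 \<eta>}"

definition strongly_monotone_on :: "real \<Rightarrow> 'a::real_inner set \<Rightarrow> ('a \<Rightarrow> 'a) \<Rightarrow> bool" where
  "strongly_monotone_on \<mu> Y F \<longleftrightarrow>
     (\<forall>u\<in>Y. \<forall>v\<in>Y. (F u - F v) \<bullet> (u - v) \<ge> \<mu> * (norm (u - v))\<^sup>2)"

definition vi_solutions :: "'a::real_inner set \<Rightarrow> ('a \<Rightarrow> 'a) \<Rightarrow> 'a set" where
  "vi_solutions Y F = {y \<in> Y. \<forall>z\<in>Y. (z - y) \<bullet> F y \<ge> 0}"

definition implicit_objective ::
    "'p measure \<Rightarrow> ('p \<Rightarrow> 'w) \<Rightarrow> ('a \<Rightarrow> 'b \<Rightarrow> 'w \<Rightarrow> real) \<Rightarrow> ('a \<Rightarrow> 'w \<Rightarrow> 'b) \<Rightarrow> 'a \<Rightarrow> real" where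
  "implicit_objective M \<omega> f y x = (\<integral>p. f x (y x (\<omega> p)) (\<omega> p) \<partial>M)"

definition minimizers :: "'a set \<Rightarrow> ('a \<Rightarrow> real) \<Rightarrow> 'a set" where
  "minimizers X F = {x \<in> X. \<forall>z\<in>X. F x \<le> F z}"

definition half_sq_radius :: "'a::metric_space set \<Rightarrow> 'a set \<Rightarrow> real" where
  "half_sq_radius X Z = 1/2 * (SUP x\<in>X. (infdist x Z)\<^sup>2)"

text \<open>Normalized surface measure on the sphere of radius \<open>\<eta>\<close>, as the (normalized) cone measure:
  a Borel set \<open>A\<close> of directions has mass proportional to the volume of
  \<open>{t *\<^sub>R a | 0 < t < 1, a \<in> A}\<close>. The origin, where \<open>sgn\<close> is not a unit vector,
  has volume zero.\<close>

definition uniform_sphere :: "real \<Rightarrow> 'a::euclidean_space measure" where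
  "uniform_sphere \<eta> = distr (uniform_measure lborel (ball 0 1)) borel (\<lambda>u. \<eta> *\<^sub>R sgn u)"

lemma borel_measurable_scaled_sgn [measurable]:
  "(\<lambda>u::'a::euclidean_space. \<eta> *\<^sub>R sgn u) \<in> borel_measurable borel"
  unfolding sgn_div_norm by measurable

lemma emeasure_lborel_unit_ball:
  "emeasure lborel (ball 0 1 :: 'a::euclidean_space set) \<noteq> 0"
  "emeasure lborel (ball 0 1 :: 'a::euclidean_space set) \<noteq> \<infinity>"
  using content_ball_pos[of 1 "0::'a"] emeasure_lborel_ball_finite[of "0::'a" 1]
  by (auto simp: measure_def)

lemma prob_space_uniform_sphere: "prob_space (uniform_sphere \<eta> :: 'a::euclidean_space measure)"
  unfolding uniform_sphere_def
  by (intro prob_space.prob_space_distr prob_space_uniform_measure emeasure_lborel_unit_ball) auto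

lemma AE_uniform_sphere:
  assumes "\<eta> \<ge> 0"
  shows "AE v in (uniform_sphere \<eta> :: 'a::euclidean_space measure). v \<in> sphere 0 \<eta>"
proof -
  have "AE u in (lborel :: 'a measure). u \<noteq> 0"
    by (rule AE_lborel_singleton)
  then have "AE u in (lborel :: 'a measure). u \<in> ball 0 1 \<longrightarrow> \<eta> *\<^sub>R sgn u \<in> sphere 0 \<eta>"
    by eventually_elim (use assms in \<open>simp add: norm_sgn\<close>)
  then have "AE u in uniform_measure lborel (ball 0 1 :: 'a set). \<eta> *\<^sub>R sgn u \<in> sphere 0 \<eta>"
    by (intro AE_uniform_measureI) auto
  then show ?thesis
    unfolding uniform_sphere_def
    by (subst AE_distr_iff) (auto simp: sets_uniform_measure)
qed

definition indep_random_variables ::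
    "'p measure \<Rightarrow> 'a measure \<Rightarrow> ('p \<Rightarrow> 'a) \<Rightarrow> 'b measure \<Rightarrow> ('p \<Rightarrow> 'b) \<Rightarrow> bool" where
  "indep_random_variables M N1 U N2 W \<longleftrightarrow>
     U \<in> measurable M N1 \<and> W \<in> measurable M N2 \<and>
     prob_space.indep_set M {U -` A \<inter> space M | A. A \<in> sets N1} {W -` B \<inter> space M | B. B \<in> sets N2}"

text \<open>The zeroth-order estimator, for one realization and with \<open>h\<close> the sampled implicit objective.\<close>

definition zo_gradient ::
    "(real^'n \<Rightarrow> real) \<Rightarrow> real \<Rightarrow> real^'n \<Rightarrow> real^'n \<Rightarrow> real^'n" where
  "zo_gradient h \<eta> x v = (real CARD('n) * (h (x + v) - h x) / (norm v * \<eta>)) *\<^sub>R v"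

text \<open>The iterates, along one sample path \<open>ws\<close> of the second-stage randomness and one sample path
  \<open>vs\<close> of the directions.\<close>

primrec zsol_iterate ::
    "(real^'n) set \<Rightarrow> (real^'n \<Rightarrow> 'b \<Rightarrow> 'w \<Rightarrow> real) \<Rightarrow> (real^'n \<Rightarrow> 'w \<Rightarrow> 'b) \<Rightarrow> (nat \<Rightarrow> real) \<Rightarrow>
     (nat \<Rightarrow> real) \<Rightarrow> real^'n \<Rightarrow> (nat \<Rightarrow> 'w) \<Rightarrow> (nat \<Rightarrow> real^'n) \<Rightarrow> nat \<Rightarrow> real^'n" where
  "zsol_iterate X f y \<gamma> \<eta> x0 ws vs 0 = x0"
| "zsol_iterate X f y \<gamma> \<eta> x0 ws vs (Suc k) =
     (let x = zsol_iterate X f y \<gamma> \<eta> x0 ws vs k in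
      closest_point X
        (x - \<gamma> k *\<^sub>R zo_gradient (\<lambda>z. f z (y z (ws k)) (ws k)) (\<eta> k) x (vs k)))"

primrec averaging_weight :: "(nat \<Rightarrow> real) \<Rightarrow> real \<Rightarrow> nat \<Rightarrow> real" where
  "averaging_weight \<gamma> r 0 = \<gamma> 0 powr r"
| "averaging_weight \<gamma> r (Suc k) = averaging_weight \<gamma> r k + \<gamma> (Suc k) powr r"

primrec weighted_average ::
    "(nat \<Rightarrow> real) \<Rightarrow> real \<Rightarrow> (nat \<Rightarrow> 'a::real_vector) \<Rightarrow> nat \<Rightarrow> 'a" where
  "weighted_average \<gamma> r x 0 = x 0"
| "weighted_average \<gamma> r x (Suc k) =
     (averaging_weight \<gamma> r k *\<^sub>R weighted_average \<gamma> r x k + \<gamma> (Suc k) powr r *\<^sub>R x (Suc k))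
       /\<^sub>R averaging_weight \<gamma> r (Suc k)"

end

theory Submission
  imports Defs
begin

text \<open>For convex \<open>F\<close>, the conditional mean of the estimator at \<open>x\<close> is the gradient of the average of
  \<open>F\<close> over a ball of radius \<open>\<eta>\<close> around \<open>x\<close>, so its inner product with \<open>x - z\<close> is at least
  \<open>F x - F z - \<eta> L0\<close>; its norm is at most \<open>n\<close> times the random Lipschitz constant. Nonexpansiveness
  of the projection then gives the usual recursion for the squared distance to the solution set.
  Multiplying it by \<open>\<gamma>\<^sub>k powr (r - 1)\<close> and summing by parts yields the rates.

  For the almost sure convergence, the noise \<open>\<xi>\<^sub>k\<close> enters the recursion for the distance to a solution
  \<open>y\<close> through \<open>\<gamma>\<^sub>k (x\<^sub>k - y) \<bullet> \<xi>\<^sub>k\<close>. The series of \<open>\<gamma>\<^sub>k x\<^sub>k \<bullet> \<xi>\<^sub>k\<close> and \<open>\<gamma>\<^sub>k \<xi>\<^sub>k\<close> are martingales bounded in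
  mean square, so outside one null set, independent of \<open>y\<close>, everything reduces to a deterministic
  quasi-Fejer argument on a compact set.\<close>

section \<open>Convex functions and averages over a sphere\<close>

text \<open>The gradient identity for the ball average is not proved as such: the recursion needs
  only a one-sided secant inequality. Smoothing costs \<eta> L0 once, not twice. Averaging a convex
  function over a ball never lowers it at the centre, so the Lipschitz bound is spent only at the
  comparison point.

  Multiplying the recursion by \<open>\<gamma>\<^sub>k powr (r - 1)\<close> turns the coefficient of
  the gap into the averaging weight, so that Jensen's inequality applies. Since r \<le> 1 and the
  steps decrease, these multipliers grow, and summation by parts needs nothing beyond a uniform
  bound on the expected squared distance.

  The comparison point differs between the two halves. For the rates it is the solution nearest to
  the current iterate, which brings in D instead of the diameter of X. For the almost sure limit it
  is a solution kept fixed along the path, and it must range over all solutions, because the right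
  one is known only afterwards as a cluster point of that path.\<close>

lemma integral_uniform_sphere:
  fixes g :: "'a::euclidean_space \<Rightarrow> real"
  assumes [measurable]: "g \<in> borel_measurable borel"
  shows "(\<integral>v. g v \<partial>uniform_sphere \<eta>) =
    (\<integral>u. indicator (ball 0 1) u * g (\<eta> *\<^sub>R sgn u) \<partial>lborel) / measure lborel (ball (0::'a) 1)"
proof -
  let ?B = "ball (0::'a) 1"
  have "(\<integral>v. g v \<partial>uniform_sphere \<eta>) = (\<integral>u. g (\<eta> *\<^sub>R sgn u) \<partial>uniform_measure lborel ?B)"
    unfolding uniform_sphere_def by (rule integral_distr) (auto simp: measurable_def[of "uniform_measure _ _"] measurable_sets[OF borel_measurable_scaled_sgn, simplified])
  also have "uniform_measure lborel ?B = density lborel (\<lambda>x. ennreal (indicator ?B x / measure lborel ?B))"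
    unfolding uniform_measure_def using emeasure_lborel_unit_ball(2)[where 'a='a] content_ball_pos[of 1 "0::'a"]
    by (intro density_cong) (auto simp: emeasure_eq_ennreal_measure divide_ennreal indicator_def simp flip: ennreal_1)
  also have "(\<integral>u. g (\<eta> *\<^sub>R sgn u) \<partial>\<dots>) = (\<integral>u. (indicator ?B u / measure lborel ?B) *\<^sub>R g (\<eta> *\<^sub>R sgn u) \<partial>lborel)"
    by (rule integral_density) (auto intro!: borel_measurable_divide borel_measurable_indicator)
  also have "\<dots> = (\<integral>u. (indicator ?B u * g (\<eta> *\<^sub>R sgn u)) / measure lborel ?B \<partial>lborel)"
    by simp
  finally show ?thesis by simp
qed

section \<open>Change of variables and integrals over cones\<close>

lemma integral_lborel_scale:
  fixes g :: "'a::euclidean_space \<Rightarrow> real"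
  assumes [measurable]: "g \<in> borel_measurable borel" and "s \<noteq> 0"
  shows "(\<integral>u. g u \<partial>lborel) = \<bar>s\<bar> ^ DIM('a) * (\<integral>u. g (s *\<^sub>R u) \<partial>lborel)"
proof -
  have "(\<integral>u. g u \<partial>lborel) = (\<integral>u. g u \<partial>density (distr lborel borel (\<lambda>x::'a. 0 + s *\<^sub>R x)) (\<lambda>_. \<bar>s\<bar>^DIM('a)))"
    using lborel_affine[of s "0::'a"] assms by simp
  also have "\<dots> = \<bar>s\<bar> ^ DIM('a) * (\<integral>u. g (s *\<^sub>R u) \<partial>lborel)"
    using assms by (subst integral_density) (auto simp: integral_distr)
  finally show ?thesis .
qed

lemma integral_lborel_translate:
  fixes g :: "'a::euclidean_space \<Rightarrow> real"
  assumes [measurable]: "g \<in> borel_measurable borel"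
  shows "(\<integral>u. g (c + u) \<partial>lborel) = (\<integral>u. g u \<partial>lborel)"
proof -
  have "(\<integral>u. g u \<partial>lborel) = (\<integral>u. g u \<partial>distr lborel borel ((+) c))"
    by (simp add: lborel_distr_plus)
  also have "\<dots> = (\<integral>u. g (c + u) \<partial>lborel)"
    by (rule integral_distr) auto
  finally show ?thesis by simp
qed

text \<open>The integrand depends on the direction alone, so passing to a ball of radius
  \<open>s\<close> contributes only the Jacobian. Subtracting two radii gives annulus integrals
  without polar coordinates.\<close>

lemma integral_ball_sgn:
  fixes g :: "'a::euclidean_space \<Rightarrow> real"
  assumes [measurable]: "g \<in> borel_measurable borel" and "s > 0"
  shows "(\<integral>u. indicator (ball 0 s) u * g (sgn u) \<partial>lborel) =
    s ^ DIM('a) * (\<integral>u. indicator (ball 0 1) u * g (sgn u) \<partial>lborel)"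
proof -
  have [measurable]: "(sgn :: 'a \<Rightarrow> 'a) \<in> borel_measurable borel"
    using borel_measurable_scaled_sgn[of 1] by simp
  have *: "indicator (ball 0 s) (s *\<^sub>R u) * g (sgn (s *\<^sub>R u)) = indicator (ball 0 1) u * g (sgn u)" for u
    using assms(2) by (auto simp: indicator_def sgn_scaleR)
  show ?thesis
    by (subst integral_lborel_scale[of _ s])
       (use assms(2) in \<open>auto simp: * intro!: borel_measurable_times borel_measurable_indicator\<close>)
qed

lemma AE_lborel_not_sphere: "AE u in lborel. norm (u :: 'a::euclidean_space) \<noteq> s"
proof -
  have "sphere (0::'a) s \<in> null_sets lborel"
    using negligible_sphere[of "0::'a" s] unfolding negligible_iff_null_sets
    by (subst (asm) null_sets_completion_iff) auto
  then show ?thesis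
    by (rule AE_I') (auto)
qed

lemma tendsto_sequentially_at_right_0:
  fixes f :: "real \<Rightarrow> 'b::topological_space"
  assumes "(f \<longlongrightarrow> l) (at_right 0)"
  shows "(\<lambda>k. f (1 / real (Suc k))) \<longlonglongrightarrow> l"
  by (rule filterlim_compose[OF assms])
     (intro tendsto_imp_filterlim_at_right LIMSEQ_Suc[OF lim_1_over_n] always_eventually; simp)

text \<open>The sphere average of a convex function is compared with secants without the divergence
  theorem: multiply by a Lipschitz cutoff that falls from 1 to 0 on a thin annulus inside the
  unit sphere, move a translation from the function to the cutoff, and let first the translation
  and then the thickness of the annulus tend to 0.\<close>

definition radial_cutoff :: "real \<Rightarrow> 'a::real_normed_vector \<Rightarrow> real" where
  "radial_cutoff \<epsilon> u = max 0 (min 1 ((1 - norm u) / \<epsilon>))"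

lemma radial_cutoff_props:
  assumes "\<epsilon> > 0"
  shows radial_cutoff_nonneg: "0 \<le> radial_cutoff \<epsilon> u"
    and radial_cutoff_le_1: "radial_cutoff \<epsilon> u \<le> 1"
    and radial_cutoff_outside: "norm u \<ge> 1 \<Longrightarrow> radial_cutoff \<epsilon> u = 0"
    and radial_cutoff_inside: "norm u \<le> 1 - \<epsilon> \<Longrightarrow> radial_cutoff \<epsilon> u = 1"
    and radial_cutoff_lipschitz: "\<bar>radial_cutoff \<epsilon> u - radial_cutoff \<epsilon> w\<bar> \<le> norm (u - w) / \<epsilon>"
    and continuous_radial_cutoff: "continuous_on A (radial_cutoff \<epsilon>)"
    and borel_measurable_radial_cutoff: "(radial_cutoff \<epsilon> :: 'b::euclidean_space \<Rightarrow> real) \<in> borel_measurable borel"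
proof -
  show "0 \<le> radial_cutoff \<epsilon> u" "radial_cutoff \<epsilon> u \<le> 1" by (auto simp: radial_cutoff_def)
  show "norm u \<ge> 1 \<Longrightarrow> radial_cutoff \<epsilon> u = 0" using assms
    by (simp add: radial_cutoff_def divide_le_0_iff max_absorb1 min.coboundedI2)
  show "norm u \<le> 1 - \<epsilon> \<Longrightarrow> radial_cutoff \<epsilon> u = 1" using assms
    by (auto simp: radial_cutoff_def max_def min_def field_simps)
  have "\<bar>radial_cutoff \<epsilon> u - radial_cutoff \<epsilon> w\<bar> \<le> \<bar>(1 - norm u) / \<epsilon> - (1 - norm w) / \<epsilon>\<bar>"
    unfolding radial_cutoff_def by linarith
  also have "\<dots> = \<bar>norm u - norm w\<bar> / \<epsilon>" using assms
    by (simp add: diff_divide_distrib[symmetric] abs_minus_commute)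
  also have "\<dots> \<le> norm (u - w) / \<epsilon>" using assms
    by (intro divide_right_mono norm_triangle_ineq3) auto
  finally show "\<bar>radial_cutoff \<epsilon> u - radial_cutoff \<epsilon> w\<bar> \<le> norm (u - w) / \<epsilon>" .
  show "continuous_on A (radial_cutoff \<epsilon>)" unfolding radial_cutoff_def[abs_def]
    by (intro continuous_intros) (use assms in auto)
  show "(radial_cutoff \<epsilon> :: 'b::euclidean_space \<Rightarrow> real) \<in> borel_measurable borel"
    unfolding radial_cutoff_def[abs_def] by measurable
qed

text \<open>Off the annulus the cutoff is locally constant; on it the cutoff is (1 - norm u) /
  \<epsilon>, with gradient -sgn u / \<epsilon>. The excluded radii are its kinks. The limit is the
  outward normal spread over a shell of thickness \<epsilon>, a substitute for the boundary term of
  the divergence theorem.\<close>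

lemma radial_cutoff_directional_derivative:
  fixes u d :: "'a::euclidean_space"
  assumes \<epsilon>: "0 < \<epsilon>" "\<epsilon> < 1" and u: "norm u \<noteq> 1" "norm u \<noteq> 1 - \<epsilon>"
  shows "(\<lambda>k. (radial_cutoff \<epsilon> u - radial_cutoff \<epsilon> (u + (1 / real (Suc k)) *\<^sub>R d)) / (1 / real (Suc k)))
    \<longlonglongrightarrow> (indicator (ball 0 1) u - indicator (ball 0 (1 - \<epsilon>)) u) * (sgn u \<bullet> d) / \<epsilon>"
proof -
  define c where "c = (\<lambda>t. norm (u + t *\<^sub>R d))"
  have c0: "(c \<longlongrightarrow> norm u) (at_right 0)"
    unfolding c_def by (rule tendsto_eq_intros refl | simp)+
  have "((\<lambda>t. (radial_cutoff \<epsilon> u - radial_cutoff \<epsilon> (u + t *\<^sub>R d)) / t) \<longlongrightarrow>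
    (indicator (ball 0 1) u - indicator (ball 0 (1 - \<epsilon>)) u) * (sgn u \<bullet> d) / \<epsilon>) (at_right 0)"
  proof -
    consider "norm u > 1" | "norm u < 1 - \<epsilon>" | "1 - \<epsilon> < norm u" "norm u < 1"
      using u by linarith
    then show ?thesis
    proof cases
      case 1
      have "eventually (\<lambda>t. c t > 1) (at_right 0)"
        using order_tendstoD(1)[OF c0 1] .
      then have "eventually (\<lambda>t. (radial_cutoff \<epsilon> u - radial_cutoff \<epsilon> (u + t *\<^sub>R d)) / t = 0) (at_right 0)"
        by eventually_elim (use 1 \<epsilon> in \<open>simp add: c_def radial_cutoff_outside\<close>)
      then show ?thesis using 1 \<epsilon> by (auto simp: tendsto_eventually)
    next
      case 2
      have "eventually (\<lambda>t. c t < 1 - \<epsilon>) (at_right 0)"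
        using order_tendstoD(2)[OF c0 2] .
      then have "eventually (\<lambda>t. (radial_cutoff \<epsilon> u - radial_cutoff \<epsilon> (u + t *\<^sub>R d)) / t = 0) (at_right 0)"
        by eventually_elim (use 2 \<epsilon> in \<open>simp add: c_def radial_cutoff_inside\<close>)
      then show ?thesis using 2 \<epsilon> by (auto simp: tendsto_eventually)
    next
      case 3
      then have u0: "u \<noteq> 0" using \<epsilon> by auto
      have "((\<lambda>t. norm (u + t *\<^sub>R d)) has_derivative (\<lambda>t. sgn (u + 0 *\<^sub>R d) \<bullet> (t *\<^sub>R d))) (at 0)"
        by (rule has_derivative_compose[of "\<lambda>t. u + t *\<^sub>R d" "\<lambda>t. t *\<^sub>R d" 0 UNIV norm "\<lambda>h. sgn (u + 0 *\<^sub>R d) \<bullet> h"])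
           (use u0 in \<open>auto intro!: derivative_eq_intros has_derivative_norm simp: inner_commute\<close>)
      then have "(c has_real_derivative (sgn u \<bullet> d)) (at 0)"
        unfolding c_def has_field_derivative_def by (simp add: mult.commute[of _ "sgn u \<bullet> d"] mult_commute_abs)
      then have "(c has_real_derivative (sgn u \<bullet> d)) (at_right 0)"
        by (rule has_field_derivative_at_within)
      then have *: "((\<lambda>t. (c t - c 0) / (t - 0)) \<longlongrightarrow> sgn u \<bullet> d) (at_right 0)"
        by (simp add: has_field_derivative_iff)
      have "((\<lambda>t. (c t - c 0) / (t - 0) / \<epsilon>) \<longlongrightarrow> (sgn u \<bullet> d) / \<epsilon>) (at_right 0)"
        by (intro tendsto_intros *) (use \<epsilon> in auto)
      moreover have "eventually (\<lambda>t. (c t - c 0) / (t - 0) / \<epsilon> = (radial_cutoff \<epsilon> u - radial_cutoff \<epsilon> (u + t *\<^sub>R d)) / t) (at_right 0)"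
        using order_tendstoD(1)[OF c0 3(1)] order_tendstoD(2)[OF c0 3(2)] eventually_at_right_less[of 0]
      proof eventually_elim
        case (elim t)
        have "radial_cutoff \<epsilon> u = (1 - norm u) / \<epsilon>" "radial_cutoff \<epsilon> (u + t *\<^sub>R d) = (1 - c t) / \<epsilon>"
          using 3 elim \<epsilon> by (auto simp: radial_cutoff_def c_def max_def min_def field_simps)
        then show ?case using elim \<epsilon> by (simp add: c_def diff_divide_distrib mult.commute)
      qed
      ultimately have "((\<lambda>t. (radial_cutoff \<epsilon> u - radial_cutoff \<epsilon> (u + t *\<^sub>R d)) / t) \<longlongrightarrow> (sgn u \<bullet> d) / \<epsilon>) (at_right 0)"
        by (rule Lim_transform_eventually)
      then show ?thesis using 3 \<epsilon> by auto
    qed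
  qed
  then show ?thesis by (rule tendsto_sequentially_at_right_0)
qed

lemma integrable_lborel_compact_support:
  fixes g :: "'a::euclidean_space \<Rightarrow> real"
  assumes g: "continuous_on UNIV g" and 0: "\<And>u. norm u > R \<Longrightarrow> g u = 0"
  shows "integrable lborel g"
proof -
  have "integrable lborel (\<lambda>u. indicator (cball 0 R) u *\<^sub>R g u)"
    by (rule borel_integrable_compact) (auto intro: continuous_on_subset[OF g])
  also have "(\<lambda>u. indicator (cball 0 R) u *\<^sub>R g u) = g"
    using 0 by (auto simp: indicator_def fun_eq_iff not_le)
  finally show ?thesis .
qed

text \<open>Slopes of a convex function are monotone, so the step along \<open>d\<close> may be
  shortened towards 0 while the slope over the full step remains a lower bound.\<close>

lemma convex_average_le_secant:
  assumes conv: "convex_on W \<phi>" and u: "u \<in> W" "u - d \<in> W" and t: "0 < t" "t \<le> (1::real)"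
  shows "\<phi> u - \<phi> (u - d) \<le> (\<phi> u - \<phi> (u - t *\<^sub>R d)) / t"
proof -
  have "u - t *\<^sub>R d = (1 - t) *\<^sub>R u + t *\<^sub>R (u - d)"
    by (simp add: algebra_simps)
  then have "\<phi> (u - t *\<^sub>R d) \<le> (1 - t) * \<phi> u + t * \<phi> (u - d)"
    using convex_onD[OF conv, of t u "u - d"] u t by simp
  then show ?thesis using t by (simp add: field_simps)
qed

lemma radial_cutoff_continuous_comp:
  assumes "\<epsilon> > 0" "continuous_on A g"
  shows "continuous_on A (\<lambda>u. radial_cutoff \<epsilon> (g u))"
  using continuous_on_compose2[OF continuous_radial_cutoff[OF assms(1), of UNIV] assms(2)] by simp

text \<open>The cutoff lies between the indicators of the balls of radii 1 - \<epsilon> and 1. As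
  \<epsilon> tends to 0 this produces the volume that normalizes the sphere average.\<close>

lemma integral_radial_cutoff_bounds:
  assumes \<epsilon>: "0 < \<epsilon>" "\<epsilon> < 1"
  shows "(1 - \<epsilon>) ^ DIM('a) * measure lborel (ball (0::'a::euclidean_space) 1) \<le> (\<integral>u. radial_cutoff \<epsilon> (u::'a) \<partial>lborel)"
    and "(\<integral>u. radial_cutoff \<epsilon> (u::'a) \<partial>lborel) \<le> measure lborel (ball (0::'a) 1)"
proof -
  have I: "integrable lborel (radial_cutoff \<epsilon> :: 'a \<Rightarrow> real)"
    by (rule integrable_lborel_compact_support[where R=1])
       (use \<epsilon> in \<open>auto simp: continuous_radial_cutoff radial_cutoff_outside\<close>)
  have m: "(\<integral>u. indicator (ball (0::'a) s) u \<partial>lborel) = s ^ DIM('a) * measure lborel (ball (0::'a) 1)" if "s > 0" for s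
    using integral_ball_sgn[of "\<lambda>_::'a. 1" s] that by simp
  have i: "integrable lborel (indicator (ball 0 s) :: 'a \<Rightarrow> real)" for s
    by (rule integrable_real_indicator) (use emeasure_lborel_ball_finite[of "0::'a" s] in auto)
  have "(\<integral>u. indicator (ball (0::'a) (1 - \<epsilon>)) u \<partial>lborel) \<le> (\<integral>u. radial_cutoff \<epsilon> (u::'a) \<partial>lborel)"
    by (rule integral_mono[OF i I])
       (use \<epsilon> in \<open>auto simp: indicator_def radial_cutoff_inside radial_cutoff_nonneg\<close>)
  then show "(1 - \<epsilon>) ^ DIM('a) * measure lborel (ball (0::'a) 1) \<le> (\<integral>u. radial_cutoff \<epsilon> (u::'a) \<partial>lborel)"
    using m[of "1-\<epsilon>"] \<epsilon> by simp
  have "(\<integral>u. radial_cutoff \<epsilon> (u::'a) \<partial>lborel) \<le> (\<integral>u. indicator (ball (0::'a) 1) u \<partial>lborel)"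
    by (rule integral_mono[OF I i])
       (use \<epsilon> in \<open>auto simp: indicator_def radial_cutoff_outside radial_cutoff_le_1\<close>)
  then show "(\<integral>u. radial_cutoff \<epsilon> (u::'a) \<partial>lborel) \<le> measure lborel (ball (0::'a) 1)"
    using m[of 1] by simp
qed

text \<open>Normalized coordinates: the unit ball around 0 stands for the ball of radius \<eta>
  around the iterate, \<open>- d\<close> for the comparison point, and \<Lambda> for \<eta> times
  the Lipschitz constant. Convexity and the Lipschitz bound are local to \<open>W\<close>; global
  continuity makes products with the cutoff integrable.\<close>

context
  fixes W :: "'a::euclidean_space set" and \<phi> :: "'a \<Rightarrow> real" and \<Lambda> :: real and d :: 'a
  assumes cont: "continuous_on UNIV \<phi>"
    and conv: "convex_on W \<phi>"
    and lip: "\<And>u w. u \<in> W \<Longrightarrow> w \<in> W \<Longrightarrow> \<bar>\<phi> u - \<phi> w\<bar> \<le> \<Lambda> * norm (u - w)"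
    and \<Lambda>: "\<Lambda> \<ge> 0"
    and W0: "cball 0 1 \<subseteq> W" and Wd: "cball (- d) 1 \<subseteq> W"
begin

lemma cont_comp: "continuous_on A g \<Longrightarrow> continuous_on A (\<lambda>u. \<phi> (g u))"
  using continuous_on_compose2[OF cont] by blast

lemmas cutoff_cont = cont_comp radial_cutoff_continuous_comp

text \<open>The cutoff is even, so reflecting u to -u and midpoint convexity bound the average
  around 0 below by \<phi> 0. Around \<open>- d\<close> the Lipschitz bound gives at most \<phi> (-
  d) + \<Lambda>. Hence only one \<Lambda> is lost.\<close>

lemma cutoff_lower:
  assumes \<epsilon>: "0 < \<epsilon>" "\<epsilon> < 1"
  shows "(\<phi> 0 - \<phi> (- d) - \<Lambda>) * (\<integral>u. radial_cutoff \<epsilon> (u::'a) \<partial>lborel)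
    \<le> (\<integral>u. radial_cutoff \<epsilon> u * (\<phi> u - \<phi> (u - d)) \<partial>lborel)"
proof -
  let ?\<rho> = "radial_cutoff \<epsilon> :: 'a \<Rightarrow> real"
  have [simp]: "?\<rho> (- u) = ?\<rho> u" for u by (simp add: radial_cutoff_def)
  have i: "integrable lborel (\<lambda>u. ?\<rho> u * g u)" if "continuous_on UNIV g" for g
    by (rule integrable_lborel_compact_support[where R=1])
       (use \<epsilon> in \<open>auto simp: radial_cutoff_outside intro!: continuous_intros continuous_radial_cutoff that\<close>)
  have refl: "(\<integral>u. ?\<rho> u * \<phi> (- u) \<partial>lborel) = (\<integral>u. ?\<rho> u * \<phi> u \<partial>lborel)"
    using integral_lborel_scale[of "\<lambda>u. ?\<rho> u * \<phi> u" "-1"] i[OF cont] by (simp add: borel_measurable_integrable)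
  have "2 * \<phi> 0 * (\<integral>u. ?\<rho> u \<partial>lborel) = (\<integral>u. ?\<rho> u * (2 * \<phi> 0) \<partial>lborel)"
    by simp
  also have "\<dots> \<le> (\<integral>u. ?\<rho> u * (\<phi> u + \<phi> (- u)) \<partial>lborel)"
  proof (rule integral_mono)
    fix u :: 'a
    show "?\<rho> u * (2 * \<phi> 0) \<le> ?\<rho> u * (\<phi> u + \<phi> (- u))"
    proof (cases "norm u \<le> 1")
      case True
      then have "u \<in> W" "-u \<in> W" using W0 by auto
      from convex_onD[OF conv, of "1/2" u "-u"] this have "2 * \<phi> 0 \<le> \<phi> u + \<phi> (- u)" by simp
      then show ?thesis using \<epsilon> by (intro mult_left_mono) (auto simp: radial_cutoff_nonneg)
    qed (use \<epsilon> in \<open>auto simp: radial_cutoff_outside\<close>)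
  qed (intro i continuous_intros cont_comp)+
  also have "\<dots> = (\<integral>u. ?\<rho> u * \<phi> u + ?\<rho> u * \<phi> (- u) \<partial>lborel)"
    by (simp add: distrib_left)
  also have "\<dots> = 2 * (\<integral>u. ?\<rho> u * \<phi> u \<partial>lborel)"
    by (subst Bochner_Integration.integral_add) (auto intro!: i continuous_intros cont_comp simp: refl)
  finally have 1: "\<phi> 0 * (\<integral>u. ?\<rho> u \<partial>lborel) \<le> (\<integral>u. ?\<rho> u * \<phi> u \<partial>lborel)" by simp
  have "(\<integral>u. ?\<rho> u * \<phi> (u - d) \<partial>lborel) \<le> (\<integral>u. ?\<rho> u * (\<phi> (- d) + \<Lambda>) \<partial>lborel)"
  proof (rule integral_mono)
    fix u :: 'a
    show "?\<rho> u * \<phi> (u - d) \<le> ?\<rho> u * (\<phi> (- d) + \<Lambda>)"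
    proof (cases "norm u \<le> 1")
      case True
      then have "u - d \<in> W" "- d \<in> W" using Wd by (auto simp: dist_norm subset_iff)
      from lip[OF this] have "\<phi> (u - d) \<le> \<phi> (- d) + \<Lambda> * norm u" by simp
      also have "\<dots> \<le> \<phi> (- d) + \<Lambda>" using True \<Lambda> by (simp add: mult_left_le)
      finally show ?thesis using \<epsilon> by (intro mult_left_mono) (auto simp: radial_cutoff_nonneg)
    qed (use \<epsilon> in \<open>auto simp: radial_cutoff_outside\<close>)
  qed (intro i continuous_intros cont_comp)+
  also have "\<dots> = (\<phi> (- d) + \<Lambda>) * (\<integral>u. ?\<rho> u \<partial>lborel)" by simp
  finally have 2: "(\<integral>u. ?\<rho> u * \<phi> (u - d) \<partial>lborel) \<le> (\<phi> (- d) + \<Lambda>) * (\<integral>u. ?\<rho> u \<partial>lborel)" .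
  have "(\<integral>u. ?\<rho> u * (\<phi> u - \<phi> (u - d)) \<partial>lborel) = (\<integral>u. ?\<rho> u * \<phi> u - ?\<rho> u * \<phi> (u - d) \<partial>lborel)"
    by (simp add: right_diff_distrib)
  also have "\<dots> = (\<integral>u. ?\<rho> u * \<phi> u \<partial>lborel) - (\<integral>u. ?\<rho> u * \<phi> (u - d) \<partial>lborel)"
    by (rule Bochner_Integration.integral_diff) (intro i continuous_intros cont_comp)+
  finally show ?thesis using 1 2 by (simp add: algebra_simps)
qed

text \<open>Monotone slopes replace \<open>d\<close> by \<open>t *\<^sub>R d\<close>. Then a
  discrete integration by parts puts the difference quotient on the cutoff, which is differentiable
  almost everywhere, while \<phi> need not be.\<close>

lemma cutoff_secant:
  assumes \<epsilon>: "0 < \<epsilon>" "\<epsilon> < 1" and t: "0 < t" "t \<le> 1"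
  shows "(\<integral>u. radial_cutoff \<epsilon> u * (\<phi> u - \<phi> (u - d)) \<partial>lborel)
    \<le> (\<integral>u. \<phi> u * ((radial_cutoff \<epsilon> u - radial_cutoff \<epsilon> (u + t *\<^sub>R d)) / t) \<partial>lborel)"
proof -
  let ?\<rho> = "radial_cutoff \<epsilon> :: 'a \<Rightarrow> real"
  have i: "integrable lborel (\<lambda>u. ?\<rho> u * g u)" if "continuous_on UNIV g" for g
    by (rule integrable_lborel_compact_support[where R=1])
       (use \<epsilon> in \<open>auto simp: radial_cutoff_outside intro!: continuous_intros continuous_radial_cutoff that\<close>)
  have i2: "integrable lborel (\<lambda>u. ?\<rho> (u + t *\<^sub>R d) * \<phi> u)"
  proof (rule integrable_lborel_compact_support[where R="1 + t * norm d"])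
    show "?\<rho> (u + t *\<^sub>R d) * \<phi> u = 0" if "1 + t * norm d < norm u" for u
      using norm_diff_ineq[of u "t *\<^sub>R d"] that t \<epsilon> by (simp add: radial_cutoff_outside)
  qed (use \<epsilon> in \<open>auto intro!: continuous_intros cutoff_cont cont\<close>)
  have tr: "(\<integral>u. ?\<rho> u * \<phi> (u - t *\<^sub>R d) \<partial>lborel) = (\<integral>u. ?\<rho> (u + t *\<^sub>R d) * \<phi> u \<partial>lborel)"
    using integral_lborel_translate[of "\<lambda>u. ?\<rho> u * \<phi> (u - t *\<^sub>R d)" "t *\<^sub>R d"]
      i[of "\<lambda>u. \<phi> (u - t *\<^sub>R d)"]
    by (simp add: borel_measurable_integrable cont_comp continuous_intros add.commute)
  have "(\<integral>u. ?\<rho> u * (\<phi> u - \<phi> (u - d)) \<partial>lborel) \<le> (\<integral>u. ?\<rho> u * ((\<phi> u - \<phi> (u - t *\<^sub>R d)) / t) \<partial>lborel)"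
  proof (rule integral_mono)
    fix u :: 'a
    show "?\<rho> u * (\<phi> u - \<phi> (u - d)) \<le> ?\<rho> u * ((\<phi> u - \<phi> (u - t *\<^sub>R d)) / t)"
    proof (cases "norm u \<le> 1")
      case True
      then have "u \<in> W" "u - d \<in> W" using W0 Wd by (auto simp: dist_norm subset_iff)
      from convex_average_le_secant[OF conv this t]
      show ?thesis using \<epsilon> by (intro mult_left_mono) (auto simp: radial_cutoff_nonneg)
    qed (use \<epsilon> in \<open>auto simp: radial_cutoff_outside\<close>)
  qed (use t in \<open>auto intro!: i continuous_intros cont_comp\<close>)
  also have "\<dots> = (\<integral>u. (?\<rho> u * \<phi> u - ?\<rho> u * \<phi> (u - t *\<^sub>R d)) / t \<partial>lborel)"
    by (simp add: algebra_simps)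
  also have "\<dots> = ((\<integral>u. ?\<rho> u * \<phi> u \<partial>lborel) - (\<integral>u. ?\<rho> u * \<phi> (u - t *\<^sub>R d) \<partial>lborel)) / t"
    by (subst integral_divide_zero, subst Bochner_Integration.integral_diff) (auto intro!: i continuous_intros cont_comp cont)
  also have "\<dots> = (\<integral>u. (?\<rho> u * \<phi> u - ?\<rho> (u + t *\<^sub>R d) * \<phi> u) / t \<partial>lborel)"
    unfolding tr
    by (subst integral_divide_zero, subst Bochner_Integration.integral_diff) (auto intro!: i i2 continuous_intros cont_comp cont)
  also have "\<dots> = (\<integral>u. \<phi> u * ((?\<rho> u - ?\<rho> (u + t *\<^sub>R d)) / t) \<partial>lborel)"
    by (simp add: algebra_simps)
  finally show ?thesis .
qed

lemma cutoff_limit: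
  assumes \<epsilon>: "0 < \<epsilon>" "\<epsilon> < 1"
  shows "(\<integral>u. radial_cutoff \<epsilon> u * (\<phi> u - \<phi> (u - d)) \<partial>lborel)
    \<le> (\<integral>u. \<phi> u * ((indicator (ball 0 1) u - indicator (ball 0 (1 - \<epsilon>)) u) * (sgn u \<bullet> d) / \<epsilon>) \<partial>lborel)"
proof -
  let ?\<rho> = "radial_cutoff \<epsilon> :: 'a \<Rightarrow> real"
  \<comment> \<open>For t \<le> 1 the cutoff vanishes at both \<open>u\<close> and
    \<open>u + t *\<^sub>R d\<close> outside this ball, so one ball serves all t. Inside, the
    Lipschitz constant 1 / \<epsilon> of the cutoff bounds the quotient by norm d / \<epsilon>,
    which gives the dominating function.\<close>
  let ?K = "cball (0::'a) (1 + norm d)"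
  obtain C where C: "\<And>u. u \<in> ?K \<Longrightarrow> \<bar>\<phi> u\<bar> \<le> C" "C \<ge> 0"
  proof -
    have "bounded (\<phi> ` ?K)"
      by (intro compact_imp_bounded compact_continuous_image continuous_on_subset[OF cont]) auto
    then obtain C where "\<forall>x\<in>\<phi> ` ?K. norm x \<le> C" by (auto simp: bounded_iff)
    then show thesis by (intro that[of "max C 0"]) (auto simp: le_max_iff_disj)
  qed
  have [measurable]: "\<phi> \<in> borel_measurable borel" "?\<rho> \<in> borel_measurable borel"
    using cont borel_measurable_radial_cutoff[OF \<epsilon>(1)] by (auto intro: borel_measurable_continuous_onI)
  have sgn_m[measurable]: "(sgn :: 'a \<Rightarrow> 'a) \<in> borel_measurable borel"
    using borel_measurable_scaled_sgn[of 1] by simp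
  have [measurable]: "ball (0::'a) s \<in> sets borel" for s by simp
  have lim: "(\<lambda>k. \<integral>u. \<phi> u * ((?\<rho> u - ?\<rho> (u + (1 / real (Suc k)) *\<^sub>R d)) / (1 / real (Suc k))) \<partial>lborel)
    \<longlonglongrightarrow> (\<integral>u. \<phi> u * ((indicator (ball 0 1) u - indicator (ball 0 (1 - \<epsilon>)) u) * (sgn u \<bullet> d) / \<epsilon>) \<partial>lborel)"
  proof (rule integral_dominated_convergence[where w="\<lambda>u. indicator ?K u * (C * (norm d / \<epsilon>))"])
    show "integrable lborel (\<lambda>u. indicator ?K u * (C * (norm d / \<epsilon>)))"
      by (intro integrable_mult_left integrable_real_indicator) (use emeasure_lborel_cball_finite[of "0::'a" "1 + norm d"] in auto)
    show "AE u in lborel. (\<lambda>k. \<phi> u * ((?\<rho> u - ?\<rho> (u + (1 / real (Suc k)) *\<^sub>R d)) / (1 / real (Suc k))))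
      \<longlonglongrightarrow> \<phi> u * ((indicator (ball 0 1) u - indicator (ball 0 (1 - \<epsilon>)) u) * (sgn u \<bullet> d) / \<epsilon>)"
      using AE_lborel_not_sphere[of 1] AE_lborel_not_sphere[of "1 - \<epsilon>"]
      by eventually_elim (intro tendsto_mult tendsto_const radial_cutoff_directional_derivative \<epsilon>)
    show "AE u in lborel. norm (\<phi> u * ((?\<rho> u - ?\<rho> (u + (1 / real (Suc k)) *\<^sub>R d)) / (1 / real (Suc k))))
      \<le> indicator ?K u * (C * (norm d / \<epsilon>))" for k
    proof (rule AE_I2)
      fix u :: 'a
      define t where "t = 1 / real (Suc k)"
      have t: "0 < t" "t \<le> 1" by (auto simp: t_def)
      show "norm (\<phi> u * ((?\<rho> u - ?\<rho> (u + (1 / real (Suc k)) *\<^sub>R d)) / (1 / real (Suc k))))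
        \<le> indicator ?K u * (C * (norm d / \<epsilon>))"
        unfolding t_def[symmetric]
      proof (cases "u \<in> ?K")
        case True
        have "\<bar>?\<rho> u - ?\<rho> (u + t *\<^sub>R d)\<bar> \<le> t * norm d / \<epsilon>"
          using radial_cutoff_lipschitz[OF \<epsilon>(1), of u "u + t *\<^sub>R d"] t by simp
        then have "\<bar>?\<rho> u - ?\<rho> (u + t *\<^sub>R d)\<bar> / t \<le> norm d / \<epsilon>"
          using t by (simp add: field_simps)
        then have "\<bar>\<phi> u\<bar> * (\<bar>?\<rho> u - ?\<rho> (u + t *\<^sub>R d)\<bar> / t) \<le> C * (norm d / \<epsilon>)"
          using C True t by (intro mult_mono) auto
        then show "norm (\<phi> u * ((?\<rho> u - ?\<rho> (u + t *\<^sub>R d)) / t)) \<le> indicator ?K u * (C * (norm d / \<epsilon>))"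
          using True t by (simp add: abs_mult)
      next
        case False
        then have *: "norm u > 1 + norm d" by simp
        have "norm (u + t *\<^sub>R d) \<ge> norm u - t * norm d"
          using norm_diff_ineq[of u "t *\<^sub>R d"] t by simp
        moreover have "t * norm d \<le> norm d" using t by (simp add: mult_left_le_one_le)
        ultimately have "?\<rho> u = 0" "?\<rho> (u + t *\<^sub>R d) = 0"
          using * norm_ge_zero[of d] by - (rule radial_cutoff_outside[OF \<epsilon>(1)], linarith)+
        then show "norm (\<phi> u * ((?\<rho> u - ?\<rho> (u + t *\<^sub>R d)) / t)) \<le> indicator ?K u * (C * (norm d / \<epsilon>))"
          using False by simp
      qed
    qed
  qed measurable
  show ?thesis
    by (rule LIMSEQ_le_const[OF lim], intro exI allI impI, rule cutoff_secant) (use \<epsilon> in auto)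
qed

text \<open>On the shell u and sgn u are at most \<epsilon> apart, so replacing \<phi> u by \<phi>
  (sgn u) costs \<Lambda> \<epsilon> norm d pointwise. The prefactor 1 / \<epsilon> cancels this
  \<epsilon>, and the shell volume left over still tends to 0. The main term now depends only on the
  direction and is evaluated by \<open>integral_ball_sgn\<close>.\<close>

lemma annulus_to_sphere:
  assumes \<epsilon>: "0 < \<epsilon>" "\<epsilon> < 1"
  shows "(\<integral>u. \<phi> u * ((indicator (ball 0 1) u - indicator (ball 0 (1 - \<epsilon>)) u) * (sgn u \<bullet> d) / \<epsilon>) \<partial>lborel)
    \<le> (1 - (1 - \<epsilon>) ^ DIM('a)) / \<epsilon> * (\<integral>u. indicator (ball 0 1) u * (\<phi> (sgn u) * (sgn u \<bullet> d)) \<partial>lborel)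
      + \<Lambda> * norm d * measure lborel (ball (0::'a) 1) * (1 - (1 - \<epsilon>) ^ DIM('a))"
proof -
  define A where "A = (\<lambda>u::'a. indicator (ball 0 1) u - indicator (ball 0 (1 - \<epsilon>)) u :: real)"
  have [measurable]: "\<phi> \<in> borel_measurable borel"
    using cont by (auto intro: borel_measurable_continuous_onI)
  have sgn_m[measurable]: "(sgn :: 'a \<Rightarrow> 'a) \<in> borel_measurable borel"
    using borel_measurable_scaled_sgn[of 1] by simp
  have [measurable]: "ball (0::'a) s \<in> sets borel" for s by simp
  obtain C where C: "\<And>u. u \<in> cball 0 1 \<Longrightarrow> \<bar>\<phi> u\<bar> \<le> C" "C \<ge> 0"
  proof -
    have "bounded (\<phi> ` cball 0 1)"
      by (intro compact_imp_bounded compact_continuous_image continuous_on_subset[OF cont]) auto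
    then obtain C where "\<forall>x\<in>\<phi> ` cball 0 1. norm x \<le> C" by (auto simp: bounded_iff)
    then show thesis by (intro that[of "max C 0"]) (auto simp: le_max_iff_disj)
  qed
  have i: "integrable lborel (\<lambda>u::'a. indicator (ball 0 s) u * g u)"
    if g[measurable]: "g \<in> borel_measurable borel" and b: "\<And>u. norm u < s \<Longrightarrow> \<bar>g u\<bar> \<le> B" for g :: "'a \<Rightarrow> real" and B s :: real
  proof (rule Bochner_Integration.integrable_bound)
    show "integrable lborel (\<lambda>u::'a. indicator (ball 0 s) u * B)"
      using emeasure_lborel_ball_finite[of "0::'a" s]
      by (intro integrable_mult_left integrable_real_indicator) auto
    show "AE u in lborel. norm (indicator (ball 0 s) u * g u) \<le> norm (indicator (ball (0::'a) s) u * B)"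
      by (auto simp: indicator_def intro!: AE_I2 order_trans[OF b abs_ge_self])
  qed measurable
  have sd: "\<bar>sgn u \<bullet> d\<bar> \<le> norm d" for u :: 'a
    using Cauchy_Schwarz_ineq2[of "sgn u" d] by (simp add: norm_sgn split: if_splits)
  have b1: "\<bar>\<phi> (sgn u) * (sgn u \<bullet> d)\<bar> \<le> C * norm d" for u :: 'a
    using C(1)[of "sgn u"] sd[of u] C(2) by (auto simp: abs_mult norm_sgn intro!: mult_mono)
  have b2: "\<bar>\<phi> u * (sgn u \<bullet> d)\<bar> \<le> C * norm d" if "norm u \<le> 1" for u :: 'a
    using C(1)[of u] sd[of u] C(2) that by (auto simp: abs_mult intro!: mult_mono)
  have s1: "0 < 1 - \<epsilon>" "0 < (1::real)" using \<epsilon> by auto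
  have iA: "integrable lborel (\<lambda>u. A u * (\<phi> u * (sgn u \<bullet> d)))"
    "integrable lborel (\<lambda>u. A u * (\<phi> (sgn u) * (sgn u \<bullet> d)))"
    "integrable lborel (\<lambda>u. A u * 1)"
    unfolding A_def left_diff_distrib
    by (intro Bochner_Integration.integrable_diff i[where B="C * norm d"]; use b1 b2 \<epsilon> in force)+
       (intro Bochner_Integration.integrable_diff i[where B=1]; force)
  have J: "(\<integral>u. A u * g (sgn u) \<partial>lborel) = (1 - (1 - \<epsilon>) ^ DIM('a)) * (\<integral>u. indicator (ball 0 1) u * g (sgn u) \<partial>lborel)"
    if [measurable]: "g \<in> borel_measurable borel" and b: "\<And>u. \<bar>g (sgn u)\<bar> \<le> B" for g B
    unfolding A_def left_diff_distrib
    by (subst Bochner_Integration.integral_diff)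
       (auto intro!: i[where B=B] b simp: integral_ball_sgn[OF _ s1(1)] left_diff_distrib)
  have "(\<integral>u. A u * (\<phi> u * (sgn u \<bullet> d)) \<partial>lborel) \<le>
    (\<integral>u. A u * (\<phi> (sgn u) * (sgn u \<bullet> d)) + A u * 1 * (\<Lambda> * \<epsilon> * norm d) \<partial>lborel)"
  proof (rule integral_mono)
    fix u :: 'a
    show "A u * (\<phi> u * (sgn u \<bullet> d)) \<le> A u * (\<phi> (sgn u) * (sgn u \<bullet> d)) + A u * 1 * (\<Lambda> * \<epsilon> * norm d)"
    proof (cases "norm u < 1 \<and> norm u \<ge> 1 - \<epsilon>")
      case True
      then have A: "A u = 1" "u \<noteq> 0" using \<epsilon> by (auto simp: A_def)
      have "u - sgn u = (norm u - 1) *\<^sub>R sgn u" by (simp add: sgn_div_norm algebra_simps A)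
      then have "norm (u - sgn u) = \<bar>norm u - 1\<bar>" by (simp add: norm_sgn A)
      then have n: "norm (u - sgn u) \<le> \<epsilon>" using True by simp
      have "u \<in> W" "sgn u \<in> W" using True W0 by (auto simp: subset_iff norm_sgn)
      from lip[OF this] n \<Lambda> have "\<bar>\<phi> u - \<phi> (sgn u)\<bar> \<le> \<Lambda> * \<epsilon>"
        by (meson mult_left_mono order_trans)
      then have "\<bar>(\<phi> u - \<phi> (sgn u)) * (sgn u \<bullet> d)\<bar> \<le> \<Lambda> * \<epsilon> * norm d"
        unfolding abs_mult using sd[of u] \<Lambda> \<epsilon> by (intro mult_mono) auto
      then show ?thesis unfolding A by (simp add: left_diff_distrib)
    next
      case False
      then have "A u = 0" using \<epsilon> by (auto simp: A_def indicator_def)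
      then show ?thesis by simp
    qed
  qed (intro iA Bochner_Integration.integrable_add integrable_mult_left)+
  also have "\<dots> = (\<integral>u. A u * (\<phi> (sgn u) * (sgn u \<bullet> d)) \<partial>lborel) + (\<integral>u. A u * 1 \<partial>lborel) * (\<Lambda> * \<epsilon> * norm d)"
    using iA by (subst Bochner_Integration.integral_add) auto
  also have "(\<integral>u. A u * 1 \<partial>lborel) = (1 - (1 - \<epsilon>) ^ DIM('a)) * measure lborel (ball (0::'a) 1)"
    using J[of "\<lambda>_. 1" 1] by simp
  also have "(\<integral>u. A u * (\<phi> (sgn u) * (sgn u \<bullet> d)) \<partial>lborel) =
     (1 - (1 - \<epsilon>) ^ DIM('a)) * (\<integral>u. indicator (ball 0 1) u * (\<phi> (sgn u) * (sgn u \<bullet> d)) \<partial>lborel)"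
    by (rule J[of "\<lambda>u. \<phi> u * (u \<bullet> d)" "C * norm d"]) (use b1 in auto)
  finally have *: "(\<integral>u. A u * (\<phi> u * (sgn u \<bullet> d)) \<partial>lborel) / \<epsilon> \<le>
      ((1 - (1 - \<epsilon>) ^ DIM('a)) * (\<integral>u. indicator (ball 0 1) u * (\<phi> (sgn u) * (sgn u \<bullet> d)) \<partial>lborel)
      + (1 - (1 - \<epsilon>) ^ DIM('a)) * measure lborel (ball (0::'a) 1) * (\<Lambda> * \<epsilon> * norm d)) / \<epsilon>"
    using \<epsilon> by (intro divide_right_mono) auto
  have "(\<integral>u. \<phi> u * ((indicator (ball 0 1) u - indicator (ball 0 (1 - \<epsilon>)) u) * (sgn u \<bullet> d) / \<epsilon>) \<partial>lborel)
     = (\<integral>u. A u * (\<phi> u * (sgn u \<bullet> d)) / \<epsilon> \<partial>lborel)"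
    by (simp add: A_def mult_ac)
  also have "\<dots> = (\<integral>u. A u * (\<phi> u * (sgn u \<bullet> d)) \<partial>lborel) / \<epsilon>" by simp
  also note *
  also have "((1 - (1 - \<epsilon>) ^ DIM('a)) * (\<integral>u. indicator (ball 0 1) u * (\<phi> (sgn u) * (sgn u \<bullet> d)) \<partial>lborel)
      + (1 - (1 - \<epsilon>) ^ DIM('a)) * measure lborel (ball (0::'a) 1) * (\<Lambda> * \<epsilon> * norm d)) / \<epsilon> =
     (1 - (1 - \<epsilon>) ^ DIM('a)) / \<epsilon> * (\<integral>u. indicator (ball 0 1) u * (\<phi> (sgn u) * (sgn u \<bullet> d)) \<partial>lborel)
      + \<Lambda> * norm d * measure lborel (ball (0::'a) 1) * (1 - (1 - \<epsilon>) ^ DIM('a))"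
    using \<epsilon> by (simp add: add_divide_distrib)
  finally show ?thesis .
qed

text \<open>Limit \<epsilon> to 0 in the chain of the three preceding bounds. The dimension factor
  is the derivative of 1 - (1 - \<epsilon>)^n at 0, the ratio of surface to volume of the ball; this
  is where the factor n of the estimator comes from.\<close>

lemma sphere_average_ge_secant:
  "(\<phi> 0 - \<phi> (- d) - \<Lambda>) * measure lborel (ball (0::'a) 1)
    \<le> DIM('a) * (\<integral>u. indicator (ball 0 1) u * (\<phi> (sgn u) * (sgn u \<bullet> d)) \<partial>lborel)"
proof -
  let ?c = "\<phi> 0 - \<phi> (- d) - \<Lambda>" and ?B = "measure lborel (ball (0::'a) 1)" and ?n = "DIM('a)"
  let ?J = "\<integral>u. indicator (ball 0 1) u * (\<phi> (sgn u) * (sgn u \<bullet> d)) \<partial>lborel"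
  let ?I = "\<lambda>\<epsilon>. \<integral>u. radial_cutoff \<epsilon> (u::'a) \<partial>lborel"
  have ev: "eventually (\<lambda>\<epsilon>::real. 0 < \<epsilon> \<and> \<epsilon> < 1) (at_right 0)"
    using eventually_at_right_less[of 0] eventually_at_right_real[of 0 1]
    by (auto elim: eventually_elim2)
  have pw: "((\<lambda>\<epsilon>::real. (1 - \<epsilon>) ^ ?n) \<longlongrightarrow> 1) (at_right 0)"
    by (rule tendsto_eq_intros refl | simp)+
  have I: "(?I \<longlongrightarrow> ?B) (at_right 0)"
  proof (rule tendsto_sandwich)
    show "((\<lambda>\<epsilon>. (1 - \<epsilon>) ^ ?n * ?B) \<longlongrightarrow> ?B) (at_right 0)"
      using tendsto_mult_right[OF pw, of ?B] by simp
    show "eventually (\<lambda>\<epsilon>. (1 - \<epsilon>) ^ ?n * ?B \<le> ?I \<epsilon>) (at_right 0)"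
      "eventually (\<lambda>\<epsilon>. ?I \<epsilon> \<le> ?B) (at_right 0)"
      using ev by (auto elim!: eventually_mono intro: integral_radial_cutoff_bounds)
  qed simp
  have D: "((\<lambda>\<epsilon>::real. (1 - (1 - \<epsilon>) ^ ?n) / \<epsilon>) \<longlongrightarrow> ?n) (at_right 0)"
  proof -
    have "((\<lambda>\<epsilon>::real. - ((1 - \<epsilon>) ^ ?n)) has_real_derivative real ?n) (at_right 0)"
      by (auto intro!: derivative_eq_intros)
    then have "((\<lambda>\<epsilon>::real. (- ((1 - \<epsilon>) ^ ?n) - - ((1 - 0) ^ ?n)) / (\<epsilon> - 0)) \<longlongrightarrow> real ?n) (at_right 0)"
      unfolding has_field_derivative_iff .
    then show ?thesis by simp
  qed
  have "((\<lambda>\<epsilon>. (1 - (1 - \<epsilon>) ^ ?n) / \<epsilon> * ?J + \<Lambda> * norm d * ?B * (1 - (1 - \<epsilon>) ^ ?n)) \<longlongrightarrow>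
      ?n * ?J + \<Lambda> * norm d * ?B * (1 - 1)) (at_right 0)"
    by (intro tendsto_intros D pw)
  moreover have "((\<lambda>\<epsilon>. ?c * ?I \<epsilon>) \<longlongrightarrow> ?c * ?B) (at_right 0)"
    by (intro tendsto_intros I)
  moreover have "eventually (\<lambda>\<epsilon>. ?c * ?I \<epsilon> \<le> (1 - (1 - \<epsilon>) ^ ?n) / \<epsilon> * ?J + \<Lambda> * norm d * ?B * (1 - (1 - \<epsilon>) ^ ?n)) (at_right 0)"
    using ev
  proof eventually_elim
    case (elim \<epsilon>)
    then show ?case
      using cutoff_lower[of \<epsilon>] cutoff_limit[of \<epsilon>] annulus_to_sphere[of \<epsilon>] by linarith
  qed
  ultimately show ?thesis
    by (intro tendsto_le[where F="at_right (0::real)"]) auto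
qed

end

section \<open>Back to a ball of radius \<eta> around an arbitrary point\<close>

lemma convex_on_affine_preimage:
  assumes "convex_on E F" and c: "convex {u. x + \<eta> *\<^sub>R u \<in> E}"
  shows "convex_on {u. x + \<eta> *\<^sub>R u \<in> E} (\<lambda>u. F (x + \<eta> *\<^sub>R u))"
proof (rule convex_onI[OF _ c])
  fix t u w assume t: "(0::real) < t" "t < 1" "u \<in> {u. x + \<eta> *\<^sub>R u \<in> E}" "w \<in> {u. x + \<eta> *\<^sub>R u \<in> E}"
  have "x + \<eta> *\<^sub>R ((1 - t) *\<^sub>R u + t *\<^sub>R w) = (1 - t) *\<^sub>R (x + \<eta> *\<^sub>R u) + t *\<^sub>R (x + \<eta> *\<^sub>R w)"
    by (simp add: algebra_simps)
  then show "F (x + \<eta> *\<^sub>R ((1 - t) *\<^sub>R u + t *\<^sub>R w)) \<le> (1 - t) * F (x + \<eta> *\<^sub>R u) + t * F (x + \<eta> *\<^sub>R w)"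
    using convex_onD[OF assms(1), of t] t by simp
qed

text \<open>Rescaling of \<open>sphere_average_ge_secant\<close>. With v = \<eta> sgn u one factor 1
  / \<eta> comes from writing sgn u through v and the other from the rescaled difference x - z;
  together they form the denominator of the estimator, since norm v = \<eta>.\<close>

lemma zeroth_order_secant:
  fixes F :: "'a::euclidean_space \<Rightarrow> real"
  assumes cont: "continuous_on UNIV F" and conv: "convex_on E F" and lip: "L-lipschitz_on E F"
    and \<eta>: "\<eta> > 0" and x: "cball x \<eta> \<subseteq> E" and z: "cball z \<eta> \<subseteq> E"
  shows "F x - F z - \<eta> * L \<le>
    (\<integral>v. DIM('a) / \<eta>\<^sup>2 * ((F (x + v) - F x) * (v \<bullet> (x - z))) \<partial>uniform_sphere \<eta>)"
proof -
  define W where "W = {u. x + \<eta> *\<^sub>R u \<in> E}"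
  \<comment> \<open>Subtracting the constant F x preserves convexity and slopes, and makes the
    two-point difference appear directly, without a separate proof that v has mean 0.\<close>
  define \<phi> where "\<phi> = (\<lambda>u. F (x + \<eta> *\<^sub>R u) + (- F x))"
  \<comment> \<open>Chosen so that \<open>- d\<close> is the rescaled coordinate of z.\<close>
  define d where "d = (x - z) /\<^sub>R \<eta>"
  let ?B = "measure lborel (ball (0::'a) 1)"
  have E: "convex E" using conv by (rule convex_on_imp_convex)
  have cW: "convex W"
    unfolding convex_alt
  proof (intro ballI allI impI)
    fix u w t assume t: "u \<in> W" "w \<in> W" "0 \<le> t \<and> t \<le> (1::real)"
    have "x + \<eta> *\<^sub>R ((1 - t) *\<^sub>R u + t *\<^sub>R w) = (1 - t) *\<^sub>R (x + \<eta> *\<^sub>R u) + t *\<^sub>R (x + \<eta> *\<^sub>R w)"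
      by (simp add: algebra_simps)
    then show "(1 - t) *\<^sub>R u + t *\<^sub>R w \<in> W"
      using convexD_alt[OF E, of "x + \<eta> *\<^sub>R u" "x + \<eta> *\<^sub>R w" t] t by (simp add: W_def)
  qed
  have 1: "continuous_on UNIV \<phi>" unfolding \<phi>_def
    by (intro continuous_intros continuous_on_compose2[OF cont]) auto
  have 2: "convex_on W \<phi>" unfolding \<phi>_def W_def
    using cW unfolding W_def
    by (intro convex_on_add[OF convex_on_affine_preimage[OF conv]]) (simp_all add: convex_on_const)
  have 3: "\<bar>\<phi> u - \<phi> w\<bar> \<le> (\<eta> * L) * norm (u - w)" if "u \<in> W" "w \<in> W" for u w
  proof -
    have "\<bar>\<phi> u - \<phi> w\<bar> \<le> L * norm ((x + \<eta> *\<^sub>R u) - (x + \<eta> *\<^sub>R w))"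
      using lipschitz_onD[OF lip, of "x + \<eta> *\<^sub>R u" "x + \<eta> *\<^sub>R w"] that by (simp add: \<phi>_def W_def dist_norm)
    also have "(x + \<eta> *\<^sub>R u) - (x + \<eta> *\<^sub>R w) = \<eta> *\<^sub>R (u - w)" by (simp add: algebra_simps)
    finally show ?thesis using \<eta> by (simp add: mult_ac)
  qed
  have 4: "\<eta> * L \<ge> 0" using lipschitz_on_nonneg[OF lip] \<eta> by simp
  have 5: "cball 0 1 \<subseteq> W" using x \<eta> by (auto simp: W_def dist_norm subset_iff mult_left_le)
  have 6: "cball (- d) 1 \<subseteq> W"
  proof
    fix u assume "u \<in> cball (- d) 1"
    then have "\<eta> * norm (d + u) \<le> \<eta>" using \<eta> by (simp add: dist_norm norm_minus_commute[of "-d"] add.commute mult_left_le)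
    moreover have "z - (x + \<eta> *\<^sub>R u) = - (\<eta> *\<^sub>R (d + u))" using \<eta> by (simp add: d_def algebra_simps)
    ultimately have "x + \<eta> *\<^sub>R u \<in> cball z \<eta>" using \<eta> by (simp add: dist_norm)
    then show "u \<in> W" using z by (auto simp: W_def)
  qed
  have B: "?B > 0" using content_ball_pos[of 1 "0::'a"] by simp
  have [simp]: "x - \<eta> *\<^sub>R d = z" using \<eta> by (simp add: d_def)
  have "(F x - F z - \<eta> * L) * ?B \<le> DIM('a) * (\<integral>u. indicator (ball 0 1) u * (\<phi> (sgn u) * (sgn u \<bullet> d)) \<partial>lborel)"
    using sphere_average_ge_secant[OF 1 2 3 4 5 6] by (simp add: \<phi>_def)
  then have "F x - F z - \<eta> * L \<le> DIM('a) * (\<integral>u. indicator (ball 0 1) u * (\<phi> (sgn u) * (sgn u \<bullet> d)) \<partial>lborel) / ?B"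
    using B by (simp add: pos_le_divide_eq)
  also have "\<dots> = (\<integral>u. indicator (ball 0 1) u * (DIM('a) / \<eta>\<^sup>2 * ((F (x + \<eta> *\<^sub>R sgn u) - F x) * ((\<eta> *\<^sub>R sgn u) \<bullet> (x - z)))) \<partial>lborel) / ?B"
  proof -
    have "indicator (ball 0 1) u * (DIM('a) / \<eta>\<^sup>2 * ((F (x + \<eta> *\<^sub>R sgn u) - F x) * ((\<eta> *\<^sub>R sgn u) \<bullet> (x - z))))
      = DIM('a) * (indicator (ball 0 1) u * (\<phi> (sgn u) * (sgn u \<bullet> d)))" for u :: 'a
    proof -
      have "sgn u \<bullet> d = (sgn u \<bullet> (x - z)) / \<eta>" by (simp add: d_def divide_inverse mult.commute)
      then show ?thesis using \<eta> by (simp add: \<phi>_def power2_eq_square)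
    qed
    then show ?thesis by simp
  qed
  also have "\<dots> = (\<integral>v. DIM('a) / \<eta>\<^sup>2 * ((F (x + v) - F x) * (v \<bullet> (x - z))) \<partial>uniform_sphere \<eta>)"
  proof (rule integral_uniform_sphere[symmetric])
    have [measurable]: "F \<in> borel_measurable borel" using cont by (rule borel_measurable_continuous_onI)
    show "(\<lambda>v. DIM('a) / \<eta>\<^sup>2 * ((F (x + v) - F x) * (v \<bullet> (x - z)))) \<in> borel_measurable borel"
      by measurable
  qed
  finally show ?thesis .
qed

section \<open>Freezing and square-integrable martingales\<close>

text \<open>Simple functions q_i converge pointwise to the identity. Each g (q_i x) w is jointly
  measurable because q_i has finitely many values, and continuity in x carries this to the
  limit.\<close>

lemma borel_measurable_Caratheodory:
  fixes g :: "'a::{metric_space, second_countable_topology} \<Rightarrow> 'w \<Rightarrow> real"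
  assumes cont: "\<And>w. w \<in> space N \<Longrightarrow> continuous_on UNIV (\<lambda>x. g x w)"
    and meas: "\<And>x. g x \<in> borel_measurable N"
  shows "(\<lambda>(x, w). g x w) \<in> borel_measurable (borel \<Otimes>\<^sub>M N)"
proof -
  obtain q :: "nat \<Rightarrow> 'a \<Rightarrow> 'a" where q: "\<And>i. simple_function borel (q i)" "\<And>x. (\<lambda>i. q i x) \<longlonglongrightarrow> x"
    using borel_measurable_implies_sequence_metric[of "\<lambda>x::'a. x" borel undefined] by auto
  show ?thesis
  proof (rule borel_measurable_LIMSEQ_real)
    fix z :: "'a \<times> 'w" assume z: "z \<in> space (borel \<Otimes>\<^sub>M N)"
    obtain x :: 'a and w where [simp]: "z = (x, w)" by (cases z)
    have "isCont (\<lambda>x. g x w) x"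
      using cont[of w] z by (simp add: space_pair_measure continuous_on_eq_continuous_at)
    then have "(\<lambda>i. g (q i x) w) \<longlonglongrightarrow> g x w"
      using q(2) by (rule isCont_tendsto_compose)
    then show "(\<lambda>i. g (q i (fst z)) (snd z)) \<longlonglongrightarrow> (case z of (x, w) \<Rightarrow> g x w)"
      by simp
  next
    fix i
    have fin: "finite (range (q i))" using simple_functionD(1)[OF q(1)[of i]] by simp
    have "q i \<in> measurable borel (count_space (range (q i)))"
      using q(1)[of i] unfolding simple_function_eq_measurable
      by (auto intro: measurable_count_space_extend[OF subset_UNIV, rotated])
    then show "(\<lambda>z. g (q i (fst z)) (snd z)) \<in> borel_measurable (borel \<Otimes>\<^sub>M N)"
      by (intro measurable_compose_countable'[where I="range (q i)" and g="\<lambda>z. q i (fst z)" and f="\<lambda>x z. g x (snd z)"]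
          measurable_compose[OF measurable_snd meas] measurable_compose[OF measurable_fst] countable_finite fin)
  qed
qed

section \<open>Independence and freezing\<close>

context prob_space
begin

lemma distr_Pair_indep:
  assumes U[measurable]: "U \<in> measurable M N1" and W[measurable]: "W \<in> measurable M N2"
    and indep: "\<And>A B. A \<in> sets N1 \<Longrightarrow> B \<in> sets N2 \<Longrightarrow>
      prob ((U -` A \<inter> space M) \<inter> (W -` B \<inter> space M)) = prob (U -` A \<inter> space M) * prob (W -` B \<inter> space M)"
  shows "distr M (N1 \<Otimes>\<^sub>M N2) (\<lambda>p. (U p, W p)) = distr M N1 U \<Otimes>\<^sub>M distr M N2 W"
proof (rule pair_measure_eqI[symmetric])
  interpret U: prob_space "distr M N1 U" by (rule prob_space_distr) fact
  interpret W: prob_space "distr M N2 W" by (rule prob_space_distr) fact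
  show "sigma_finite_measure (distr M N1 U)" "sigma_finite_measure (distr M N2 W)"
    by unfold_locales
  show "sets (distr M N1 U \<Otimes>\<^sub>M distr M N2 W) = sets (distr M (N1 \<Otimes>\<^sub>M N2) (\<lambda>p. (U p, W p)))"
    by (simp cong: sets_pair_measure_cong)
  fix A B assume "A \<in> sets (distr M N1 U)" "B \<in> sets (distr M N2 W)"
  then have [measurable]: "A \<in> sets N1" "B \<in> sets N2" by auto
  have "(\<lambda>p. (U p, W p)) -` (A \<times> B) \<inter> space M = (U -` A \<inter> space M) \<inter> (W -` B \<inter> space M)" by auto
  then show "emeasure (distr M N1 U) A * emeasure (distr M N2 W) B =
      emeasure (distr M (N1 \<Otimes>\<^sub>M N2) (\<lambda>p. (U p, W p))) (A \<times> B)"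
    using indep[of A B] by (simp add: emeasure_distr emeasure_eq_measure ennreal_mult'')
qed

text \<open>Fubini for the product law of (U, W): W is integrated out with U held fixed. This does
  the work of a conditional expectation given U.\<close>

lemma integral_freeze_indep:
  fixes \<Psi> :: "'u \<times> 'z \<Rightarrow> real"
  assumes U[measurable]: "U \<in> measurable M N1" and W[measurable]: "W \<in> measurable M N2"
    and indep: "\<And>A B. A \<in> sets N1 \<Longrightarrow> B \<in> sets N2 \<Longrightarrow>
      prob ((U -` A \<inter> space M) \<inter> (W -` B \<inter> space M)) = prob (U -` A \<inter> space M) * prob (W -` B \<inter> space M)"
    and [measurable]: "\<Psi> \<in> borel_measurable (N1 \<Otimes>\<^sub>M N2)"
    and int: "integrable M (\<lambda>p. \<Psi> (U p, W p))"
  shows "(\<integral>p. \<Psi> (U p, W p) \<partial>M) = (\<integral>p. (\<integral>z. \<Psi> (U p, z) \<partial>distr M N2 W) \<partial>M)"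
proof -
  interpret U: prob_space "distr M N1 U" by (rule prob_space_distr) fact
  interpret W: prob_space "distr M N2 W" by (rule prob_space_distr) fact
  interpret UW: pair_sigma_finite "distr M N1 U" "distr M N2 W" ..
  have d: "distr M (N1 \<Otimes>\<^sub>M N2) (\<lambda>p. (U p, W p)) = distr M N1 U \<Otimes>\<^sub>M distr M N2 W"
    by (rule distr_Pair_indep[OF U W indep])
  have i: "integrable (distr M N1 U \<Otimes>\<^sub>M distr M N2 W) \<Psi>"
    unfolding d[symmetric] by (subst integrable_distr_eq) (use int in auto)
  have "(\<integral>p. \<Psi> (U p, W p) \<partial>M) = (\<integral>z. \<Psi> z \<partial>(distr M N1 U \<Otimes>\<^sub>M distr M N2 W))"
    unfolding d[symmetric] by (rule integral_distr[symmetric]) auto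
  also have "\<dots> = (\<integral>u. (\<integral>z. \<Psi> (u, z) \<partial>distr M N2 W) \<partial>distr M N1 U)"
    using UW.integral_fst'[OF i] by simp
  also have "\<dots> = (\<integral>p. (\<integral>z. \<Psi> (U p, z) \<partial>distr M N2 W) \<partial>M)"
    by (rule integral_distr) (auto intro!: W.borel_measurable_lebesgue_integral)
  finally show ?thesis .
qed

lemma integrable_mult_square_integrable:
  fixes f g :: "'a \<Rightarrow> real"
  assumes [measurable]: "f \<in> borel_measurable M" "g \<in> borel_measurable M"
    and i: "integrable M (\<lambda>p. (f p)\<^sup>2)" "integrable M (\<lambda>p. (g p)\<^sup>2)"
  shows "integrable M (\<lambda>p. f p * g p)"
proof (rule Bochner_Integration.integrable_bound[OF Bochner_Integration.integrable_add[OF i]])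
  have *: "\<bar>x * y\<bar> \<le> x\<^sup>2 + y\<^sup>2" for x y :: real
    using sum_squares_bound[of "\<bar>x\<bar>" "\<bar>y\<bar>"] abs_ge_zero[of "x * y"]
    unfolding abs_mult power2_abs by linarith
  show "AE p in M. norm (f p * g p) \<le> norm ((f p)\<^sup>2 + (g p)\<^sup>2)"
    using * by simp
qed measurable

end

text \<open>Orthogonality of each increment to all square-integrable functions of the past replaces
  conditional expectations.\<close>

locale L2_martingale = prob_space +
  fixes Fil :: "nat \<Rightarrow> 'a measure" and D :: "nat \<Rightarrow> 'a \<Rightarrow> real"
  assumes sub: "\<And>k. subalgebra M (Fil k)"
    and mono: "\<And>k. sets (Fil k) \<subseteq> sets (Fil (Suc k))"
    and adapted: "\<And>k. D k \<in> borel_measurable (Fil (Suc k))"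
    and square_int: "\<And>k. integrable M (\<lambda>p. (D k p)\<^sup>2)"
    and orth: "\<And>k \<phi>. \<phi> \<in> borel_measurable (Fil k) \<Longrightarrow> integrable M (\<lambda>p. (\<phi> p)\<^sup>2) \<Longrightarrow>
      (\<integral>p. \<phi> p * D k p \<partial>M) = 0"
begin

lemma mono_le: "j \<le> k \<Longrightarrow> sets (Fil j) \<subseteq> sets (Fil k)"
  by (rule lift_Suc_mono_le[of "\<lambda>k. sets (Fil k)"]) (use mono in auto)

lemma space_Fil: "space (Fil k) = space M"
  using sub[of k] by (simp add: subalgebra_def)

lemma measurable_Fil_mono:
  assumes "f \<in> borel_measurable (Fil j)" "j \<le> k"
  shows "f \<in> borel_measurable (Fil k)"
  using assms mono_le[of j k] by (auto simp: measurable_def space_Fil)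

lemma D_measurable_Fil: "j < k \<Longrightarrow> D j \<in> borel_measurable (Fil k)"
  using measurable_Fil_mono[OF adapted[of j], of k] by simp

lemma D_measurable[measurable]: "D j \<in> borel_measurable M"
  using measurable_from_subalg[OF sub adapted] .

definition part :: "nat \<Rightarrow> 'a \<Rightarrow> real" where "part n p = (\<Sum>i<n. D i p)"

lemma part_measurable_Fil: "n \<le> k \<Longrightarrow> part n \<in> borel_measurable (Fil k)"
  unfolding part_def[abs_def] by (intro borel_measurable_sum D_measurable_Fil) auto

lemma part_measurable[measurable]: "part n \<in> borel_measurable M"
  using measurable_from_subalg[OF sub part_measurable_Fil[OF order_refl]] .

lemma shift: "L2_martingale M (\<lambda>k. Fil (m + k)) (\<lambda>k. D (m + k))"
  by unfold_locales (use sub mono adapted square_int orth in auto)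

text \<open>Kolmogorov's maximal inequality: the martingale stopped at the first exit from
  \<open>(-c, c)\<close> has no larger second moment and stays at the value attained at the exit.\<close>

definition alive :: "real \<Rightarrow> nat \<Rightarrow> 'a \<Rightarrow> real" where "alive c n p = (if \<forall>j\<le>n. \<bar>part j p\<bar> < c then 1 else 0 :: real)"

primrec stopped :: "real \<Rightarrow> nat \<Rightarrow> 'a \<Rightarrow> real" where
  "stopped c 0 p = 0"
| "stopped c (Suc n) p = stopped c n p + alive c n p * D n p"

lemma alive_measurable_Fil: "alive c n \<in> borel_measurable (Fil n)"
proof -
  have [measurable]: "\<And>j. j \<in> {..n} \<Longrightarrow> part j \<in> borel_measurable (Fil n)"
    by (rule part_measurable_Fil) auto
  have "alive c n = (\<lambda>p. \<Prod>j\<in>{..n}. if \<bar>part j p\<bar> < c then 1 else 0)"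
    by (auto simp: alive_def fun_eq_iff)
  also have "\<dots> \<in> borel_measurable (Fil n)"
    by (intro borel_measurable_prod) measurable
  finally show ?thesis .
qed

lemma stopped_measurable_Fil: "stopped c n \<in> borel_measurable (Fil n)"
proof (induction n)
  case (Suc n)
  have "stopped c n \<in> borel_measurable (Fil (Suc n))" "alive c n \<in> borel_measurable (Fil (Suc n))"
    using measurable_Fil_mono[OF Suc] measurable_Fil_mono[OF alive_measurable_Fil] by auto
  then show ?case using adapted[of n] by simp
qed simp

lemma stopped_measurable[measurable]: "stopped c n \<in> borel_measurable M"
  and alive_measurable[measurable]: "alive c n \<in> borel_measurable M"
  using measurable_from_subalg[OF sub stopped_measurable_Fil]
    measurable_from_subalg[OF sub alive_measurable_Fil] by auto

lemma integrable_mult_alive: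
  fixes g :: "'a \<Rightarrow> real"
  assumes "integrable M g"
  shows "integrable M (\<lambda>p. alive c n p * g p)"
  using assms(1) by (rule Bochner_Integration.integrable_bound)
    (use assms in \<open>auto simp: alive_def\<close>)

text \<open>The product of \<open>stopped\<close> and \<open>alive\<close> depends on the past only,
  so the cross term vanishes by orthogonality. The weight \<open>alive\<close> is 0 or 1 and can
  only shrink the square of the increment.\<close>

lemma stopped_second_moment:
  "integrable M (\<lambda>p. (stopped c n p)\<^sup>2) \<and>
   (\<integral>p. (stopped c n p)\<^sup>2 \<partial>M) \<le> (\<Sum>i<n. \<integral>p. (D i p)\<^sup>2 \<partial>M)"
proof (induction n)
  case (Suc n)
  have al2: "(alive c n p)\<^sup>2 = alive c n p" for p by (simp add: alive_def)
  have al1: "alive c n p \<le> 1" for p by (simp add: alive_def)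
  let ?\<phi> = "\<lambda>p. stopped c n p * alive c n p"
  have \<phi>: "?\<phi> \<in> borel_measurable (Fil n)"
    by (intro borel_measurable_times stopped_measurable_Fil alive_measurable_Fil)
  have \<phi>2: "integrable M (\<lambda>p. (?\<phi> p)\<^sup>2)"
    using integrable_mult_alive[of "\<lambda>p. (stopped c n p)\<^sup>2"] Suc by (simp add: power_mult_distrib al2 mult.commute)
  have o: "(\<integral>p. ?\<phi> p * D n p \<partial>M) = 0" by (rule orth[OF \<phi> \<phi>2])
  have iD: "integrable M (\<lambda>p. alive c n p * (D n p)\<^sup>2)"
    by (rule integrable_mult_alive[OF square_int])
  have ic: "integrable M (\<lambda>p. ?\<phi> p * D n p)"
    by (rule integrable_mult_square_integrable[OF _ _ \<phi>2 square_int]) measurable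
  have e: "(stopped c (Suc n) p)\<^sup>2 = (stopped c n p)\<^sup>2 + alive c n p * (D n p)\<^sup>2 + 2 * (?\<phi> p * D n p)" for p
    by (simp add: power2_sum power_mult_distrib al2)
  have "(\<integral>p. (stopped c (Suc n) p)\<^sup>2 \<partial>M) = (\<integral>p. (stopped c n p)\<^sup>2 \<partial>M) + (\<integral>p. alive c n p * (D n p)\<^sup>2 \<partial>M) + 2 * 0"
    unfolding e o[symmetric] using Suc iD ic by simp
  also have "(\<integral>p. alive c n p * (D n p)\<^sup>2 \<partial>M) \<le> (\<integral>p. (D n p)\<^sup>2 \<partial>M)"
    by (rule integral_mono[OF iD square_int]) (use al1 in \<open>auto intro: mult_left_le_one_le simp: alive_def\<close>)
  finally show ?case unfolding e using Suc iD ic by auto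
qed simp

text \<open>The test in \<open>alive\<close> precedes the addition of the increment. Hence the
  increment that causes the exit is still counted, and all later ones are dropped.\<close>

lemma stopped_cases:
  "(if \<exists>j\<le>n. \<bar>part j p\<bar> \<ge> c then \<bar>stopped c n p\<bar> \<ge> c else stopped c n p = part n p)"
proof (induction n)
  case 0
  then show ?case by (simp add: part_def)
next
  case (Suc n)
  have part_Suc: "part (Suc n) p = part n p + D n p" by (simp add: part_def)
  show ?case
  proof (cases "\<exists>j\<le>n. \<bar>part j p\<bar> \<ge> c")
    case True
    then have "alive c n p = 0" by (auto simp: alive_def not_less)
    moreover have "\<exists>j\<le>Suc n. \<bar>part j p\<bar> \<ge> c" using True le_SucI by blast
    ultimately show ?thesis using Suc True by simp
  next
    case False
    then have "alive c n p = 1" by (auto simp: alive_def not_le)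
    then have "stopped c (Suc n) p = part (Suc n) p" using Suc False by (simp add: part_Suc)
    moreover have "(\<exists>j\<le>Suc n. \<bar>part j p\<bar> \<ge> c) \<longleftrightarrow> \<bar>part (Suc n) p\<bar> \<ge> c"
      using False by (auto simp: le_Suc_eq)
    ultimately show ?thesis by simp
  qed
qed

lemma maximal_inequality:
  assumes "c > 0"
  shows "prob {p \<in> space M. \<exists>j\<le>n. \<bar>part j p\<bar> \<ge> c} \<le> (\<Sum>i<n. \<integral>p. (D i p)\<^sup>2 \<partial>M) / c\<^sup>2"
proof -
  have "prob {p \<in> space M. \<exists>j\<le>n. \<bar>part j p\<bar> \<ge> c} \<le> prob {p \<in> space M. (stopped c n p)\<^sup>2 \<ge> c\<^sup>2}"
  proof (rule finite_measure_mono)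
    show "{p \<in> space M. \<exists>j\<le>n. \<bar>part j p\<bar> \<ge> c} \<subseteq> {p \<in> space M. (stopped c n p)\<^sup>2 \<ge> c\<^sup>2}"
    proof safe
      fix p j assume "j \<le> n" "c \<le> \<bar>part j p\<bar>"
      then have "c \<le> \<bar>stopped c n p\<bar>" using stopped_cases[where n=n and p=p and c=c] by (auto split: if_splits)
      then show "c\<^sup>2 \<le> (stopped c n p)\<^sup>2" using assms abs_le_square_iff[of c] by simp
    qed
  qed measurable
  also have "\<dots> \<le> (\<integral>p. (stopped c n p)\<^sup>2 \<partial>M) / c\<^sup>2"
    using stopped_second_moment[of c n] assms
    by (intro integral_Markov_inequality_measure[where A="{}"]) auto
  also have "\<dots> \<le> (\<Sum>i<n. \<integral>p. (D i p)\<^sup>2 \<partial>M) / c\<^sup>2"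
    using stopped_second_moment[of c n] assms by (intro divide_right_mono) auto
  finally show ?thesis .
qed

lemma maximal_inequality_infinite:
  assumes "c > 0" and sm: "summable (\<lambda>i. \<integral>p. (D i p)\<^sup>2 \<partial>M)"
  shows "prob {p \<in> space M. \<exists>j. \<bar>part j p\<bar> \<ge> c} \<le> (\<Sum>i. \<integral>p. (D i p)\<^sup>2 \<partial>M) / c\<^sup>2"
proof -
  let ?A = "\<lambda>n. {p \<in> space M. \<exists>j\<le>n. \<bar>part j p\<bar> \<ge> c}"
  have "(\<lambda>n. prob (?A n)) \<longlonglongrightarrow> prob (\<Union>n. ?A n)"
    by (rule finite_Lim_measure_incseq) (auto simp: incseq_def intro: order_trans)
  moreover have "(\<Union>n. ?A n) = {p \<in> space M. \<exists>j. \<bar>part j p\<bar> \<ge> c}" by auto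
  moreover have "prob (?A n) \<le> (\<Sum>i. \<integral>p. (D i p)\<^sup>2 \<partial>M) / c\<^sup>2" for n
    using maximal_inequality[OF assms(1), of n] assms
    by (elim order_trans) (auto intro!: divide_right_mono sum_le_suminf)
  ultimately show ?thesis by (intro LIMSEQ_le_const2[of "\<lambda>n. prob (?A n)"]) auto
qed

text \<open>The maximal inequality, applied to the martingale restarted at m, bounds the chance of
  an oscillation of size c after m by a tail sum over c^2. Tails tend to 0, so almost surely some m
  has no such oscillation. Countably many c then give the Cauchy property.\<close>

theorem AE_convergent:
  assumes sm: "summable (\<lambda>i. \<integral>p. (D i p)\<^sup>2 \<partial>M)"
  shows "AE p in M. convergent (\<lambda>n. part n p)"
proof -
  let ?T = "\<lambda>m. \<Sum>i. \<integral>p. (D (m + i) p)\<^sup>2 \<partial>M"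
  have T: "?T \<longlonglongrightarrow> 0"
    using suminf_exist_split2[OF sm] by (simp add: add.commute)
  have sm': "summable (\<lambda>i. \<integral>p. (D (m + i) p)\<^sup>2 \<partial>M)" for m
    using summable_ignore_initial_segment[OF sm, of m] by (simp add: add.commute)
  define B where "B = (\<lambda>c m. {p \<in> space M. \<exists>j. \<bar>part (m + j) p - part m p\<bar> \<ge> c})"
  have Bm[measurable]: "B c m \<in> sets M" for c m unfolding B_def by measurable
  have pB: "prob (B c m) \<le> ?T m / c\<^sup>2" if "c > 0" for c m
  proof -
    interpret sh: L2_martingale M "\<lambda>k. Fil (m + k)" "\<lambda>k. D (m + k)" by (rule shift)
    have "sh.part j p = part (m + j) p - part m p" for j p
      unfolding sh.part_def part_def by (induction j) auto
    then show ?thesis using sh.maximal_inequality_infinite[OF that sm'[of m]] by (simp add: B_def)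
  qed
  have AE1: "AE p in M. \<exists>m. p \<notin> B c m" if "c > 0" for c
  proof -
    have "prob (\<Inter>m. B c m) \<le> 0"
    proof (rule LIMSEQ_le_const)
      show "(\<lambda>m. ?T m / c\<^sup>2) \<longlonglongrightarrow> 0" using tendsto_divide[OF T tendsto_const, of "c\<^sup>2"] that by simp
      have "prob (\<Inter>m. B c m) \<le> prob (B c m)" for m
        by (rule finite_measure_mono) auto
      then show "\<exists>N. \<forall>n\<ge>N. prob (\<Inter>m. B c m) \<le> ?T n / c\<^sup>2"
        using pB[OF that] order_trans by blast
    qed
    then have "(\<Inter>m. B c m) \<in> null_sets M"
      by (auto simp: measure_le_0_iff emeasure_eq_measure)
    from AE_not_in[OF this] show ?thesis by simp
  qed
  have "AE p in M. \<forall>q::nat. \<exists>m. p \<notin> B (1 / real (Suc q)) m"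
    unfolding AE_all_countable by (intro allI AE1) simp
  then show ?thesis
  proof (rule AE_mp, intro AE_I2 impI)
    fix p assume p: "p \<in> space M" and *: "\<forall>q::nat. \<exists>m. p \<notin> B (1 / real (Suc q)) m"
    have "Cauchy (\<lambda>n. part n p)"
      unfolding Cauchy_altdef2
    proof (intro allI impI)
      fix e :: real assume "e > 0"
      then obtain q where q: "1 / real (Suc q) < e" using nat_approx_posE by blast
      obtain m where m: "p \<notin> B (1 / real (Suc q)) m" using * by auto
      have "dist (part n p) (part m p) < e" if "n \<ge> m" for n
      proof -
        have "\<bar>part (m + (n - m)) p - part m p\<bar> < 1 / real (Suc q)"
          using m p unfolding B_def by (auto simp: not_le simp del: of_nat_Suc)
        then show ?thesis using q that by (simp add: dist_real_def)
      qed
      then show "\<exists>N. \<forall>n\<ge>N. dist (part n p) (part N p) < e" by blast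
    qed
    then show "convergent (\<lambda>n. part n p)" by (rule Cauchy_convergent)
  qed
qed

end

section \<open>The stochastic oracle\<close>

text \<open>The Boolean index separates directions (\<open>True\<close>) from second-stage samples
  (\<open>False\<close>). Recording preimages instead of variables lets both, with their different
  value spaces, form a single independent family.\<close>

definition (in prob_space) noise_sets ::
    "(nat \<Rightarrow> 'a \<Rightarrow> 'v::topological_space) \<Rightarrow> 'w measure \<Rightarrow> (nat \<Rightarrow> 'a \<Rightarrow> 'w) \<Rightarrow> bool \<times> nat \<Rightarrow> 'a set set" where
  "noise_sets v S w = (\<lambda>(b, k). if b then {v k -` A \<inter> space M | A. A \<in> sets borel}
     else {w k -` B \<inter> space M | B. B \<in> sets S})"

context prob_space
begin

lemma prob_indep_vars_finite:
  assumes X: "indep_vars (\<lambda>_. N) X UNIV" and K: "finite K" and B: "\<And>k. k \<in> K \<Longrightarrow> B k \<in> sets N"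
  shows "prob {p \<in> space M. \<forall>k\<in>K. X k p \<in> B k} = (\<Prod>k\<in>K. prob (X k -` B k \<inter> space M))"
\<comment> \<open>An intersection over the empty set is \<open>UNIV\<close>, not
  \<open>space M\<close>. Stating the event by comprehension covers this case, which arises when
  only one kind of noise is involved.\<close>
proof (cases "K = {}")
  case True
  then show ?thesis by (simp add: prob_space)
next
  case False
  have "prob (\<Inter>k\<in>K. X k -` B k \<inter> space M) = (\<Prod>k\<in>K. prob (X k -` B k \<inter> space M))"
    by (rule indep_varsD_finite[OF indep_vars_subset[OF X]]) (use False K B in auto)
  also have "(\<Inter>k\<in>K. X k -` B k \<inter> space M) = {p \<in> space M. \<forall>k\<in>K. X k p \<in> B k}"
    using False by auto
  finally show ?thesis .
qed

text \<open>A finite choice of events splits into a direction part and a sample part. Independence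
  of the two whole sequences separates the parts, and independence inside each sequence factorizes
  them.\<close>

lemma indep_sets_noise:
  fixes v :: "nat \<Rightarrow> 'a \<Rightarrow> 'v::topological_space"
  assumes v: "indep_vars (\<lambda>_. borel) v UNIV" and w: "indep_vars (\<lambda>_. S) w UNIV"
    and vw: "indep_random_variables M (Pi\<^sub>M UNIV (\<lambda>_. borel)) (\<lambda>p k. v k p) (Pi\<^sub>M UNIV (\<lambda>_. S)) (\<lambda>p k. w k p)"
  shows "indep_sets (noise_sets v S w) UNIV"
proof (rule indep_setsI)
  have vm[measurable]: "\<And>k. v k \<in> borel_measurable M" and wm[measurable]: "\<And>k. w k \<in> measurable M S"
    using v w by (auto simp: indep_vars_def2)
  have ind: "indep_set {(\<lambda>p k. v k p) -` A \<inter> space M | A. A \<in> sets (Pi\<^sub>M UNIV (\<lambda>_. borel))}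
     {(\<lambda>p k. w k p) -` B \<inter> space M | B. B \<in> sets (Pi\<^sub>M UNIV (\<lambda>_. S))}"
    using vw unfolding indep_random_variables_def by blast
  show "noise_sets v S w i \<subseteq> events" for i
    by (auto simp: noise_sets_def split: prod.splits if_splits)
  fix A J assume J: "J \<noteq> {}" "finite J" and A: "\<forall>j\<in>J. A j \<in> noise_sets v S w j"
  define JT where "JT = {k. (True, k) \<in> J}"
  define JF where "JF = {k. (False, k) \<in> J}"
  have Jeq: "J = Pair True ` JT \<union> Pair False ` JF"
    unfolding JT_def JF_def by (auto simp: image_iff; metis (full_types))
  have fin: "finite JT" "finite JF"
    using J(2) unfolding Jeq by (auto dest: finite_imageD simp: inj_on_def)
  have "\<forall>k\<in>JT. \<exists>B. B \<in> sets borel \<and> A (True, k) = v k -` B \<inter> space M"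
    using A by (force simp: JT_def noise_sets_def)
  then obtain BT where BT: "\<And>k. k \<in> JT \<Longrightarrow> BT k \<in> sets borel" "\<And>k. k \<in> JT \<Longrightarrow> A (True, k) = v k -` BT k \<inter> space M"
    by metis
  have "\<forall>k\<in>JF. \<exists>B. B \<in> sets S \<and> A (False, k) = w k -` B \<inter> space M"
    using A by (force simp: JF_def noise_sets_def)
  then obtain BF where BF: "\<And>k. k \<in> JF \<Longrightarrow> BF k \<in> sets S" "\<And>k. k \<in> JF \<Longrightarrow> A (False, k) = w k -` BF k \<inter> space M"
    by metis
  define PT where "PT = {p \<in> space M. \<forall>k\<in>JT. v k p \<in> BT k}"
  define PF where "PF = {p \<in> space M. \<forall>k\<in>JF. w k p \<in> BF k}"
  have "(\<Inter>j\<in>J. A j) = PT \<inter> PF"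
  proof -
    have "(\<Inter>j\<in>J. A j) = (\<Inter>k\<in>JT. A (True, k)) \<inter> (\<Inter>k\<in>JF. A (False, k))" unfolding Jeq by auto
    moreover have "JT \<noteq> {} \<or> JF \<noteq> {}" using J(1) unfolding Jeq by auto
    ultimately show ?thesis unfolding PT_def PF_def using BT(2) BF(2) by auto
  qed
  moreover have "prob (PT \<inter> PF) = prob PT * prob PF"
  proof (rule indep_setD[OF ind])
    let ?C = "{f \<in> space (Pi\<^sub>M UNIV (\<lambda>_. borel)). \<forall>k\<in>JT. f k \<in> BT k}"
    have "?C \<in> sets (Pi\<^sub>M UNIV (\<lambda>_. borel))"
      using BT(1) fin by (intro sets.sets_Collect_finite_All) auto
    moreover have "PT = (\<lambda>p k. v k p) -` ?C \<inter> space M"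
      by (auto simp: PT_def space_PiM)
    ultimately show "PT \<in> {(\<lambda>p k. v k p) -` A \<inter> space M | A. A \<in> sets (Pi\<^sub>M UNIV (\<lambda>_. borel))}" by blast
    let ?C = "{f \<in> space (Pi\<^sub>M UNIV (\<lambda>_. S)). \<forall>k\<in>JF. f k \<in> BF k}"
    have "?C \<in> sets (Pi\<^sub>M UNIV (\<lambda>_. S))"
      using BF(1) fin by (intro sets.sets_Collect_finite_All) auto
    moreover have "PF = (\<lambda>p k. w k p) -` ?C \<inter> space M"
      using measurable_space[OF wm] by (auto simp: PF_def space_PiM)
    ultimately show "PF \<in> {(\<lambda>p k. w k p) -` A \<inter> space M | A. A \<in> sets (Pi\<^sub>M UNIV (\<lambda>_. S))}" by blast
  qed
  moreover have "prob PT = (\<Prod>k\<in>JT. prob (A (True, k)))"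
    unfolding PT_def by (subst prob_indep_vars_finite[OF v fin(1) BT(1)]) (auto simp: BT(2) intro!: prod.cong)
  moreover have "prob PF = (\<Prod>k\<in>JF. prob (A (False, k)))"
    unfolding PF_def by (subst prob_indep_vars_finite[OF w fin(2) BF(1)]) (auto simp: BF(2) intro!: prod.cong)
  moreover have "(\<Prod>j\<in>J. prob (A j)) = (\<Prod>k\<in>JT. prob (A (True, k))) * (\<Prod>k\<in>JF. prob (A (False, k)))"
    unfolding Jeq by (subst prod.union_disjoint) (auto simp: fin prod.reindex inj_on_def)
  ultimately show "prob (\<Inter>j\<in>J. A j) = (\<Prod>j\<in>J. prob (A j))" by simp
qed

end

text \<open>The problem reduced to its sampled implicit objective \<open>h\<close>: \<open>Q\<close>
  is the law of one sample, \<open>E\<close> the enlarged feasible set that contains all query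
  points, \<open>l\<close> the random Lipschitz constant.\<close>

locale zeroth_order_scheme = prob_space M for M :: "'p measure" +
  fixes Q :: "'w measure" and X E :: "(real^'n) set" and h :: "real^'n \<Rightarrow> 'w \<Rightarrow> real"
    and l :: "'w \<Rightarrow> real" and L0 :: real and F :: "real^'n \<Rightarrow> real"
    and \<gamma> \<eta> :: "nat \<Rightarrow> real" and v :: "nat \<Rightarrow> 'p \<Rightarrow> real^'n" and w :: "nat \<Rightarrow> 'p \<Rightarrow> 'w"
    and x :: "nat \<Rightarrow> 'p \<Rightarrow> real^'n" and x0 :: "real^'n"
  assumes Q: "prob_space Q"
    and X: "X \<noteq> {}" "compact X" "convex X"
    and closed_E: "closed E"
    and cball_E: "\<And>z k. z \<in> X \<Longrightarrow> cball z (\<eta> k) \<subseteq> E"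
    and \<gamma>_pos: "\<And>k. \<gamma> k > 0" and \<eta>_pos: "\<And>k. \<eta> k > 0"
    and h_meas: "\<And>z. z \<in> E \<Longrightarrow> h z \<in> borel_measurable Q"
    and h_int: "\<And>z. z \<in> X \<Longrightarrow> integrable Q (h z)"
    and h_lip: "\<And>\<omega>. \<omega> \<in> space Q \<Longrightarrow> (l \<omega>)-lipschitz_on E (\<lambda>z. h z \<omega>)"
    and l_meas[measurable]: "l \<in> borel_measurable Q"
    and l_int: "integrable Q (\<lambda>\<omega>. (l \<omega>)\<^sup>2)"
    and L0_def: "L0 = sqrt (\<integral>\<omega>. (l \<omega>)\<^sup>2 \<partial>Q)"
    and F_def: "\<And>z. z \<in> E \<Longrightarrow> F z = (\<integral>\<omega>. h z \<omega> \<partial>Q)"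
    and F_conv: "convex_on E F"
    and indep: "indep_sets (noise_sets v Q w) UNIV"
    and v_meas[measurable]: "\<And>k. v k \<in> borel_measurable M"
    and w_meas[measurable]: "\<And>k. w k \<in> measurable M Q"
    and v_sphere: "\<And>k p. p \<in> space M \<Longrightarrow> norm (v k p) = \<eta> k"
    and v_unif: "\<And>k. distr M borel (v k) = uniform_sphere (\<eta> k)"
    and w_law: "\<And>k. distr M Q (w k) = Q"
    and x0: "x0 \<in> X"
    and x_0: "\<And>p. x 0 p = x0"
    and x_Suc: "\<And>k p. x (Suc k) p =
      closest_point X (x k p - \<gamma> k *\<^sub>R zo_gradient (\<lambda>z. h z (w k p)) (\<eta> k) (x k p) (v k p))"
begin

sublocale Q: prob_space Q by (rule Q)

lemma X_sub_E: "X \<subseteq> E"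
proof
  fix z assume "z \<in> X"
  then show "z \<in> E" using cball_E[of z 0] \<eta>_pos[of 0] by (auto simp: subset_iff)
qed

lemma E_props: "E \<noteq> {}" "convex E"
  using X_sub_E X(1) convex_on_imp_convex[OF F_conv] by auto

text \<open>The assumptions only control the sampled objective on \<open>E\<close>. Composing it with the projection
  onto \<open>E\<close> gives a Caratheodory function on the whole space, hence joint measurability.\<close>

definition proj :: "real^'n \<Rightarrow> real^'n" where "proj = closest_point E"
definition h' :: "real^'n \<Rightarrow> 'w \<Rightarrow> real" where "h' z \<omega> = h (proj z) \<omega>"

lemma proj_in: "proj z \<in> E" and proj_id: "z \<in> E \<Longrightarrow> proj z = z"
  unfolding proj_def using closest_point_in_set[OF closed_E E_props(1)] closest_point_self by auto

lemma proj_lipschitz: "dist (proj a) (proj b) \<le> dist a b"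
  unfolding proj_def by (rule closest_point_lipschitz[OF E_props(2) closed_E E_props(1)])

lemma h'_eq: "z \<in> E \<Longrightarrow> h' z = h z" by (auto simp: h'_def proj_id)

lemma h'_lip: "\<omega> \<in> space Q \<Longrightarrow> \<bar>h' a \<omega> - h' b \<omega>\<bar> \<le> l \<omega> * norm (a - b)"
proof -
  assume \<omega>: "\<omega> \<in> space Q"
  have "\<bar>h' a \<omega> - h' b \<omega>\<bar> \<le> l \<omega> * dist (proj a) (proj b)"
    using lipschitz_onD[OF h_lip[OF \<omega>] proj_in proj_in, of a b] by (simp add: h'_def dist_real_def)
  also have "\<dots> \<le> l \<omega> * dist a b"
    by (intro mult_left_mono proj_lipschitz lipschitz_on_nonneg[OF h_lip[OF \<omega>]])
  finally show ?thesis by (simp add: dist_norm)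
qed

lemma l_nonneg: "\<omega> \<in> space Q \<Longrightarrow> 0 \<le> l \<omega>"
  using lipschitz_on_nonneg[OF h_lip] .

lemma h'_meas1[measurable]: "h' z \<in> borel_measurable Q"
  unfolding h'_def[abs_def] by (rule h_meas[OF proj_in])

lemma h'_cont: "\<omega> \<in> space Q \<Longrightarrow> continuous_on UNIV (\<lambda>z. h' z \<omega>)"
  by (rule lipschitz_on_continuous_on[of "l \<omega>"])
     (auto intro!: lipschitz_onI h'_lip l_nonneg simp: dist_norm)

lemma h'_meas: "(\<lambda>(z, \<omega>). h' z \<omega>) \<in> borel_measurable (borel \<Otimes>\<^sub>M Q)"
  by (rule borel_measurable_Caratheodory) (auto intro: h'_cont)

lemma h'_meas_compose[measurable (raw)]:
  assumes "f \<in> borel_measurable N" "g \<in> measurable N Q"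
  shows "(\<lambda>z. h' (f z) (g z)) \<in> borel_measurable N"
  using measurable_compose[OF measurable_Pair[OF assms] h'_meas] by simp

lemma l_integrable: "integrable Q l"
  by (rule Q.square_integrable_imp_integrable[OF l_meas l_int])

lemma L0_nonneg: "L0 \<ge> 0" and L0_sq: "L0\<^sup>2 = (\<integral>\<omega>. (l \<omega>)\<^sup>2 \<partial>Q)"
  by (auto simp: L0_def)

text \<open>Variance is nonnegative. The Lipschitz constant of the expected objective is the mean of
  \<open>l\<close>, whereas the bounds are expressed by the root mean square.\<close>

lemma l_mean_le: "(\<integral>\<omega>. l \<omega> \<partial>Q) \<le> L0"
proof -
  have "(\<integral>\<omega>. l \<omega> \<partial>Q)\<^sup>2 \<le> L0\<^sup>2"
    using Q.variance_eq[OF l_integrable l_int] Q.variance_positive[of l] by (simp add: L0_sq)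
  then show ?thesis using L0_nonneg by (rule power2_le_imp_le)
qed

text \<open>Integrability is given on X only; elsewhere the difference to a point of X is dominated
  by a multiple of \<open>l\<close>.\<close>

lemma h'_int: "integrable Q (h' z)"
proof -
  obtain z0 where z0: "z0 \<in> X" using X(1) by auto
  have i0: "integrable Q (h' z0)" using h_int[OF z0] h'_eq[of z0] X_sub_E z0 by auto
  have "integrable Q (\<lambda>\<omega>. h' z \<omega> - h' z0 \<omega>)"
  proof (rule Bochner_Integration.integrable_bound[OF integrable_mult_right[OF l_integrable, of "norm (z - z0)"]])
    show "AE \<omega> in Q. norm (h' z \<omega> - h' z0 \<omega>) \<le> norm (norm (z - z0) * l \<omega>)"
      using h'_lip[of _ z z0] l_nonneg by (auto intro!: AE_I2 simp: mult.commute)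
  qed measurable
  from Bochner_Integration.integrable_add[OF this i0] show ?thesis by simp
qed

text \<open>Unlike \<open>F\<close>, which is only controlled on \<open>E\<close>, this extension is
  Lipschitz on the whole space, so it is continuous and measurable everywhere.\<close>

definition F' :: "real^'n \<Rightarrow> real" where "F' z = (\<integral>\<omega>. h' z \<omega> \<partial>Q)"

lemma F'_eq: "z \<in> E \<Longrightarrow> F' z = F z" by (simp add: F'_def F_def h'_eq)

lemma F'_lip: "\<bar>F' a - F' b\<bar> \<le> L0 * norm (a - b)"
proof -
  have "F' a - F' b = (\<integral>\<omega>. h' a \<omega> - h' b \<omega> \<partial>Q)" unfolding F'_def using h'_int by simp
  also have "\<bar>\<dots>\<bar> \<le> (\<integral>\<omega>. \<bar>h' a \<omega> - h' b \<omega>\<bar> \<partial>Q)" by (rule integral_abs_bound)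
  also have "\<dots> \<le> (\<integral>\<omega>. l \<omega> * norm (a - b) \<partial>Q)"
    by (rule integral_mono_AE) (auto intro!: AE_I2 h'_lip h'_int l_integrable)
  also have "\<dots> = (\<integral>\<omega>. l \<omega> \<partial>Q) * norm (a - b)" by simp
  also have "\<dots> \<le> L0 * norm (a - b)" by (intro mult_right_mono l_mean_le) auto
  finally show ?thesis .
qed

lemma F'_cont: "continuous_on A F'"
  by (rule lipschitz_on_continuous_on[of L0]) (auto intro!: lipschitz_onI F'_lip L0_nonneg simp: dist_norm)

lemma F'_meas[measurable]: "F' \<in> borel_measurable borel"
  by (rule borel_measurable_continuous_onI[OF F'_cont])

lemma F'_conv: "convex_on E F'"
  using F_conv E_props(2) unfolding convex_on_def by (auto simp: F'_eq convexD)

section \<open>The mean of the estimator at a frozen iterate\<close>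

definition Z :: "nat \<Rightarrow> 'p \<Rightarrow> (real^'n) \<times> 'w" where "Z k p = (v k p, w k p)"

definition g :: "nat \<Rightarrow> real^'n \<Rightarrow> (real^'n) \<times> 'w \<Rightarrow> real^'n" where
  "g k z = (\<lambda>(u, \<omega>). zo_gradient (\<lambda>z. h' z \<omega>) (\<eta> k) z u)"

text \<open>Evaluated at \<open>x k p\<close>, this plays the role of the conditional mean of the
  estimator given the past.\<close>

definition m :: "nat \<Rightarrow> real^'n \<Rightarrow> real^'n" where
  "m k z = (\<integral>s. g k z s \<partial>distr M (borel \<Otimes>\<^sub>M Q) (Z k))"

lemma Z_meas[measurable]: "Z k \<in> measurable M (borel \<Otimes>\<^sub>M Q)"
  unfolding Z_def[abs_def] by measurable

lemma Z_law: "distr M (borel \<Otimes>\<^sub>M Q) (Z k) = uniform_sphere (\<eta> k) \<Otimes>\<^sub>M Q"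
proof -
  have "distr M (borel \<Otimes>\<^sub>M Q) (\<lambda>p. (v k p, w k p)) = distr M borel (v k) \<Otimes>\<^sub>M distr M Q (w k)"
  proof (rule distr_Pair_indep[OF v_meas w_meas])
    fix A :: "(real^'n) set" and B assume AB: "A \<in> sets borel" "B \<in> sets Q"
    have "prob (\<Inter>i\<in>{(True, k), (False, k)}. case i of (b, _) \<Rightarrow> if b then v k -` A \<inter> space M else w k -` B \<inter> space M)
      = (\<Prod>i\<in>{(True, k), (False, k)}. prob (case i of (b, _) \<Rightarrow> if b then v k -` A \<inter> space M else w k -` B \<inter> space M))"
      by (rule indep_setsD[OF indep]) (use AB in \<open>auto simp: noise_sets_def\<close>)
    then show "prob ((v k -` A \<inter> space M) \<inter> (w k -` B \<inter> space M)) = prob (v k -` A \<inter> space M) * prob (w k -` B \<inter> space M)"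
      by simp
  qed
  then show ?thesis unfolding Z_def[abs_def] v_unif w_law .
qed

lemma g_meas: "(\<lambda>(z, s). g k z s) \<in> borel_measurable (borel \<Otimes>\<^sub>M (borel \<Otimes>\<^sub>M Q))"
  unfolding g_def zo_gradient_def split_beta by measurable

lemma g_meas_compose[measurable (raw)]:
  assumes "f1 \<in> borel_measurable N" "f2 \<in> measurable N (borel \<Otimes>\<^sub>M Q)"
  shows "(\<lambda>z. g k (f1 z) (f2 z)) \<in> borel_measurable N"
  using measurable_compose[OF measurable_Pair[OF assms] g_meas] by simp

lemma g_bound:
  assumes u: "norm u = \<eta> k" and \<omega>: "\<omega> \<in> space Q"
  shows "norm (g k z (u, \<omega>)) \<le> CARD('n) * l \<omega>"
proof -
  have "norm (g k z (u, \<omega>)) = CARD('n) / \<eta> k * \<bar>h' (z + u) \<omega> - h' z \<omega>\<bar>"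
    using u \<eta>_pos[of k] by (simp add: g_def zo_gradient_def abs_mult)
  also have "\<dots> \<le> CARD('n) / \<eta> k * (l \<omega> * norm u)"
    using h'_lip[OF \<omega>, of "z + u" z] \<eta>_pos[of k] by (intro mult_left_mono) auto
  also have "\<dots> = CARD('n) * l \<omega>" using u \<eta>_pos[of k] by simp
  finally show ?thesis .
qed

lemma g_Z_bound: "p \<in> space M \<Longrightarrow> norm (g k z (Z k p)) \<le> CARD('n) * l (w k p)"
  unfolding Z_def using measurable_space[OF w_meas] by (intro g_bound v_sphere) auto

lemma l_w_int:
  shows "integrable M (\<lambda>p. l (w k p))" "integrable M (\<lambda>p. (l (w k p))\<^sup>2)"
    and "(\<integral>p. l (w k p) \<partial>M) = (\<integral>\<omega>. l \<omega> \<partial>Q)" "(\<integral>p. (l (w k p))\<^sup>2 \<partial>M) = L0\<^sup>2"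
proof -
  show "integrable M (\<lambda>p. l (w k p))" "integrable M (\<lambda>p. (l (w k p))\<^sup>2)"
    using integrable_distr[OF w_meas[of k], of l] integrable_distr[OF w_meas[of k], of "\<lambda>\<omega>. (l \<omega>)\<^sup>2"]
      l_integrable l_int unfolding w_law by auto
  show "(\<integral>p. l (w k p) \<partial>M) = (\<integral>\<omega>. l \<omega> \<partial>Q)" "(\<integral>p. (l (w k p))\<^sup>2 \<partial>M) = L0\<^sup>2"
    using integral_distr[OF w_meas[of k], of l] integral_distr[OF w_meas[of k], of "\<lambda>\<omega>. (l \<omega>)\<^sup>2"]
    unfolding w_law L0_sq by auto
qed

lemma m_eq: "m k z = (\<integral>p. g k z (Z k p) \<partial>M)"
  unfolding m_def by (rule integral_distr) measurable

lemma g_int: "integrable M (\<lambda>p. g k z (Z k p))"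
proof (rule Bochner_Integration.integrable_bound)
  show "integrable M (\<lambda>p. CARD('n) * l (w k p))" by (intro integrable_mult_right l_w_int)
  show "AE p in M. norm (g k z (Z k p)) \<le> norm (CARD('n) * l (w k p))"
    by (intro AE_I2 order_trans[OF g_Z_bound]) auto
qed measurable

lemma g_int': "integrable (distr M (borel \<Otimes>\<^sub>M Q) (Z k)) (g k z)"
  using g_int by (subst integrable_distr_eq) auto

lemma m_bound: "norm (m k z) \<le> CARD('n) * L0"
proof -
  have "norm (m k z) \<le> (\<integral>p. norm (g k z (Z k p)) \<partial>M)" unfolding m_eq by (rule integral_norm_bound)
  also have "\<dots> \<le> (\<integral>p. CARD('n) * l (w k p) \<partial>M)"
    by (rule integral_mono) (auto intro!: integrable_norm g_int l_w_int integrable_mult_right g_Z_bound)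
  also have "\<dots> \<le> CARD('n) * L0" using l_mean_le by (simp add: l_w_int)
  finally show ?thesis .
qed

lemma m_meas[measurable]: "m k \<in> borel_measurable borel"
proof -
  interpret PZ: prob_space "distr M (borel \<Otimes>\<^sub>M Q) (Z k)" by (rule prob_space_distr) measurable
  show ?thesis unfolding m_def[abs_def]
    by (rule PZ.borel_measurable_lebesgue_integral) (use g_meas in \<open>simp cong: measurable_cong_sets\<close>)
qed

text \<open>Fubini: integrating the sample first turns the sampled objective into its expectation,
  and the remaining sphere integral is the one in \<open>zeroth_order_secant\<close>.\<close>

lemma m_ge:
  assumes z: "z \<in> X" and y: "y \<in> X"
  shows "F z - F y - \<eta> k * L0 \<le> m k z \<bullet> (z - y)"
proof -
  interpret U: prob_space "uniform_sphere (\<eta> k) :: (real^'n) measure" by (rule prob_space_uniform_sphere)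
  interpret UQ: pair_sigma_finite "uniform_sphere (\<eta> k) :: (real^'n) measure" Q ..
  have E: "z \<in> E" "y \<in> E" using z y X_sub_E by auto
  have "F z - F y - \<eta> k * L0 = F' z - F' y - \<eta> k * L0" using E by (simp add: F'_eq)
  also have "\<dots> \<le> (\<integral>u. DIM(real^'n) / (\<eta> k)\<^sup>2 * ((F' (z + u) - F' z) * (u \<bullet> (z - y))) \<partial>uniform_sphere (\<eta> k))"
    by (rule zeroth_order_secant[OF F'_cont F'_conv _ \<eta>_pos cball_E[OF z] cball_E[OF y]])
       (auto intro!: lipschitz_onI F'_lip L0_nonneg simp: dist_norm)
  also have "\<dots> = (\<integral>u. (\<integral>\<omega>. g k z (u, \<omega>) \<bullet> (z - y) \<partial>Q) \<partial>uniform_sphere (\<eta> k))"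
  proof (rule integral_cong_AE)
    \<comment> \<open>The surface measure is concentrated on norm u = \<eta> k, where the
      denominator norm u * \<eta> k of the estimator equals
      \<open>(\<eta> k)\<^sup>2\<close>.\<close>
    show "AE u in uniform_sphere (\<eta> k). DIM(real^'n) / (\<eta> k)\<^sup>2 * ((F' (z + u) - F' z) * (u \<bullet> (z - y))) =
       (\<integral>\<omega>. g k z (u, \<omega>) \<bullet> (z - y) \<partial>Q)"
      using AE_uniform_sphere[OF less_imp_le[OF \<eta>_pos[of k]]]
    proof eventually_elim
      case (elim u)
      then have u: "norm u = \<eta> k" by simp
      have "(\<integral>\<omega>. g k z (u, \<omega>) \<bullet> (z - y) \<partial>Q) =
        (\<integral>\<omega>. (CARD('n) / (\<eta> k)\<^sup>2 * (u \<bullet> (z - y))) * (h' (z + u) \<omega> - h' z \<omega>) \<partial>Q)"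
        by (simp add: g_def zo_gradient_def u power2_eq_square mult_ac)
      also have "\<dots> = (CARD('n) / (\<eta> k)\<^sup>2 * (u \<bullet> (z - y))) * (F' (z + u) - F' z)"
        unfolding F'_def by (subst integral_mult_right_zero) (simp add: h'_int)
      finally show ?case by simp
    qed
  qed (measurable, auto intro!: Q.borel_measurable_lebesgue_integral simp: uniform_sphere_def)
  also have "\<dots> = (\<integral>s. g k z s \<bullet> (z - y) \<partial>distr M (borel \<Otimes>\<^sub>M Q) (Z k))"
    unfolding Z_law
    by (rule UQ.integral_fst') (use g_int'[of k z] in \<open>simp add: Z_law\<close>)
  also have "\<dots> = m k z \<bullet> (z - y)"
    unfolding m_def by (rule integral_inner_left) (use g_int' in auto)
  finally show ?thesis .
qed

section \<open>Noise strictly before step k, noise at step k, and adaptedness\<close>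

definition hist :: "nat \<Rightarrow> 'p measure" where
  "hist k = sigma (space M) (\<Union>i\<in>UNIV \<times> {..<k}. noise_sets v Q w i)"

definition present :: "nat \<Rightarrow> 'p measure" where
  "present k = sigma (space M) (\<Union>i\<in>UNIV \<times> {k}. noise_sets v Q w i)"

lemma noise_sets_sub: "noise_sets v Q w i \<subseteq> sets M"
  by (auto simp: noise_sets_def split: prod.splits if_splits)

lemma noise_sets_Pow: "(\<Union>i\<in>I. noise_sets v Q w i) \<subseteq> Pow (space M)"
  using noise_sets_sub sets.sets_into_space by blast

lemma space_hist: "space (hist k) = space M" and space_present: "space (present k) = space M"
  by (auto simp: hist_def present_def space_measure_of[OF noise_sets_Pow])

lemma sets_hist: "sets (hist k) = sigma_sets (space M) (\<Union>i\<in>UNIV \<times> {..<k}. noise_sets v Q w i)"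
  and sets_present: "sets (present k) = sigma_sets (space M) (\<Union>i\<in>UNIV \<times> {k}. noise_sets v Q w i)"
  by (auto simp: hist_def present_def sets_measure_of[OF noise_sets_Pow])

lemma subalgebra_hist: "subalgebra M (hist k)"
  unfolding subalgebra_def space_hist sets_hist
  using noise_sets_sub by (auto intro!: sets.sigma_sets_subset)

lemma hist_mono: "sets (hist k) \<subseteq> sets (hist (Suc k))"
  unfolding sets_hist by (rule sigma_sets_mono', rule UN_mono) auto

lemma present_sub_hist: "sets (present k) \<subseteq> sets (hist (Suc k))"
  unfolding sets_hist sets_present by (rule sigma_sets_mono', rule UN_mono) auto

lemma measurable_hist_mono: "f \<in> measurable (hist k) N \<Longrightarrow> f \<in> measurable (hist (Suc k)) N"
  using hist_mono[of k] by (auto simp: measurable_def space_hist)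

lemma v_present: "v k \<in> borel_measurable (present k)"
proof (rule measurableI)
  fix A :: "(real^'n) set" assume "A \<in> sets borel"
  then have "v k -` A \<inter> space M \<in> noise_sets v Q w (True, k)" by (auto simp: noise_sets_def)
  then show "v k -` A \<inter> space (present k) \<in> sets (present k)"
    unfolding sets_present space_present by (intro sigma_sets.Basic) auto
qed simp

lemma w_present: "w k \<in> measurable (present k) Q"
proof (rule measurableI)
  fix A assume "A \<in> sets Q"
  then have "w k -` A \<inter> space M \<in> noise_sets v Q w (False, k)" by (auto simp: noise_sets_def)
  then show "w k -` A \<inter> space (present k) \<in> sets (present k)"
    unfolding sets_present space_present by (intro sigma_sets.Basic) auto
qed (use measurable_space[OF w_meas] in \<open>auto simp: space_present\<close>)

lemma Z_present: "Z k \<in> measurable (present k) (borel \<Otimes>\<^sub>M Q)"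
  unfolding Z_def[abs_def] by (intro measurable_Pair v_present w_present)

lemma Z_hist: "Z k \<in> measurable (hist (Suc k)) (borel \<Otimes>\<^sub>M Q)"
  using Z_present[of k] present_sub_hist[of k] by (auto simp: measurable_def space_hist space_present)

text \<open>The two sigma-algebras are generated by disjoint index blocks of
  \<open>noise_sets\<close>. Each generator is stable under intersection, so independence extends
  from the generators.\<close>

lemma prob_hist_present:
  assumes A: "A \<in> sets (hist k)" and B: "B \<in> sets (present k)"
  shows "prob (A \<inter> B) = prob A * prob B"
proof -
  let ?I = "\<lambda>b. if b then UNIV \<times> {..<k} else (UNIV :: bool set) \<times> {k}"
  have "indep_sets (\<lambda>b. sigma_sets (space M) (\<Union>i\<in>?I b. noise_sets v Q w i)) UNIV"
  proof (rule indep_sets_collect_sigma)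
    show "indep_sets (noise_sets v Q w) (\<Union>b\<in>UNIV. ?I b)"
      by (rule indep_sets_mono_index[OF subset_UNIV indep])
    show "disjoint_family_on ?I UNIV" by (auto simp: disjoint_family_on_def)
    fix i show "Int_stable (noise_sets v Q w i)"
    proof (cases i)
      case (Pair b j)
      have "(v j -` A \<inter> space M) \<inter> (v j -` B \<inter> space M) = v j -` (A \<inter> B) \<inter> space M"
        "(w j -` C \<inter> space M) \<inter> (w j -` D \<inter> space M) = w j -` (C \<inter> D) \<inter> space M" for A B C D by auto
      then show ?thesis unfolding Pair Int_stable_def noise_sets_def
        by (auto; metis sets.Int)
    qed
  qed
  then have "prob (\<Inter>b\<in>UNIV. if b then A else B) = (\<Prod>b\<in>UNIV. prob (if b then A else B))"
    by (rule indep_setsD) (use A B in \<open>auto simp: sets_hist sets_present\<close>)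
  then show ?thesis by (simp add: UNIV_bool mult.commute Int_commute)
qed

lemma x_in_X: "x k p \<in> X"
proof (cases k)
  case (Suc j)
  show ?thesis unfolding Suc x_Suc
    by (rule closest_point_in_set[OF compact_imp_closed[OF X(2)] X(1)])
qed (simp add: x_0 x0)

text \<open>Both query points lie in \<open>E\<close>, where the extension agrees with
  \<open>h\<close>. The restriction to \<open>space M\<close> is where \<open>v k p\<close> is known
  to lie on the sphere.\<close>

lemma x_step: "p \<in> space M \<Longrightarrow> x (Suc k) p = closest_point X (x k p - \<gamma> k *\<^sub>R g k (x k p) (Z k p))"
proof -
  assume p: "p \<in> space M"
  have "x k p + v k p \<in> E" using cball_E[OF x_in_X[of k p], of k] v_sphere[OF p, of k] by (auto simp: subset_iff dist_norm)
  moreover have "x k p \<in> E" using x_in_X X_sub_E by auto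
  ultimately show ?thesis unfolding x_Suc by (simp add: g_def Z_def zo_gradient_def h'_eq)
qed

lemma closest_point_X_meas[measurable]: "closest_point X \<in> borel_measurable borel"
  using X by (intro borel_measurable_continuous_onI continuous_on_closest_point compact_imp_closed)

lemma x_hist: "x k \<in> borel_measurable (hist k)"
proof (induction k)
  case 0
  then show ?case using x_0 by (simp add: measurable_cong[of _ "x 0" "\<lambda>_. x0"])
next
  case (Suc k)
  have [measurable]: "x k \<in> borel_measurable (hist (Suc k))" "Z k \<in> measurable (hist (Suc k)) (borel \<Otimes>\<^sub>M Q)"
    using measurable_hist_mono[OF Suc] Z_hist by auto
  have "(\<lambda>p. closest_point X (x k p - \<gamma> k *\<^sub>R g k (x k p) (Z k p))) \<in> borel_measurable (hist (Suc k))"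
    by measurable
  then show ?case by (subst measurable_cong[OF x_step]) (simp_all add: space_hist)
qed

lemma x_meas[measurable]: "x k \<in> borel_measurable M"
  using measurable_from_subalg[OF subalgebra_hist x_hist] .

definition \<xi> :: "nat \<Rightarrow> 'p \<Rightarrow> real^'n" where "\<xi> k p = g k (x k p) (Z k p) - m k (x k p)"

lemma \<xi>_meas[measurable]: "\<xi> k \<in> borel_measurable M"
  unfolding \<xi>_def[abs_def] by measurable

lemma \<xi>_hist: "\<xi> k \<in> borel_measurable (hist (Suc k))"
proof -
  have [measurable]: "x k \<in> borel_measurable (hist (Suc k))" "Z k \<in> measurable (hist (Suc k)) (borel \<Otimes>\<^sub>M Q)"
    using measurable_hist_mono[OF x_hist] Z_hist by auto
  show ?thesis unfolding \<xi>_def[abs_def] by measurable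
qed

text \<open>The pair of \<phi> and the iterate depends on the past and is independent of the noise
  of step k. Freezing the pair replaces the estimator by its mean \<open>m\<close>, so the noise
  integrates to 0.\<close>

lemma inner_orth:
  assumes \<phi>: "\<phi> \<in> borel_measurable (hist k)" and \<phi>2: "integrable M (\<lambda>p. (norm (\<phi> p))\<^sup>2)"
  shows "(\<integral>p. \<phi> p \<bullet> \<xi> k p \<partial>M) = 0"
proof -
  have [measurable]: "\<phi> \<in> borel_measurable M" using measurable_from_subalg[OF subalgebra_hist \<phi>] .
  define U where "U = (\<lambda>p. (\<phi> p, x k p))"
  define \<Psi> where "\<Psi> = (\<lambda>((a, z), s). a \<bullet> g k z s)"
  have U_hist: "U \<in> measurable (hist k) (borel \<Otimes>\<^sub>M borel)"
    unfolding U_def using \<phi> x_hist by measurable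
  have \<phi>l: "integrable M (\<lambda>p. norm (\<phi> p) * (CARD('n) * l (w k p)))"
    by (rule integrable_mult_square_integrable) (auto simp: power_mult_distrib intro!: \<phi>2 l_w_int)
  have i1: "integrable M (\<lambda>p. \<phi> p \<bullet> g k (x k p) (Z k p))"
  proof (rule Bochner_Integration.integrable_bound[OF \<phi>l])
    show "AE p in M. norm (\<phi> p \<bullet> g k (x k p) (Z k p)) \<le> norm (norm (\<phi> p) * (CARD('n) * l (w k p)))"
    proof (rule AE_I2)
      fix p assume p: "p \<in> space M"
      have "norm (\<phi> p \<bullet> g k (x k p) (Z k p)) \<le> norm (\<phi> p) * norm (g k (x k p) (Z k p))"
        using Cauchy_Schwarz_ineq2 by simp
      also have "\<dots> \<le> norm (\<phi> p) * (CARD('n) * l (w k p))"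
        by (intro mult_left_mono g_Z_bound p) auto
      finally show "norm (\<phi> p \<bullet> g k (x k p) (Z k p)) \<le> norm (norm (\<phi> p) * (CARD('n) * l (w k p)))" by simp
    qed
  qed measurable
  have \<phi>1: "integrable M (\<lambda>p. norm (\<phi> p))"
    by (rule square_integrable_imp_integrable[OF _ \<phi>2]) measurable
  have i2: "integrable M (\<lambda>p. \<phi> p \<bullet> m k (x k p))"
  proof (rule Bochner_Integration.integrable_bound[OF integrable_mult_left[OF \<phi>1, of "CARD('n) * L0"]])
    show "AE p in M. norm (\<phi> p \<bullet> m k (x k p)) \<le> norm (norm (\<phi> p) * (CARD('n) * L0))"
    proof (rule AE_I2)
      fix p
      have "norm (\<phi> p \<bullet> m k (x k p)) \<le> norm (\<phi> p) * norm (m k (x k p))"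
        using Cauchy_Schwarz_ineq2 by simp
      also have "\<dots> \<le> norm (\<phi> p) * (CARD('n) * L0)"
        by (intro mult_left_mono m_bound) auto
      finally show "norm (\<phi> p \<bullet> m k (x k p)) \<le> norm (norm (\<phi> p) * (CARD('n) * L0))" by simp
    qed
  qed measurable
  have "(\<integral>p. \<Psi> (U p, Z k p) \<partial>M) = (\<integral>p. (\<integral>s. \<Psi> (U p, s) \<partial>distr M (borel \<Otimes>\<^sub>M Q) (Z k)) \<partial>M)"
  proof (rule integral_freeze_indep)
    show "U \<in> measurable M (borel \<Otimes>\<^sub>M borel)" using measurable_from_subalg[OF subalgebra_hist U_hist] .
    show "Z k \<in> measurable M (borel \<Otimes>\<^sub>M Q)" by measurable
    show "\<Psi> \<in> borel_measurable ((borel \<Otimes>\<^sub>M borel) \<Otimes>\<^sub>M (borel \<Otimes>\<^sub>M Q))"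
      unfolding \<Psi>_def split_beta by measurable
    show "integrable M (\<lambda>p. \<Psi> (U p, Z k p))" using i1 by (simp add: \<Psi>_def U_def)
    fix A B assume "A \<in> sets (borel \<Otimes>\<^sub>M borel :: ((real^'n) \<times> (real^'n)) measure)" "B \<in> sets (borel \<Otimes>\<^sub>M Q :: ((real^'n) \<times> 'w) measure)"
    then show "prob ((U -` A \<inter> space M) \<inter> (Z k -` B \<inter> space M)) = prob (U -` A \<inter> space M) * prob (Z k -` B \<inter> space M)"
      using measurable_sets[OF U_hist] measurable_sets[OF Z_present] unfolding space_hist space_present
      by (intro prob_hist_present) auto
  qed
  also have "\<dots> = (\<integral>p. \<phi> p \<bullet> m k (x k p) \<partial>M)"
    unfolding \<Psi>_def U_def m_def using g_int' by (simp add: integral_inner_right)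
  finally have "(\<integral>p. \<phi> p \<bullet> g k (x k p) (Z k p) \<partial>M) = (\<integral>p. \<phi> p \<bullet> m k (x k p) \<partial>M)"
    by (simp add: \<Psi>_def U_def)
  then show ?thesis unfolding \<xi>_def inner_diff_right
    by (subst Bochner_Integration.integral_diff[OF i1 i2]) simp
qed

end

section \<open>Power sums, quasi-Fejer sequences and weighted averages\<close>

text \<open>Comparison of the power with its integral over [j, j + 1], obtained without integration:
  Young's inequality bounds j^(1-s) (j+1)^s by (1-s) j + s (j+1), which is (j+1) - (1-s).\<close>

lemma powr_minus_le_increment:
  fixes s :: real
  assumes s: "0 \<le> s" "s < 1"
  shows "real (Suc j) powr (- s) \<le> (real (Suc j) powr (1 - s) - real j powr (1 - s)) / (1 - s)"
proof (cases "j = 0")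
  case True
  then show ?thesis using s by (simp add: field_simps)
next
  case False
  have base: "real (Suc j) powr (1 - s) = real (Suc j) * real (Suc j) powr (- s)"
    using powr_mult_base[of "real (Suc j)" "- s"] by (metis of_nat_0_le_iff uminus_add_conv_diff add.commute)
  have "real j powr (1 - s) * real (Suc j) powr s \<le> (1 - s) * real j + s * real (Suc j)"
    using s False by (intro Youngs_inequality_0) auto
  then have "real j powr (1 - s) * real (Suc j) powr s * real (Suc j) powr (- s)
      \<le> (real (Suc j) - (1 - s)) * real (Suc j) powr (- s)"
    by (intro mult_right_mono) (auto simp: algebra_simps)
  also have "real j powr (1 - s) * real (Suc j) powr s * real (Suc j) powr (- s) = real j powr (1 - s)"
    by (simp add: powr_minus)
  also have "(real (Suc j) - (1 - s)) * real (Suc j) powr (- s) =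
      real (Suc j) powr (1 - s) - (1 - s) * real (Suc j) powr (- s)"
    unfolding base by (simp only: left_diff_distrib)
  finally have "real (Suc j) powr (- s) * (1 - s) \<le> real (Suc j) powr (1 - s) - real j powr (1 - s)"
    by (simp only: mult.commute[of _ "1 - s"])
  then show ?thesis using s by (subst pos_le_divide_eq) simp_all
qed

lemma sum_powr_le:
  fixes s :: real
  assumes s: "0 \<le> s" "s < 1"
  shows "(\<Sum>k\<le>K. real (k + 1) powr (- s)) \<le> real (K + 1) powr (1 - s) / (1 - s)"
proof -
  have "(\<Sum>k<N. real (Suc k) powr (- s)) \<le> real N powr (1 - s) / (1 - s)" for N
  proof (induction N)
    case (Suc N)
    then show ?case using powr_minus_le_increment[OF s, of N] by (simp add: diff_divide_distrib)
  qed simp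
  from this[of "Suc K"] show ?thesis by (simp add: lessThan_Suc_atMost)
qed

text \<open>Each of the K + 1 terms is at least the last. As a lower bound for the averaging weights
  it has leading constant 1, so no factor 2 - r appears in \<open>expected_gap_rate\<close>.\<close>

lemma sum_powr_ge:
  fixes s :: real
  assumes s: "0 \<le> s"
  shows "real (K + 1) powr (1 - s) \<le> (\<Sum>k\<le>K. real (k + 1) powr (- s))"
proof -
  have "real (K + 1) powr (1 - s) = (\<Sum>k\<le>K. real (K + 1) powr (- s))"
    by (simp add: powr_mult_base add.commute)
  also have "\<dots> \<le> (\<Sum>k\<le>K. real (k + 1) powr (- s))"
    using s by (intro sum_mono powr_mono2') auto
  finally show ?thesis .
qed

text \<open>Since \<open>c\<close> may have either sign, its series is only required to converge; this
  pathwise form takes the place of the Robbins--Siegmund theorem.\<close>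

lemma almost_decreasing_convergent:
  fixes a b c :: "nat \<Rightarrow> real"
  assumes step: "\<And>k. a (Suc k) \<le> a k - b k + c k" and a: "\<And>k. 0 \<le> a k" and b: "\<And>k. 0 \<le> b k"
    and c: "convergent (\<lambda>n. \<Sum>k<n. c k)"
  shows "convergent a" "summable b"
proof -
  obtain B where B: "\<And>n. \<bar>\<Sum>k<n. c k\<bar> \<le> B"
    using convergent_imp_Bseq[OF c] by (auto simp: Bseq_def)
  \<comment> \<open>Subtracting the partial sums of c leaves a decreasing sequence, bounded below
    because those sums are bounded.\<close>
  define t where "t = (\<lambda>n. a n - (\<Sum>k<n. c k))"
  have "decseq t" unfolding decseq_Suc_iff t_def
  proof
    fix k show "a (Suc k) - (\<Sum>i<Suc k. c i) \<le> a k - (\<Sum>i<k. c i)" using step[of k] b[of k] by simp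
  qed
  moreover have "\<forall>i. - B \<le> t i" unfolding t_def
  proof
    fix i show "- B \<le> a i - (\<Sum>k<i. c k)" using a[of i] B[of i] by linarith
  qed
  ultimately obtain L where "t \<longlonglongrightarrow> L" by (rule decseq_convergent)
  then have "convergent (\<lambda>n. t n + (\<Sum>k<n. c k))"
    using c by (intro convergent_add) (auto simp: convergent_def)
  then show "convergent a" by (simp add: t_def)
  have tel: "a n + (\<Sum>k<n. b k) \<le> a 0 + (\<Sum>k<n. c k)" for n
  proof (induction n)
    case (Suc n)
    then show ?case using step[of n] by simp
  qed simp
  have "(\<Sum>k<n. b k) \<le> a 0 + B" for n
    using tel[of n] a[of n] B[of n] by linarith
  from this[of "Suc _"] show "summable b"
    unfolding lessThan_Suc_atMost by (rule bounded_imp_summable[OF b])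
qed

text \<open>Divergence of the step sums forces the gap to be small infinitely often, and compactness
  turns this into a cluster point y that is a minimizer. The distance to this particular y
  converges, and along a subsequence it tends to 0, so its limit is 0.\<close>

lemma fejer_compact_convergent:
  fixes x :: "nat \<Rightarrow> 'a::metric_space" and F :: "'a \<Rightarrow> real"
  assumes X: "compact X" "\<And>k. x k \<in> X" and F: "continuous_on X F" and fs: "\<And>z. z \<in> X \<Longrightarrow> fs \<le> F z"
    and fejer: "\<And>y. y \<in> X \<Longrightarrow> F y = fs \<Longrightarrow> convergent (\<lambda>k. (dist (x k) y)\<^sup>2)"
    and sm: "summable (\<lambda>k. \<gamma> k * (F (x k) - fs))" and \<gamma>: "\<And>k. \<gamma> k > 0" "\<not> summable \<gamma>"
  shows "\<exists>y\<in>X. F y = fs \<and> x \<longlonglongrightarrow> y"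
proof -
  \<comment> \<open>If the gap stayed above e from N on, comparison would make \<gamma>
    summable.\<close>
  have ex: "\<exists>k\<ge>N. F (x k) - fs < e" if "e > 0" for e :: real and N
  proof (rule ccontr)
    assume "\<not> ?thesis"
    then have *: "\<And>k. k \<ge> N \<Longrightarrow> e \<le> F (x k) - fs" by (auto simp: not_less)
    have "summable (\<lambda>k. inverse e * (\<gamma> k * (F (x k) - fs)))" using sm by (rule summable_mult)
    then have "summable \<gamma>"
    proof (rule summable_comparison_test'[where N=N])
      fix k assume "k \<ge> N"
      then have "\<gamma> k * e \<le> \<gamma> k * (F (x k) - fs)" using * \<gamma>(1)[of k] by (intro mult_left_mono) auto
      then show "norm (\<gamma> k) \<le> inverse e * (\<gamma> k * (F (x k) - fs))" using that \<gamma>(1)[of k]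
        by (simp add: field_simps)
    qed
    then show False using \<gamma>(2) by simp
  qed
  have "\<forall>j. \<exists>k\<ge>j. F (x k) - fs < 1 / real (Suc j)" by (intro allI ex) simp
  \<comment> \<open>The indices \<kappa> need not increase strictly. From \<kappa> j \<ge> j and the
    strictly increasing \<sigma> below, the composed indices tend to infinity, which suffices to
    transfer the limit of the distances.\<close>
  then obtain \<kappa> where \<kappa>: "\<And>j. \<kappa> j \<ge> j" "\<And>j. F (x (\<kappa> j)) - fs < 1 / real (Suc j)" by metis
  obtain y \<sigma> where y: "y \<in> X" "strict_mono \<sigma>" "((\<lambda>j. x (\<kappa> j)) \<circ> \<sigma>) \<longlonglongrightarrow> y"
    using seq_compactE[OF compact_imp_seq_compact[OF X(1)], of "\<lambda>j. x (\<kappa> j)"] X(2) by blast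
  have lim: "(\<lambda>j. x (\<kappa> (\<sigma> j))) \<longlonglongrightarrow> y" using y(3) by (simp add: o_def)
  have "(\<lambda>j. F (x (\<kappa> (\<sigma> j)))) \<longlonglongrightarrow> F y"
    by (rule continuous_on_tendsto_compose[OF F lim y(1)]) (simp add: X)
  moreover have "(\<lambda>j. F (x (\<kappa> (\<sigma> j)))) \<longlonglongrightarrow> fs"
  proof (rule tendsto_sandwich[of "\<lambda>_. fs" _ _ "\<lambda>j. fs + 1 / real (Suc j)"])
    have "F (x (\<kappa> (\<sigma> j))) \<le> fs + 1 / real (Suc j)" for j
    proof -
      have "1 / real (Suc (\<sigma> j)) \<le> 1 / real (Suc j)" using seq_suble[OF y(2), of j] by (intro divide_left_mono) auto
      then show ?thesis using \<kappa>(2)[of "\<sigma> j"] by linarith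
    qed
    then show "\<forall>\<^sub>F j in sequentially. F (x (\<kappa> (\<sigma> j))) \<le> fs + 1 / real (Suc j)" by simp
    show "(\<lambda>j. fs + 1 / real (Suc j)) \<longlonglongrightarrow> fs"
      using tendsto_add[OF tendsto_const[of fs] LIMSEQ_Suc[OF lim_1_over_n]] by simp
  qed (use fs X in auto)
  ultimately have Fy: "F y = fs" by (rule LIMSEQ_unique)
  from fejer[OF y(1) Fy] obtain L where L: "(\<lambda>k. (dist (x k) y)\<^sup>2) \<longlonglongrightarrow> L" by (auto simp: convergent_def)
  have "filterlim (\<lambda>j. \<kappa> (\<sigma> j)) at_top sequentially"
  proof (rule filterlim_at_top_mono[OF filterlim_ident])
    show "\<forall>\<^sub>F j in sequentially. j \<le> \<kappa> (\<sigma> j)"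
      by (rule always_eventually) (blast intro: order_trans[OF seq_suble[OF y(2)] \<kappa>(1)])
  qed
  from filterlim_compose[OF L this] have "(\<lambda>j. (dist (x (\<kappa> (\<sigma> j))) y)\<^sup>2) \<longlonglongrightarrow> L" .
  moreover have "(\<lambda>j. (dist (x (\<kappa> (\<sigma> j))) y)\<^sup>2) \<longlonglongrightarrow> 0"
    using tendsto_power[OF tendsto_dist[OF lim tendsto_const[of y]], of 2] by simp
  ultimately have "L = 0" by (rule LIMSEQ_unique)
  then have "(\<lambda>k. sqrt ((dist (x k) y)\<^sup>2)) \<longlonglongrightarrow> sqrt 0" using L by (intro tendsto_real_sqrt) simp
  then have "x \<longlonglongrightarrow> y" unfolding tendsto_dist_iff[of x] by simp
  then show ?thesis using y(1) Fy by blast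
qed

section \<open>Weighted averages and summation by parts\<close>

lemma averaging_weight_eq: "averaging_weight \<gamma> r k = (\<Sum>j\<le>k. \<gamma> j powr r)"
  by (induction k) auto

lemma averaging_weight_pos: "(\<And>k. \<gamma> k > 0) \<Longrightarrow> averaging_weight \<gamma> r k > 0"
  unfolding averaging_weight_eq by (intro sum_pos) (auto simp: powr_gt_zero less_imp_neq[symmetric])

lemma weighted_average_eq:
  assumes "\<And>k. \<gamma> k > 0"
  shows "averaging_weight \<gamma> r k *\<^sub>R weighted_average \<gamma> r x k = (\<Sum>j\<le>k. \<gamma> j powr r *\<^sub>R x j)"
proof (induction k)
  case (Suc k)
  have "averaging_weight \<gamma> r (Suc k) \<noteq> 0" using averaging_weight_pos[of \<gamma> r "Suc k"] assms by simp
  then have "averaging_weight \<gamma> r (Suc k) *\<^sub>R weighted_average \<gamma> r x (Suc k) =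
    averaging_weight \<gamma> r k *\<^sub>R weighted_average \<gamma> r x k + \<gamma> (Suc k) powr r *\<^sub>R x (Suc k)"
    by (simp del: averaging_weight.simps)
  then show ?case using Suc by simp
qed simp

text \<open>Jensen in incremental form: each new average is a convex combination of the old average
  and the new iterate, with weight \<open>\<gamma> (Suc k) powr r / averaging_weight \<gamma> r (Suc
  k)\<close> on the iterate.\<close>

lemma weighted_average_convex:
  fixes F :: "'a::real_vector \<Rightarrow> real"
  assumes \<gamma>: "\<And>k. \<gamma> k > 0" and X: "convex X" "\<And>k. x k \<in> X" and F: "convex_on X F"
  shows "weighted_average \<gamma> r x k \<in> X"
    and "averaging_weight \<gamma> r k * F (weighted_average \<gamma> r x k) \<le> (\<Sum>j\<le>k. \<gamma> j powr r * F (x j))"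
proof -
  have "weighted_average \<gamma> r x k \<in> X \<and>
    averaging_weight \<gamma> r k * F (weighted_average \<gamma> r x k) \<le> (\<Sum>j\<le>k. \<gamma> j powr r * F (x j))"
  proof (induction k)
    case 0
    then show ?case using X by simp
  next
    case (Suc k)
    let ?S = "averaging_weight \<gamma> r" and ?w = "\<gamma> (Suc k) powr r" and ?b = "weighted_average \<gamma> r x"
    have S: "?S k > 0" "?S (Suc k) > 0" using averaging_weight_pos[of \<gamma> r] \<gamma> by blast+
    define t where "t = ?w / ?S (Suc k)"
    have t: "0 \<le> t" "t \<le> 1" and t1: "1 - t = ?S k / ?S (Suc k)"
      using S by (auto simp: t_def field_simps)
    have b: "?b (Suc k) = (1 - t) *\<^sub>R ?b k + t *\<^sub>R x (Suc k)"
      unfolding t1 unfolding t_def by (simp add: scaleR_add_right divide_inverse mult.commute)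
    have "?b (Suc k) \<in> X" unfolding b using X(1) Suc X(2) t by (intro convexD_alt) auto
    moreover have "F (?b (Suc k)) \<le> (1 - t) * F (?b k) + t * F (x (Suc k))"
      unfolding b using convex_onD[OF F, of t "?b k" "x (Suc k)"] Suc X(2) t by auto
    then have "?S (Suc k) * F (?b (Suc k)) \<le> ?S (Suc k) * ((1 - t) * F (?b k) + t * F (x (Suc k)))"
      using S by (intro mult_left_mono) auto
    then have "?S (Suc k) * F (?b (Suc k)) \<le> ?S k * F (?b k) + ?w * F (x (Suc k))"
      unfolding t1 unfolding t_def using S by (simp add: distrib_left del: averaging_weight.simps weighted_average.simps)
    ultimately show ?case using Suc by simp
  qed
  then show "weighted_average \<gamma> r x k \<in> X"
    and "averaging_weight \<gamma> r k * F (weighted_average \<gamma> r x k) \<le> (\<Sum>j\<le>k. \<gamma> j powr r * F (x j))" by auto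
qed

text \<open>Toeplitz's lemma: the total weight diverges, so any finite initial segment loses its
  influence.\<close>

lemma weighted_average_tendsto:
  fixes x :: "nat \<Rightarrow> 'a::real_normed_vector"
  assumes \<gamma>: "\<And>k. \<gamma> k > 0" and div: "\<not> summable (\<lambda>k. \<gamma> k powr r)" and x: "x \<longlonglongrightarrow> y"
  shows "weighted_average \<gamma> r x \<longlonglongrightarrow> y"
proof (rule LIMSEQ_I)
  fix e :: real assume e: "e > 0"
  let ?S = "averaging_weight \<gamma> r" and ?b = "weighted_average \<gamma> r x"
  have S: "?S k > 0" for k using averaging_weight_pos[of \<gamma> r] \<gamma> by blast
  obtain N where N: "\<And>k. k \<ge> N \<Longrightarrow> norm (x k - y) < e / 2" using LIMSEQ_D[OF x, of "e/2"] e by auto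
  define C where "C = (\<Sum>j<N. \<gamma> j powr r * norm (x j - y))"
  \<comment> \<open>From here on the N initial deviations, of total weighted size C, contribute less
    than e / 2; the remaining terms contribute at most e / 2.\<close>
  obtain K where K: "?S K > 2 * C / e"
  proof (rule ccontr)
    assume "\<not> thesis"
    then have "\<And>K. ?S K \<le> 2 * C / e" using that by (meson not_le)
    then have "summable (\<lambda>k. \<gamma> k powr r)"
      unfolding averaging_weight_eq by (intro bounded_imp_summable) auto
    then show False using div by simp
  qed
  have mono: "?S K \<le> ?S k" if "K \<le> k" for k
    unfolding averaging_weight_eq using that by (intro sum_mono2) auto
  have "norm (?b k - y) < e" if k: "k \<ge> max K N" for k
  proof -
    have "?S k *\<^sub>R (?b k - y) = (\<Sum>j\<le>k. \<gamma> j powr r *\<^sub>R (x j - y))"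
      using weighted_average_eq[of \<gamma> r k x] \<gamma>
      by (simp add: scaleR_diff_right sum_subtractf averaging_weight_eq scaleR_sum_left)
    then have "?S k * norm (?b k - y) = norm (\<Sum>j\<le>k. \<gamma> j powr r *\<^sub>R (x j - y))"
      using S[of k] by (metis abs_of_pos norm_scaleR)
    also have "\<dots> \<le> (\<Sum>j\<le>k. \<gamma> j powr r * norm (x j - y))"
      by (rule order_trans[OF norm_sum]) simp
    also have "\<dots> \<le> (\<Sum>j\<le>k. (if j < N then \<gamma> j powr r * norm (x j - y) else 0) + \<gamma> j powr r * (e / 2))"
    proof (intro sum_mono)
      fix j
      show "\<gamma> j powr r * norm (x j - y) \<le> (if j < N then \<gamma> j powr r * norm (x j - y) else 0) + \<gamma> j powr r * (e / 2)"
      proof (cases "j < N")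
        case False
        then have "norm (x j - y) \<le> e / 2" using N[of j] False by (simp only: not_less less_imp_le)
        then show ?thesis using False mult_left_mono[of "norm (x j - y)" "e / 2" "\<gamma> j powr r"] by simp
      qed (use e in simp)
    qed
    also have "\<dots> = C + ?S k * (e / 2)"
    proof -
      have "(\<Sum>j\<le>k. if j < N then \<gamma> j powr r * norm (x j - y) else 0) = (\<Sum>j\<in>{..k} \<inter> {..<N}. \<gamma> j powr r * norm (x j - y))"
        using sum.inter_restrict[of "{..k}" "\<lambda>j. \<gamma> j powr r * norm (x j - y)" "{..<N}"] by simp
      also have "{..k} \<inter> {..<N} = {..<N}" using k by auto
      finally show ?thesis by (simp add: sum.distrib C_def averaging_weight_eq sum_distrib_right)
    qed
    also have "C < ?S k * (e / 2)"
    proof -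
      have "2 * C < e * ?S K" using K e by (simp add: field_simps)
      also have "\<dots> \<le> e * ?S k" using k e by (intro mult_left_mono mono) auto
      finally show ?thesis by (simp add: mult.commute)
    qed
    finally have "?S k * norm (?b k - y) < ?S k * e" by (simp add: mult.commute)
    then show ?thesis using S[of k] by simp
  qed
  then show "\<exists>no. \<forall>k\<ge>no. norm (?b k - y) < e" by blast
qed

text \<open>After summation by parts the e k have nonnegative coefficients q k - q (k - 1).
  Replacing each e k by B makes these telescope to q K.\<close>

lemma summation_by_parts_le:
  fixes q e :: "nat \<Rightarrow> real"
  assumes q: "\<And>k. 0 \<le> q k" "\<And>k. q k \<le> q (Suc k)" and e: "\<And>k. 0 \<le> e k" "\<And>k. e k \<le> B"
  shows "(\<Sum>k\<le>K. q k * (e k - e (Suc k))) \<le> q K * B"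
proof -
  \<comment> \<open>Keeping the last e makes the induction close: B - e (Suc K) is nonnegative, so q
    K may be raised to q (Suc K).\<close>
  have "(\<Sum>k\<le>K. q k * (e k - e (Suc k))) \<le> q K * (B - e (Suc K))"
  proof (induction K)
    case 0
    show ?case using q(1)[of 0] e(2)[of 0] by (simp add: mult_left_mono)
  next
    case (Suc K)
    have "q K * (B - e (Suc K)) \<le> q (Suc K) * (B - e (Suc K))"
      using q e by (intro mult_right_mono) auto
    then show ?case using Suc by (simp add: algebra_simps)
  qed
  also have "\<dots> \<le> q K * B" using q e by (intro mult_left_mono) auto
  finally show ?thesis .
qed

section \<open>Almost sure convergence\<close>

context zeroth_order_scheme
begin

section \<open>The solution set and the optimal value\<close>

definition Xs :: "(real^'n) set" where "Xs = minimizers X F"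

definition fs :: real where "fs = (INF z\<in>X. F z)"

lemma F_cont_X: "continuous_on X F"
  using F'_cont[of X] by (rule continuous_on_cong[THEN iffD1, rotated 2]) (use X_sub_E F'_eq in auto)

lemma F_conv_X: "convex_on X F"
  by (rule convex_on_subset[OF F_conv X_sub_E X(3)])

lemma F_attains: "\<exists>y\<in>X. \<forall>z\<in>X. F y \<le> F z"
  by (rule continuous_attains_inf[OF X(2) X(1) F_cont_X])

lemma Xs_nonempty: "Xs \<noteq> {}" and Xs_sub: "Xs \<subseteq> X"
  using F_attains by (auto simp: Xs_def minimizers_def)

lemma F_Xs: "y \<in> Xs \<Longrightarrow> F y = fs"
  unfolding fs_def Xs_def minimizers_def by (intro cInf_eq_minimum[symmetric]) auto

lemma fs_le: "z \<in> X \<Longrightarrow> fs \<le> F z"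
  using F_attains F_Xs unfolding Xs_def minimizers_def by fastforce

lemma Xs_eq: "Xs = {z \<in> X. F z = fs}"
  using F_Xs fs_le Xs_sub by (auto simp: Xs_def minimizers_def)

lemma closed_Xs: "closed Xs"
  unfolding Xs_eq by (rule continuous_closed_preimage_constant[OF F_cont_X compact_imp_closed[OF X(2)]])

lemma convex_Xs: "convex Xs"
proof (rule convexI)
  fix a b :: "real^'n" and s t :: real
  assume ab: "a \<in> Xs" "b \<in> Xs" and st: "0 \<le> s" "0 \<le> t" "s + t = 1"
  then have X': "a \<in> X" "b \<in> X" "s *\<^sub>R a + t *\<^sub>R b \<in> X" using Xs_sub convexD[OF X(3)] by blast+
  have "F (s *\<^sub>R a + t *\<^sub>R b) \<le> s * F a + t * F b"
    using F_conv_X X' st unfolding convex_on_def by blast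
  also have "\<dots> = fs" using ab st F_Xs by (simp add: distrib_right[symmetric])
  finally show "s *\<^sub>R a + t *\<^sub>R b \<in> Xs" using X' fs_le[of "s *\<^sub>R a + t *\<^sub>R b"] by (simp add: Xs_eq)
qed

text \<open>Being a statement about one path, it allows y to vary with the path: y is a fixed
  solution in the almost sure argument and the solution nearest to the iterate in the argument for
  expectations. The linear noise term is kept for both.\<close>

lemma pathwise_step:
  assumes p: "p \<in> space M" and y: "y \<in> X"
  shows "(dist (x (Suc k) p) y)\<^sup>2 \<le> (dist (x k p) y)\<^sup>2 - 2 * \<gamma> k * (F (x k p) - F y - \<eta> k * L0)
    - 2 * (\<gamma> k * ((x k p - y) \<bullet> \<xi> k p)) + (\<gamma> k)\<^sup>2 * (CARD('n) * l (w k p))\<^sup>2"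
proof -
  let ?x = "x k p" and ?g = "g k (x k p) (Z k p)"
  have clX: "closed X" using X(2) by (rule compact_imp_closed)
  have "dist (x (Suc k) p) y = dist (closest_point X (?x - \<gamma> k *\<^sub>R ?g)) (closest_point X y)"
    unfolding x_step[OF p] closest_point_self[OF y] ..
  also have "\<dots> \<le> dist (?x - \<gamma> k *\<^sub>R ?g) y"
    by (rule closest_point_lipschitz[OF X(3) clX X(1)])
  finally have "(dist (x (Suc k) p) y)\<^sup>2 \<le> (dist (?x - \<gamma> k *\<^sub>R ?g) y)\<^sup>2" by (intro power_mono) auto
  also have "\<dots> = (dist ?x y)\<^sup>2 - 2 * \<gamma> k * (?g \<bullet> (?x - y)) + (\<gamma> k)\<^sup>2 * (norm ?g)\<^sup>2"
    unfolding dist_norm power2_norm_eq_inner by (simp add: algebra_simps inner_commute power2_eq_square)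
  also have "?g \<bullet> (?x - y) = m k ?x \<bullet> (?x - y) + (?x - y) \<bullet> \<xi> k p"
    by (simp add: \<xi>_def inner_diff_right inner_commute)
  also have "(dist ?x y)\<^sup>2 - 2 * \<gamma> k * (m k ?x \<bullet> (?x - y) + (?x - y) \<bullet> \<xi> k p) + (\<gamma> k)\<^sup>2 * (norm ?g)\<^sup>2 \<le>
     (dist ?x y)\<^sup>2 - 2 * \<gamma> k * ((F ?x - F y - \<eta> k * L0) + (?x - y) \<bullet> \<xi> k p) + (\<gamma> k)\<^sup>2 * (CARD('n) * l (w k p))\<^sup>2"
    using \<gamma>_pos[of k] m_ge[OF x_in_X y, of k p k] g_Z_bound[OF p, of k ?x]
    by (intro add_mono diff_left_mono mult_left_mono power_mono add_right_mono) auto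
  finally show ?thesis by (simp add: algebra_simps)
qed

lemma \<xi>_second_moment:
  "integrable M (\<lambda>p. (norm (\<xi> k p))\<^sup>2)" "(\<integral>p. (norm (\<xi> k p))\<^sup>2 \<partial>M) \<le> 4 * (real CARD('n))\<^sup>2 * L0\<^sup>2"
proof -
  \<comment> \<open>From (a + b)^2 \<le> 2 a^2 + 2 b^2, with a bounding the estimator and b its
    mean. In expectation each half gives 2 n^2 L0^2, hence the constant 4.\<close>
  let ?B = "\<lambda>p. 2 * (real CARD('n))\<^sup>2 * (l (w k p))\<^sup>2 + 2 * (real CARD('n))\<^sup>2 * L0\<^sup>2"
  have b: "(norm (\<xi> k p))\<^sup>2 \<le> ?B p" if "p \<in> space M" for p
  proof -
    have "norm (\<xi> k p) \<le> CARD('n) * l (w k p) + CARD('n) * L0"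
      unfolding \<xi>_def by (rule norm_triangle_le_diff) (intro add_mono g_Z_bound[OF that] m_bound)
    then have "(norm (\<xi> k p))\<^sup>2 \<le> (CARD('n) * l (w k p) + CARD('n) * L0)\<^sup>2" by (intro power_mono) auto
    also have "\<dots> \<le> ?B p"
      using sum_squares_bound[of "CARD('n) * l (w k p)" "CARD('n) * L0"]
      unfolding power2_sum power_mult_distrib by linarith
    finally show ?thesis .
  qed
  have iB: "integrable M ?B"
    by (intro Bochner_Integration.integrable_add integrable_mult_right l_w_int) auto
  show i: "integrable M (\<lambda>p. (norm (\<xi> k p))\<^sup>2)"
    by (rule Bochner_Integration.integrable_bound[OF iB]) (use b in \<open>auto intro!: AE_I2\<close>)
  have "(\<integral>p. (norm (\<xi> k p))\<^sup>2 \<partial>M) \<le> (\<integral>p. ?B p \<partial>M)" by (rule integral_mono[OF i iB b])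
  also have "\<dots> = 4 * (real CARD('n))\<^sup>2 * L0\<^sup>2"
    using l_w_int[of k] by (simp add: prob_space)
  finally show "(\<integral>p. (norm (\<xi> k p))\<^sup>2 \<partial>M) \<le> 4 * (real CARD('n))\<^sup>2 * L0\<^sup>2" .
qed

text \<open>The factor \<open>u k\<close> is bounded and known before step k, so the terms are
  orthogonal to the past and their second moments are at most a constant times
  \<open>(\<gamma> k)\<^sup>2\<close>. It is used with the iterates and with constant basis
  vectors.\<close>

lemma AE_convergent_noise:
  assumes u: "\<And>k. u k \<in> borel_measurable (hist k)" and C: "\<And>k p. norm (u k p) \<le> C"
    and sm: "summable (\<lambda>k. (\<gamma> k)\<^sup>2)"
  shows "AE p in M. convergent (\<lambda>n. \<Sum>k<n. \<gamma> k * (u k p \<bullet> \<xi> k p))"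
proof -
  have u_hist[measurable]: "u k \<in> borel_measurable M" for k using measurable_from_subalg[OF subalgebra_hist u] .
  have sq: "(\<gamma> k * (u k p \<bullet> \<xi> k p))\<^sup>2 \<le> (\<gamma> k)\<^sup>2 * C\<^sup>2 * (norm (\<xi> k p))\<^sup>2" for k p
  proof -
    have "\<bar>u k p \<bullet> \<xi> k p\<bar> \<le> C * norm (\<xi> k p)"
      by (rule order_trans[OF Cauchy_Schwarz_ineq2]) (intro mult_right_mono C norm_ge_zero)
    then have "\<bar>u k p \<bullet> \<xi> k p\<bar>\<^sup>2 \<le> (C * norm (\<xi> k p))\<^sup>2" by (intro power_mono) auto
    then show ?thesis by (simp add: power_mult_distrib mult.assoc mult_left_mono)
  qed
  have isq: "integrable M (\<lambda>p. (\<gamma> k * (u k p \<bullet> \<xi> k p))\<^sup>2)" for k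
    by (rule Bochner_Integration.integrable_bound[OF integrable_mult_right[OF \<xi>_second_moment(1)[of k], of "(\<gamma> k)\<^sup>2 * C\<^sup>2"]])
       (use sq in \<open>auto intro!: AE_I2\<close>)
  interpret L2_martingale M hist "\<lambda>k p. \<gamma> k * (u k p \<bullet> \<xi> k p)"
  proof unfold_locales
    show "(\<lambda>p. \<gamma> k * (u k p \<bullet> \<xi> k p)) \<in> borel_measurable (hist (Suc k))" for k
      using measurable_hist_mono[OF u] \<xi>_hist by measurable
    fix k and \<phi> :: "'p \<Rightarrow> real" assume \<phi>: "\<phi> \<in> borel_measurable (hist k)" and \<phi>2: "integrable M (\<lambda>p. (\<phi> p)\<^sup>2)"
    have [measurable]: "\<phi> \<in> borel_measurable M" using measurable_from_subalg[OF subalgebra_hist \<phi>] .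
    have "(\<integral>p. (\<phi> p * \<gamma> k) *\<^sub>R u k p \<bullet> \<xi> k p \<partial>M) = 0"
    proof (rule inner_orth)
      show "(\<lambda>p. (\<phi> p * \<gamma> k) *\<^sub>R u k p) \<in> borel_measurable (hist k)" using \<phi> u by measurable
      show "integrable M (\<lambda>p. (norm ((\<phi> p * \<gamma> k) *\<^sub>R u k p))\<^sup>2)"
      proof (rule Bochner_Integration.integrable_bound[OF integrable_mult_right[OF \<phi>2, of "(\<gamma> k)\<^sup>2 * C\<^sup>2"]])
        have "(norm ((\<phi> p * \<gamma> k) *\<^sub>R u k p))\<^sup>2 \<le> (\<gamma> k)\<^sup>2 * C\<^sup>2 * (\<phi> p)\<^sup>2" for p
        proof -
          have "(norm (u k p))\<^sup>2 \<le> C\<^sup>2" by (intro power_mono C) auto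
          then have "((\<phi> p)\<^sup>2 * (\<gamma> k)\<^sup>2) * (norm (u k p))\<^sup>2 \<le> ((\<phi> p)\<^sup>2 * (\<gamma> k)\<^sup>2) * C\<^sup>2" by (intro mult_left_mono) auto
          then show ?thesis by (simp add: power_mult_distrib mult_ac)
        qed
        then show "AE p in M. norm ((norm ((\<phi> p * \<gamma> k) *\<^sub>R u k p))\<^sup>2) \<le> norm ((\<gamma> k)\<^sup>2 * C\<^sup>2 * (\<phi> p)\<^sup>2)"
          by (intro AE_I2) simp
      qed measurable
    qed
    then show "(\<integral>p. \<phi> p * (\<gamma> k * (u k p \<bullet> \<xi> k p)) \<partial>M) = 0" by (simp add: mult.assoc)
  qed (use subalgebra_hist hist_mono isq in auto)
  have "summable (\<lambda>k. \<integral>p. (\<gamma> k * (u k p \<bullet> \<xi> k p))\<^sup>2 \<partial>M)"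
  proof (rule summable_comparison_test[OF exI])
    show "summable (\<lambda>k. (\<gamma> k)\<^sup>2 * (C\<^sup>2 * (4 * (real CARD('n))\<^sup>2 * L0\<^sup>2)))" using sm by (rule summable_mult2)
    show "\<forall>k\<ge>0. norm (\<integral>p. (\<gamma> k * (u k p \<bullet> \<xi> k p))\<^sup>2 \<partial>M) \<le> (\<gamma> k)\<^sup>2 * (C\<^sup>2 * (4 * (real CARD('n))\<^sup>2 * L0\<^sup>2))"
    proof (intro allI impI)
      fix k
      have "(\<integral>p. (\<gamma> k * (u k p \<bullet> \<xi> k p))\<^sup>2 \<partial>M) \<le> (\<integral>p. (\<gamma> k)\<^sup>2 * C\<^sup>2 * (norm (\<xi> k p))\<^sup>2 \<partial>M)"
        by (intro integral_mono isq sq integrable_mult_right \<xi>_second_moment)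
      also have "\<dots> = (\<gamma> k)\<^sup>2 * C\<^sup>2 * (\<integral>p. (norm (\<xi> k p))\<^sup>2 \<partial>M)" by simp
      also have "\<dots> \<le> (\<gamma> k)\<^sup>2 * C\<^sup>2 * (4 * (real CARD('n))\<^sup>2 * L0\<^sup>2)"
        by (intro mult_left_mono \<xi>_second_moment) auto
      finally show "norm (\<integral>p. (\<gamma> k * (u k p \<bullet> \<xi> k p))\<^sup>2 \<partial>M) \<le> (\<gamma> k)\<^sup>2 * (C\<^sup>2 * (4 * (real CARD('n))\<^sup>2 * L0\<^sup>2))"
        by (simp add: mult.assoc)
    qed
  qed
  from AE_convergent[OF this] show ?thesis by (simp add: part_def)
qed

text \<open>The expectation of the whole series is finite by monotone convergence, so the series is
  finite almost surely.\<close>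

lemma AE_summable_l:
  assumes sm: "summable (\<lambda>k. (\<gamma> k)\<^sup>2)"
  shows "AE p in M. summable (\<lambda>k. (\<gamma> k)\<^sup>2 * (CARD('n) * l (w k p))\<^sup>2)"
proof -
  let ?c = "\<lambda>k p. (\<gamma> k)\<^sup>2 * (CARD('n) * l (w k p))\<^sup>2"
  have i: "integrable M (?c k)" for k
    unfolding power_mult_distrib by (intro integrable_mult_right l_w_int)
  have e: "(\<integral>p. ?c k p \<partial>M) = (\<gamma> k)\<^sup>2 * ((real CARD('n))\<^sup>2 * L0\<^sup>2)" for k
    by (simp add: power_mult_distrib l_w_int)
  have "(\<integral>\<^sup>+p. (\<Sum>k. ennreal (?c k p)) \<partial>M) = (\<Sum>k. \<integral>\<^sup>+p. ennreal (?c k p) \<partial>M)"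
    by (rule nn_integral_suminf) measurable
  also have "\<dots> = (\<Sum>k. ennreal ((\<gamma> k)\<^sup>2 * ((real CARD('n))\<^sup>2 * L0\<^sup>2)))"
    by (subst nn_integral_eq_integral[OF i]) (simp_all only: e AE_I2 zero_le_mult_iff zero_le_power2 simp_thms)
  also have "\<dots> < \<infinity>"
    using summable_mult2[OF sm, of "(real CARD('n))\<^sup>2 * L0\<^sup>2"] by (subst suminf_ennreal2) auto
  finally have "AE p in M. (\<Sum>k. ennreal (?c k p)) \<noteq> \<infinity>"
    by (intro nn_integral_PInf_AE) auto
  then show ?thesis
    by eventually_elim (intro summable_suminf_not_top, auto)
qed

theorem AE_iterates_converge:
  assumes sm: "summable (\<lambda>k. (\<gamma> k)\<^sup>2)" "summable (\<lambda>k. \<gamma> k * \<eta> k)" and div: "\<not> summable \<gamma>"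
  shows "AE p in M. \<exists>y\<in>Xs. (\<lambda>k. x k p) \<longlonglongrightarrow> y"
proof -
  obtain C where C: "\<And>z. z \<in> X \<Longrightarrow> norm z \<le> C"
    using compact_imp_bounded[OF X(2)] by (auto simp: bounded_iff)
  have A1: "AE p in M. convergent (\<lambda>n. \<Sum>k<n. \<gamma> k * (x k p \<bullet> \<xi> k p))"
    by (rule AE_convergent_noise[OF x_hist C[OF x_in_X] sm(1)])
  \<comment> \<open>The noise series is affine in y, so finitely many coordinate series handle the
    possibly uncountable set of solutions y outside one null set.\<close>
  have "AE p in M. \<forall>b\<in>Basis. convergent (\<lambda>n. \<Sum>k<n. \<gamma> k * ((b::real^'n) \<bullet> \<xi> k p))"
    by (intro AE_finite_allI finite_Basis AE_convergent_noise[where C=1 and u="\<lambda>_ _. b" for b] sm) auto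
  from A1 this AE_summable_l[OF sm(1)] AE_space show ?thesis
  proof eventually_elim
    case (elim p)
    have conv: "convergent (\<lambda>n. \<Sum>k<n. \<gamma> k * ((x k p - y) \<bullet> \<xi> k p))" for y
    proof -
      have "(\<Sum>k<n. \<gamma> k * ((x k p - y) \<bullet> \<xi> k p)) = (\<Sum>k<n. \<gamma> k * (x k p \<bullet> \<xi> k p)) -
        (\<Sum>b\<in>Basis. (y \<bullet> b) * (\<Sum>k<n. \<gamma> k * (b \<bullet> \<xi> k p)))" for n
      proof -
        have "(\<Sum>b\<in>Basis. (y \<bullet> b) * (\<Sum>k<n. \<gamma> k * (b \<bullet> \<xi> k p))) = (\<Sum>k<n. \<gamma> k * (\<Sum>b\<in>Basis. (y \<bullet> b) * (b \<bullet> \<xi> k p)))"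
          unfolding sum_distrib_left by (subst sum.swap) (simp add: mult_ac)
        also have "\<dots> = (\<Sum>k<n. \<gamma> k * (y \<bullet> \<xi> k p))"
          by (subst euclidean_inner[of y]) (simp add: inner_commute)
        finally show ?thesis by (simp add: inner_diff_left right_diff_distrib sum_subtractf)
      qed
      moreover have "convergent (\<lambda>n. (\<Sum>k<n. \<gamma> k * (x k p \<bullet> \<xi> k p)) -
        (\<Sum>b\<in>Basis. (y \<bullet> b) * (\<Sum>k<n. \<gamma> k * (b \<bullet> \<xi> k p))))"
        using elim(1,2) by (intro convergent_diff convergent_sum convergent_mult convergent_const) auto
      ultimately show ?thesis by simp
    qed
    have main: "convergent (\<lambda>k. (dist (x k p) y)\<^sup>2) \<and> summable (\<lambda>k. \<gamma> k * (F (x k p) - fs))" if y: "y \<in> Xs" for y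
    proof -
      \<comment> \<open>Smoothing bias, martingale noise and squared step length: the noise has no
        sign, so this series is only known to converge.\<close>
      define c where "c = (\<lambda>k. 2 * L0 * (\<gamma> k * \<eta> k) - 2 * (\<gamma> k * ((x k p - y) \<bullet> \<xi> k p)) + (\<gamma> k)\<^sup>2 * (CARD('n) * l (w k p))\<^sup>2)"
      have "convergent (\<lambda>n. \<Sum>k<n. c k)"
      proof -
        have "convergent (\<lambda>n. 2 * L0 * (\<Sum>k<n. \<gamma> k * \<eta> k) - 2 * (\<Sum>k<n. \<gamma> k * ((x k p - y) \<bullet> \<xi> k p))
          + (\<Sum>k<n. (\<gamma> k)\<^sup>2 * (CARD('n) * l (w k p))\<^sup>2))"
          using sm(2) elim(3) unfolding summable_iff_convergent
          by (intro convergent_add convergent_diff convergent_mult convergent_const conv)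
        then show ?thesis by (simp add: c_def sum.distrib sum_subtractf sum_distrib_left)
      qed
      moreover have "(dist (x (Suc k) p) y)\<^sup>2 \<le> (dist (x k p) y)\<^sup>2 - 2 * \<gamma> k * (F (x k p) - fs) + c k" for k
        using pathwise_step[OF elim(4), of y k] y Xs_sub F_Xs[OF y] by (auto simp: c_def algebra_simps)
      moreover have "0 \<le> 2 * \<gamma> k * (F (x k p) - fs)" for k
        using \<gamma>_pos[of k] fs_le[OF x_in_X, of k p] by simp
      ultimately have "convergent (\<lambda>k. (dist (x k p) y)\<^sup>2)" "summable (\<lambda>k. 2 * \<gamma> k * (F (x k p) - fs))"
        by (auto intro!: almost_decreasing_convergent[where c=c and a="\<lambda>k. (dist (x k p) y)\<^sup>2"
          and b="\<lambda>k. 2 * \<gamma> k * (F (x k p) - fs)"])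
      then show ?thesis using summable_mult[of "\<lambda>k. 2 * \<gamma> k * (F (x k p) - fs)" "1/2"] by (simp add: mult.assoc)
    qed
    have "\<exists>y\<in>X. F y = fs \<and> (\<lambda>k. x k p) \<longlonglongrightarrow> y"
    proof (rule fejer_compact_convergent[OF X(2) x_in_X F_cont_X fs_le])
      show "convergent (\<lambda>k. (dist (x k p) y)\<^sup>2)" if "y \<in> X" "F y = fs" for y
        using main[of y] that by (simp add: Xs_eq)
      show "summable (\<lambda>k. \<gamma> k * (F (x k p) - fs))" using main Xs_nonempty by blast
    qed (use \<gamma>_pos div in auto)
    then show ?case by (auto simp: Xs_eq)
  qed
qed

corollary average_converges:
  assumes sm: "summable (\<lambda>k. (\<gamma> k)\<^sup>2)" "summable (\<lambda>k. \<gamma> k * \<eta> k)"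
    and div: "\<not> summable \<gamma>" "\<not> summable (\<lambda>k. \<gamma> k powr r)"
  shows "\<exists>xstar \<in> borel_measurable M. (\<forall>p\<in>space M. xstar p \<in> Xs) \<and>
    (AE p in M. (\<lambda>k. (norm (weighted_average \<gamma> r (\<lambda>j. x j p) k - xstar p))\<^sup>2) \<longlonglongrightarrow> 0)"
proof -
  obtain N where N: "{p \<in> space M. \<not> (\<exists>y\<in>Xs. (\<lambda>k. x k p) \<longlonglongrightarrow> y)} \<subseteq> N" "emeasure M N = 0" "N \<in> sets M"
    using AE_iterates_converge[OF sm div(1)] by (rule AE_E)
  obtain y0 where y0: "y0 \<in> Xs" using Xs_nonempty by auto
  \<comment> \<open>The value y0 on the exceptional null set keeps the limit in \<open>Xs\<close> at
    every sample point; off that set it is a pointwise limit, hence measurable.\<close>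
  define xs where "xs = (\<lambda>p. if p \<in> N then y0 else lim (\<lambda>k. x k p))"
  have xs: "xs p \<in> Xs" "(\<lambda>k. x k p) \<longlonglongrightarrow> xs p" if p: "p \<in> space M" "p \<notin> N" for p
  proof -
    obtain y where y: "y \<in> Xs" "(\<lambda>k. x k p) \<longlonglongrightarrow> y" using N(1) p by blast
    then have "xs p = y" using p by (simp add: xs_def limI)
    then show "xs p \<in> Xs" "(\<lambda>k. x k p) \<longlonglongrightarrow> xs p" using y by auto
  qed
  have "xs \<in> borel_measurable M"
    unfolding xs_def using N(3) by measurable
  moreover have "\<forall>p\<in>space M. xs p \<in> Xs" using xs(1) y0 by (force simp: xs_def)
  moreover have "AE p in M. p \<notin> N" by (rule AE_not_in) (use N in auto)
  then have "AE p in M. (\<lambda>k. (norm (weighted_average \<gamma> r (\<lambda>j. x j p) k - xs p))\<^sup>2) \<longlonglongrightarrow> 0"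
    using AE_space
  proof eventually_elim
    case (elim p)
    have "weighted_average \<gamma> r (\<lambda>j. x j p) \<longlonglongrightarrow> xs p"
      by (rule weighted_average_tendsto[OF \<gamma>_pos div(2) xs(2)[OF elim(2,1)]])
    then have "(\<lambda>k. norm (weighted_average \<gamma> r (\<lambda>j. x j p) k - xs p)) \<longlonglongrightarrow> 0"
      by (intro tendsto_norm_zero LIM_zero)
    from tendsto_power[OF this, of 2] show ?case by simp
  qed
  ultimately show ?thesis by blast
qed

end

section \<open>Rates in expectation\<close>

context zeroth_order_scheme
begin

lemma integrable_continuous_X:
  fixes G :: "real^'n \<Rightarrow> real"
  assumes G: "continuous_on UNIV G" and u[measurable]: "u \<in> borel_measurable M" and uX: "\<And>p. u p \<in> X"
  shows "integrable M (\<lambda>p. G (u p))"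
proof -
  have "bounded (G ` X)"
    by (intro compact_imp_bounded compact_continuous_image continuous_on_subset[OF G] X(2)) auto
  then obtain B where "\<And>z. z \<in> X \<Longrightarrow> norm (G z) \<le> B" by (auto simp: bounded_iff)
  moreover have [measurable]: "G \<in> borel_measurable borel" by (rule borel_measurable_continuous_onI[OF G])
  ultimately show ?thesis using uX by (intro integrable_const_bound[where B=B]) auto
qed

lemma integrable_F:
  assumes "u \<in> borel_measurable M" "\<And>p. u p \<in> X"
  shows "integrable M (\<lambda>p. F (u p))"
proof -
  have "F' (u p) = F (u p)" for p using assms(2)[of p] X_sub_E by (intro F'_eq) auto
  then show ?thesis using integrable_continuous_X[OF F'_cont assms] by simp
qed

text \<open>The comparison solution moves with the iterate. As a function of \<open>x k\<close> it
  depends on the past only, so \<open>inner_orth\<close> applies, and its distance to the iterate is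
  the quantity measured by \<open>half_sq_radius\<close>.\<close>

definition near :: "nat \<Rightarrow> 'p \<Rightarrow> real^'n" where "near k p = closest_point Xs (x k p)"

definition dsq :: "nat \<Rightarrow> 'p \<Rightarrow> real" where "dsq k p = (dist (x k p) (near k p))\<^sup>2"

lemma near_in: "near k p \<in> Xs"
  unfolding near_def by (rule closest_point_in_set[OF closed_Xs Xs_nonempty])

lemma continuous_closest_Xs: "continuous_on A (closest_point Xs)"
  by (rule continuous_on_closest_point[OF convex_Xs closed_Xs Xs_nonempty])

lemma dsq_int: "integrable M (dsq k)"
  unfolding dsq_def near_def
  by (rule integrable_continuous_X[of "\<lambda>z. (dist z (closest_point Xs z))\<^sup>2" "x k"])
     (auto intro!: continuous_intros continuous_closest_Xs x_in_X)

lemma dsq_le: "dsq k p \<le> 2 * half_sq_radius X Xs"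
proof -
  have "infdist (x k p) Xs = dist (x k p) (near k p)"
  proof (rule antisym)
    show "infdist (x k p) Xs \<le> dist (x k p) (near k p)" by (rule infdist_le[OF near_in])
    show "dist (x k p) (near k p) \<le> infdist (x k p) Xs"
      unfolding infdist_notempty[OF Xs_nonempty] near_def
      by (intro cINF_greatest Xs_nonempty closest_point_le closed_Xs)
  qed
  moreover have "(infdist (x k p) Xs)\<^sup>2 \<le> (SUP z\<in>X. (infdist z Xs)\<^sup>2)"
  proof (rule cSUP_upper[OF x_in_X])
    show "bdd_above ((\<lambda>z. (infdist z Xs)\<^sup>2) ` X)"
      by (intro bounded_imp_bdd_above compact_imp_bounded compact_continuous_image continuous_intros X(2))
  qed
  ultimately show ?thesis by (simp add: dsq_def half_sq_radius_def)
qed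

lemma half_sq_radius_nonneg: "0 \<le> half_sq_radius X Xs"
proof -
  obtain p where "p \<in> space M" using not_empty by auto
  show ?thesis using dsq_le[of 0 p] zero_le_power2[of "dist (x 0 p) (near 0 p)"] unfolding dsq_def by linarith
qed

text \<open>The difference of iterate and nearest solution is bounded and determined by the past, so
  the noise term of \<open>pathwise_step\<close> vanishes in expectation.\<close>

lemma expected_step:
  "(\<integral>p. dsq (Suc k) p \<partial>M) \<le> (\<integral>p. dsq k p \<partial>M) - 2 * \<gamma> k * ((\<integral>p. F (x k p) \<partial>M) - fs - \<eta> k * L0)
    + (\<gamma> k)\<^sup>2 * ((real CARD('n))\<^sup>2 * L0\<^sup>2)"
proof -
  obtain C where C: "\<And>z. z \<in> X \<Longrightarrow> norm z \<le> C"
    using compact_imp_bounded[OF X(2)] by (auto simp: bounded_iff)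
  let ?u = "\<lambda>p. x k p - near k p"
  have u_hist: "?u \<in> borel_measurable (hist k)"
    unfolding near_def
    by (intro borel_measurable_diff x_hist measurable_compose[OF x_hist]
        borel_measurable_continuous_onI continuous_closest_Xs)
  have [measurable]: "?u \<in> borel_measurable M" using measurable_from_subalg[OF subalgebra_hist u_hist] .
  have u_bd: "norm (?u p) \<le> 2 * C" for p
    using norm_triangle_ineq4[of "x k p" "near k p"] C[OF x_in_X, of k p] C[of "near k p"] near_in[of k p] Xs_sub by auto
  have u2: "integrable M (\<lambda>p. (norm (?u p))\<^sup>2)"
  proof (rule integrable_const_bound)
    show "AE p in M. norm ((norm (?u p))\<^sup>2) \<le> (2 * C)\<^sup>2"
      using power_mono[OF u_bd norm_ge_zero, where n=2] by (intro AE_I2) (simp only: real_norm_def abs_power2)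
  qed measurable
  have orth0: "(\<integral>p. ?u p \<bullet> \<xi> k p \<partial>M) = 0" by (rule inner_orth[OF u_hist u2])
  have iu: "integrable M (\<lambda>p. ?u p \<bullet> \<xi> k p)"
  proof (rule Bochner_Integration.integrable_bound)
    show "integrable M (\<lambda>p. (2 * C) * norm (\<xi> k p))"
      by (intro integrable_mult_right square_integrable_imp_integrable[OF _ \<xi>_second_moment(1)]) measurable
    show "AE p in M. norm (?u p \<bullet> \<xi> k p) \<le> norm ((2 * C) * norm (\<xi> k p))"
    proof (rule AE_I2)
      fix p
      have "norm (?u p \<bullet> \<xi> k p) \<le> norm (?u p) * norm (\<xi> k p)" using Cauchy_Schwarz_ineq2 by simp
      also have "\<dots> \<le> (2 * C) * norm (\<xi> k p)" by (intro mult_right_mono u_bd) auto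
      finally show "norm (?u p \<bullet> \<xi> k p) \<le> norm ((2 * C) * norm (\<xi> k p))" by simp
    qed
  qed measurable
  have iF: "integrable M (\<lambda>p. F (x k p))" by (rule integrable_F) (auto intro: x_in_X)
  let ?B = "\<lambda>p. dsq k p - 2 * \<gamma> k * (F (x k p) - fs - \<eta> k * L0) - 2 * (\<gamma> k * (?u p \<bullet> \<xi> k p))
     + (\<gamma> k)\<^sup>2 * (real CARD('n))\<^sup>2 * (l (w k p))\<^sup>2"
  have "(\<integral>p. dsq (Suc k) p \<partial>M) \<le> (\<integral>p. ?B p \<partial>M)"
  proof (rule integral_mono)
    show "integrable M (dsq (Suc k))" by (rule dsq_int)
    show "integrable M ?B"
      by (intro Bochner_Integration.integrable_add Bochner_Integration.integrable_diff integrable_mult_right dsq_int iF iu l_w_int) auto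
    fix p assume p: "p \<in> space M"
    \<comment> \<open>The old comparison point is kept for one step. Switching to the nearest
      solution of the new iterate can only decrease the distance, so the recursion chains.\<close>
    have "dsq (Suc k) p \<le> (dist (x (Suc k) p) (near k p))\<^sup>2"
      unfolding dsq_def near_def[of "Suc k"] by (intro power_mono closest_point_le closed_Xs near_in) auto
    also have "\<dots> \<le> ?B p"
      using pathwise_step[OF p, of "near k p" k] near_in[of k p] Xs_sub F_Xs[OF near_in, of k p]
      by (auto simp: dsq_def power_mult_distrib mult.assoc)
    finally show "dsq (Suc k) p \<le> ?B p" .
  qed
  also have "\<dots> = (\<integral>p. dsq k p \<partial>M) - 2 * \<gamma> k * ((\<integral>p. F (x k p) \<partial>M) - fs - \<eta> k * L0)
    - 2 * (\<gamma> k * (\<integral>p. ?u p \<bullet> \<xi> k p \<partial>M)) + (\<gamma> k)\<^sup>2 * (real CARD('n))\<^sup>2 * (\<integral>p. (l (w k p))\<^sup>2 \<partial>M)"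
    using dsq_int[of k] iF iu l_w_int(2)[of k]
    by (simp add: prob_space)
  finally show ?thesis unfolding orth0 l_w_int by (simp add: mult.assoc)
qed

section \<open>Expected gap of the averaged iterates\<close>

abbreviation xb :: "real \<Rightarrow> nat \<Rightarrow> 'p \<Rightarrow> real^'n" where
  "xb r k p \<equiv> weighted_average \<gamma> r (\<lambda>j. x j p) k"

lemma xb_in_X: "xb r k p \<in> X"
  by (rule weighted_average_convex(1)[OF \<gamma>_pos X(3) x_in_X F_conv_X])

lemma xb_meas[measurable]: "xb r k \<in> borel_measurable M"
  by (induction k) (simp_all add: x_meas)

text \<open>This sign allows the averaging weight in front of the gap to be replaced by a smaller
  quantity.\<close>

lemma gap_nonneg: "fs \<le> (\<integral>p. F (xb r K p) \<partial>M)"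
proof -
  have "(\<integral>p. fs \<partial>M) \<le> (\<integral>p. F (xb r K p) \<partial>M)"
    by (intro integral_mono integrable_F fs_le xb_in_X xb_meas) auto
  then show ?thesis by (simp add: prob_space)
qed

theorem expected_gap_bound:
  assumes dec: "\<And>k. \<gamma> (Suc k) \<le> \<gamma> k" and r: "r \<le> 1"
  shows "averaging_weight \<gamma> r K * ((\<integral>p. F (xb r K p) \<partial>M) - fs) \<le>
    half_sq_radius X Xs * \<gamma> K powr (r - 1) + L0 * (\<Sum>k\<le>K. \<gamma> k powr r * \<eta> k)
      + (real CARD('n))\<^sup>2 * L0\<^sup>2 / 2 * (\<Sum>k\<le>K. \<gamma> k powr (r + 1))"
proof -
  define e where "e = (\<lambda>k. \<integral>p. dsq k p \<partial>M)"
  define \<Delta> where "\<Delta> = (\<lambda>k. (\<integral>p. F (x k p) \<partial>M) - fs)"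
  let ?V = "(real CARD('n))\<^sup>2 * L0\<^sup>2" and ?D = "half_sq_radius X Xs" and ?S = "averaging_weight \<gamma> r K"
  have iF: "integrable M (\<lambda>p. F (x k p))" for k by (rule integrable_F) (auto intro: x_in_X)
  have e0: "0 \<le> e k" for k unfolding e_def by (rule integral_nonneg_AE) (simp add: dsq_def)
  have eD: "e k \<le> 2 * ?D" for k
  proof -
    have "e k \<le> (\<integral>p. 2 * ?D \<partial>M)" unfolding e_def by (intro integral_mono dsq_int dsq_le) auto
    then show ?thesis by (simp add: prob_space)
  qed
  \<comment> \<open>Half of the expected recursion multiplied by
    \<open>\<gamma> k powr (r - 1)\<close>, which gives the gap its averaging weight.\<close>
  have step: "\<gamma> k powr r * \<Delta> k \<le> \<gamma> k powr (r - 1) * (e k - e (Suc k)) / 2 + L0 * (\<gamma> k powr r * \<eta> k) + ?V / 2 * \<gamma> k powr (r + 1)" for k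
  proof -
    have p1: "\<gamma> k powr (r - 1) * \<gamma> k = \<gamma> k powr r"
      using powr_mult_base[of "\<gamma> k" "r - 1"] \<gamma>_pos[of k] by (simp add: mult.commute)
    have "\<gamma> k powr (r - 1) * (\<gamma> k)\<^sup>2 = (\<gamma> k powr (r - 1) * \<gamma> k) * \<gamma> k" by (simp add: power2_eq_square)
    also have "\<dots> = \<gamma> k powr (r + 1)"
      unfolding p1 using powr_mult_base[of "\<gamma> k" r] \<gamma>_pos[of k] by (simp add: mult.commute add.commute)
    finally have p2: "\<gamma> k powr (r - 1) * (\<gamma> k)\<^sup>2 = \<gamma> k powr (r + 1)" .
    have "2 * (\<gamma> k * \<Delta> k) \<le> e k - e (Suc k) + 2 * (L0 * (\<gamma> k * \<eta> k)) + ?V * (\<gamma> k)\<^sup>2"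
      using expected_step[of k] by (simp add: e_def \<Delta>_def algebra_simps)
    moreover have "a \<le> d / 2 + c + v / 2" if "2 * a \<le> d + 2 * c + v" for a c d v :: real
      using that by simp
    ultimately have "\<gamma> k * \<Delta> k \<le> (e k - e (Suc k)) / 2 + L0 * (\<gamma> k * \<eta> k) + ?V / 2 * (\<gamma> k)\<^sup>2"
      by fastforce
    then have "\<gamma> k powr (r - 1) * (\<gamma> k * \<Delta> k) \<le>
      \<gamma> k powr (r - 1) * ((e k - e (Suc k)) / 2 + L0 * (\<gamma> k * \<eta> k) + ?V / 2 * (\<gamma> k)\<^sup>2)"
      by (intro mult_left_mono) auto
    also have "\<dots> = \<gamma> k powr (r - 1) * (e k - e (Suc k)) / 2 + L0 * ((\<gamma> k powr (r - 1) * \<gamma> k) * \<eta> k)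
      + ?V / 2 * (\<gamma> k powr (r - 1) * (\<gamma> k)\<^sup>2)" by (simp add: algebra_simps)
    also have "\<gamma> k powr (r - 1) * (\<gamma> k * \<Delta> k) = \<gamma> k powr r * \<Delta> k"
      unfolding p1[symmetric] by (simp only: mult.assoc)
    finally show ?thesis unfolding p1 p2 .
  qed
  \<comment> \<open>Decreasing steps and the exponent r - 1 \<le> 0 make the multipliers
    nondecreasing, as summation by parts requires.\<close>
  have parts: "(\<Sum>k\<le>K. \<gamma> k powr (r - 1) * (e k - e (Suc k))) \<le> \<gamma> K powr (r - 1) * (2 * ?D)"
    using dec r \<gamma>_pos by (intro summation_by_parts_le e0 eD powr_mono2') auto
  have jen: "?S * F (xb r K p) \<le> (\<Sum>j\<le>K. \<gamma> j powr r * F (x j p))" for p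
    by (rule weighted_average_convex(2)[OF \<gamma>_pos X(3) x_in_X F_conv_X])
  have "?S * (\<integral>p. F (xb r K p) \<partial>M) = (\<integral>p. ?S * F (xb r K p) \<partial>M)" by simp
  also have "\<dots> \<le> (\<integral>p. (\<Sum>j\<le>K. \<gamma> j powr r * F (x j p)) \<partial>M)"
    by (intro integral_mono jen integrable_mult_right integrable_F xb_in_X xb_meas Bochner_Integration.integrable_sum iF)
  also have "\<dots> = (\<Sum>j\<le>K. \<gamma> j powr r * (\<integral>p. F (x j p) \<partial>M))"
    using iF by (subst Bochner_Integration.integral_sum) auto
  finally have "?S * ((\<integral>p. F (xb r K p) \<partial>M) - fs) \<le> (\<Sum>j\<le>K. \<gamma> j powr r * \<Delta> j)"
    by (simp add: \<Delta>_def right_diff_distrib sum_subtractf averaging_weight_eq sum_distrib_right)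
  also have "\<dots> \<le> (\<Sum>k\<le>K. \<gamma> k powr (r - 1) * (e k - e (Suc k)) / 2 + L0 * (\<gamma> k powr r * \<eta> k) + ?V / 2 * \<gamma> k powr (r + 1))"
    by (intro sum_mono step)
  also have "\<dots> = (\<Sum>k\<le>K. \<gamma> k powr (r - 1) * (e k - e (Suc k))) / 2 + L0 * (\<Sum>k\<le>K. \<gamma> k powr r * \<eta> k)
     + ?V / 2 * (\<Sum>k\<le>K. \<gamma> k powr (r + 1))"
    unfolding sum.distrib sum_divide_distrib sum_distrib_left ..
  also have "\<dots> \<le> \<gamma> K powr (r - 1) * (2 * ?D) / 2 + L0 * (\<Sum>k\<le>K. \<gamma> k powr r * \<eta> k)
     + ?V / 2 * (\<Sum>k\<le>K. \<gamma> k powr (r + 1))"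
    using parts by (intro add_right_mono divide_right_mono) auto
  finally show ?thesis by (simp add: mult.commute)
qed

theorem expected_gap_rate:
  assumes \<gamma>: "\<And>k. \<gamma> k = \<gamma>0 / real (k + 1) powr (1/2)" "\<gamma>0 > 0"
    and \<eta>: "\<And>k. \<eta> k = \<eta>0 / real (k + 1) powr b" "\<eta>0 > 0" and b: "0 \<le> b"
    and r: "0 \<le> r" "r < 1" "r / 2 + b < 1"
  shows "(\<integral>p. F (xb r K p) \<partial>M) - fs \<le>
    (half_sq_radius X Xs / \<gamma>0 + L0\<^sup>2 * (real CARD('n))\<^sup>2 * \<gamma>0 / (1 - r)) * (1 / sqrt (real K + 1))
      + \<eta>0 * L0 / (1 - r / 2 - b) * (1 / (real K + 1) powr b)"
proof -
  define N where "N = real (K + 1)"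
  \<comment> \<open>A lower bound for the averaging weight. Each error term below is bounded by P
    times its share of the final rate, so that P cancels.\<close>
  define P where "P = \<gamma>0 powr r * N powr (1 - r / 2)"
  let ?E = "(\<integral>p. F (xb r K p) \<partial>M) - fs" and ?D = "half_sq_radius X Xs" and ?V = "(real CARD('n))\<^sup>2 * L0\<^sup>2"
  have N: "N > 0" by (simp add: N_def)
  have P: "P > 0" using N \<gamma>(2) by (simp add: P_def)
  have pw: "\<gamma> k powr s = \<gamma>0 powr s * real (k + 1) powr (- (s / 2))" for k s
  proof -
    have "\<gamma> k powr s = \<gamma>0 powr s / (real (k + 1) powr (1/2)) powr s"
      unfolding \<gamma>(1) by (rule powr_divide)
    then show ?thesis unfolding powr_powr powr_minus_divide by simp
  qed
  have dec: "\<gamma> (Suc k) \<le> \<gamma> k" for k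
    unfolding \<gamma>(1) using \<gamma>(2) by (intro divide_left_mono powr_mono2 mult_pos_pos) auto
  have S: "P \<le> averaging_weight \<gamma> r K"
    unfolding averaging_weight_eq pw P_def N_def sum_distrib_left[symmetric]
    using sum_powr_ge[of "r / 2" K] r by (intro mult_left_mono) auto
  have t1: "\<gamma> K powr (r - 1) = P * (1 / \<gamma>0 * (1 / sqrt N))"
  proof -
    have "- ((r - 1) / 2) = (1 - r / 2) - 1 / 2" by argo
    then have "\<gamma> K powr (r - 1) = \<gamma>0 powr (r - 1) * N powr ((1 - r / 2) - 1/2)"
      unfolding pw N_def by (simp only:)
    also have "\<dots> = (\<gamma>0 powr r / \<gamma>0) * (N powr (1 - r / 2) / sqrt N)"
      unfolding powr_diff using \<gamma>(2) N by (simp add: powr_half_sqrt)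
    finally show ?thesis by (simp add: P_def)
  qed
  have t2: "(\<Sum>k\<le>K. \<gamma> k powr r * \<eta> k) \<le> P * (\<eta>0 / (1 - r / 2 - b) * (1 / N powr b))"
  proof -
    have "\<gamma> k powr r * \<eta> k = (\<gamma>0 powr r * \<eta>0) * real (k + 1) powr (- (r / 2 + b))" for k
      unfolding pw \<eta>(1) unfolding minus_add_distrib powr_add powr_minus_divide by simp
    then have "(\<Sum>k\<le>K. \<gamma> k powr r * \<eta> k) = (\<gamma>0 powr r * \<eta>0) * (\<Sum>k\<le>K. real (k + 1) powr (- (r / 2 + b)))"
      by (simp only: sum_distrib_left)
    also have "\<dots> \<le> (\<gamma>0 powr r * \<eta>0) * (N powr (1 - (r / 2 + b)) / (1 - (r / 2 + b)))"
      unfolding N_def using r b \<eta>(2) by (intro mult_left_mono sum_powr_le) auto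
    also have "N powr (1 - (r / 2 + b)) = N powr (1 - r / 2) / N powr b"
      by (simp only: powr_diff[symmetric] diff_diff_eq)
    finally show ?thesis by (simp add: P_def diff_diff_eq mult_ac)
  qed
  \<comment> \<open>Here 1 - (r + 1) / 2 = (1 - r) / 2 produces the 2 / (1 - r); the 2 cancels
    against the 1/2 in front of this sum.\<close>
  have t3: "(\<Sum>k\<le>K. \<gamma> k powr (r + 1)) \<le> P * (2 * \<gamma>0 / (1 - r) * (1 / sqrt N))"
  proof -
    have "(\<Sum>k\<le>K. \<gamma> k powr (r + 1)) = \<gamma>0 powr (r + 1) * (\<Sum>k\<le>K. real (k + 1) powr (- ((r + 1) / 2)))"
      unfolding pw sum_distrib_left ..
    also have "\<dots> \<le> \<gamma>0 powr (r + 1) * (N powr (1 - (r + 1) / 2) / (1 - (r + 1) / 2))"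
      unfolding N_def using r by (intro mult_left_mono sum_powr_le) auto
    also have "1 - (r + 1) / 2 = (1 - r / 2) - 1 / 2" by argo
    also have "N powr ((1 - r / 2) - 1 / 2) = N powr (1 - r / 2) / sqrt N"
      unfolding powr_diff using N by (simp add: powr_half_sqrt)
    also have "\<gamma>0 powr (r + 1) = \<gamma>0 powr r * \<gamma>0" using \<gamma>(2) by (simp add: powr_add)
    also have "(1 - r / 2) - 1 / 2 = (1 - r) / 2" by argo
    finally show ?thesis by (simp add: P_def mult_ac)
  qed
  have "P * ?E \<le> averaging_weight \<gamma> r K * ?E"
    using S gap_nonneg[of r K] by (intro mult_right_mono) auto
  also have "\<dots> \<le> ?D * \<gamma> K powr (r - 1) + L0 * (\<Sum>k\<le>K. \<gamma> k powr r * \<eta> k) + ?V / 2 * (\<Sum>k\<le>K. \<gamma> k powr (r + 1))"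
    by (rule expected_gap_bound[OF dec]) (use r in auto)
  also have "\<dots> \<le> ?D * (P * (1 / \<gamma>0 * (1 / sqrt N))) + L0 * (P * (\<eta>0 / (1 - r / 2 - b) * (1 / N powr b)))
     + ?V / 2 * (P * (2 * \<gamma>0 / (1 - r) * (1 / sqrt N)))"
    unfolding t1 by (intro add_mono mult_left_mono t2 t3 order_refl L0_nonneg) auto
  also have "\<dots> = P * ((?D / \<gamma>0 + L0\<^sup>2 * (real CARD('n))\<^sup>2 * \<gamma>0 / (1 - r)) * (1 / sqrt N)
      + \<eta>0 * L0 / (1 - r / 2 - b) * (1 / N powr b))"
  proof -
    have "?V / 2 * (P * (2 * \<gamma>0 / (1 - r) * (1 / sqrt N))) = P * (L0\<^sup>2 * (real CARD('n))\<^sup>2 * \<gamma>0 / (1 - r) * (1 / sqrt N))"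
      by simp
    then show ?thesis by (simp only:) (simp add: distrib_left distrib_right add_divide_distrib mult_ac)
  qed
  finally show ?thesis using P by (simp add: N_def add.commute)
qed

end

section \<open>The two-stage implicit problem\<close>

lemma summable_step_powr_iff: "summable (\<lambda>k. real (k + 1) powr s) \<longleftrightarrow> s < -1"
  using summable_Suc_iff[of "\<lambda>k. real k powr s"] summable_real_powr_iff[of s] by simp

lemma step_powr:
  assumes "c > 0" shows "(c / real (k + 1) powr a) powr s = c powr s * real (k + 1) powr (- (a * s))"
proof -
  have "(c / real (k + 1) powr a) powr s = c powr s / (real (k + 1) powr a) powr s"
    by (rule powr_divide)
  then show ?thesis unfolding powr_powr powr_minus_divide by simp
qed

lemma compact_enlargement:
  fixes Y :: "'b::euclidean_space set"
  assumes "compact Y" shows "compact (enlargement Y r)"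
  unfolding enlargement_def using compact_sums[OF assms compact_cball[of 0 r]] by simp

lemma cball_subset_enlargement:
  assumes "z \<in> Y" "r \<le> s"
  shows "cball z r \<subseteq> enlargement Y s"
proof
  fix u assume "u \<in> cball z r"
  then have "u - z \<in> cball 0 s" using assms(2) by (simp add: dist_norm norm_minus_commute)
  then show "u \<in> enlargement Y s" unfolding enlargement_def
    using assms(1) by (intro CollectI exI[of _ z] exI[of _ "u - z"]) auto
qed

theorem corollary3:
  fixes M :: "'p measure" and S :: "'w measure" and \<omega> :: "'p \<Rightarrow> 'w"
    and X :: "(real^'n) set" and Y :: "(real^'m) set"
    and f :: "real^'n \<Rightarrow> real^'m \<Rightarrow> 'w \<Rightarrow> real"
    and G :: "real^'n \<Rightarrow> real^'m \<Rightarrow> 'w \<Rightarrow> real^'m"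
    and y :: "real^'n \<Rightarrow> 'w \<Rightarrow> real^'m"
    and L0\<omega> Lt0\<omega> \<mu>F\<omega> LF\<omega> :: "'w \<Rightarrow> real"
    and \<gamma>0 \<eta>0 a b r \<mu>F LF L0 fstar D n :: real
    and \<gamma> \<eta> :: "nat \<Rightarrow> real"
    and \<omega>s :: "nat \<Rightarrow> 'p \<Rightarrow> 'w" and v :: "nat \<Rightarrow> 'p \<Rightarrow> real^'n"
    and x0 :: "real^'n" and F :: "real^'n \<Rightarrow> real" and Xstar :: "(real^'n) set"
    and xbar :: "nat \<Rightarrow> 'p \<Rightarrow> real^'n"
  assumes prob: "prob_space M"
    and rv: "\<omega> \<in> measurable M S"
    and y_sol: "\<And>x w. x \<in> enlargement X \<eta>0 \<Longrightarrow> w \<in> space S \<Longrightarrow>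
                  vi_solutions Y (\<lambda>z. G x z w) = {y x w}"
    and f_meas: "\<And>x. x \<in> enlargement X \<eta>0 \<Longrightarrow> (\<lambda>w. f x (y x w) w) \<in> borel_measurable S"
    and f_int: "\<And>x. x \<in> X \<Longrightarrow> integrable M (\<lambda>p. f x (y x (\<omega> p)) (\<omega> p))"
    and F_def: "F = implicit_objective M \<omega> f y"
    and Xstar_def: "Xstar = minimizers X F"
    and fstar_def: "fstar = (INF x\<in>X. F x)"
    and D_def: "D = half_sq_radius X Xstar"
    and n_def: "n = real CARD('n)"
    and eta0_pos: "\<eta>0 > 0"
    and B1_lip: "\<And>w. w \<in> space S \<Longrightarrow>
                  (L0\<omega> w)-lipschitz_on (enlargement X \<eta>0) (\<lambda>x. f x (y x w) w)"
    and B1_meas: "L0\<omega> \<in> borel_measurable S"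
    and B1_int: "integrable M (\<lambda>p. (L0\<omega> (\<omega> p))\<^sup>2)"
    and L0_def: "L0 = sqrt (\<integral>p. (L0\<omega> (\<omega> p))\<^sup>2 \<partial>M)"
    and B1_lip_y: "\<And>x w. x \<in> enlargement X \<eta>0 \<Longrightarrow> w \<in> space S \<Longrightarrow>
                  (Lt0\<omega> w)-lipschitz_on UNIV (\<lambda>z. f x z w)"
    and B1_meas_y: "Lt0\<omega> \<in> borel_measurable S"
    and B1_int_y: "integrable M (\<lambda>p. (Lt0\<omega> (\<omega> p))\<^sup>2)"
    and B2_X: "X \<noteq> {}" "closed X" "bounded X" "convex X"
    and B2_Y: "Y \<noteq> {}" "closed Y" "bounded Y" "convex Y"
    and B3_mono: "\<And>x w. x \<in> X \<Longrightarrow> w \<in> space S \<Longrightarrow> strongly_monotone_on (\<mu>F\<omega> w) Y (\<lambda>z. G x z w)"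
    and B3_lip: "\<And>x w. x \<in> X \<Longrightarrow> w \<in> space S \<Longrightarrow> (LF\<omega> w)-lipschitz_on Y (\<lambda>z. G x z w)"
    and B3_const: "\<mu>F > 0" "LF > 0" "\<And>w. w \<in> space S \<Longrightarrow> \<mu>F \<le> \<mu>F\<omega> w"
                  "\<And>w. w \<in> space S \<Longrightarrow> LF\<omega> w \<le> LF"
    and C: "convex_on (enlargement X \<eta>0) F"
    and gamma0_pos: "\<gamma>0 > 0"
    and gamma_def: "\<And>k. \<gamma> k = \<gamma>0 / real (k + 1) powr a"
    and eta_def: "\<And>k. \<eta> k = \<eta>0 / real (k + 1) powr b"
    and U_v_indep: "prob_space.indep_vars M (\<lambda>_. borel) v UNIV"
    and U_v_sphere: "\<And>k p. p \<in> space M \<Longrightarrow> v k p \<in> sphere 0 (\<eta> k)"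
    and U_v_unif: "\<And>k. distr M borel (v k) = uniform_sphere (\<eta> k)"
    and U_w_indep: "prob_space.indep_vars M (\<lambda>_. S) \<omega>s UNIV"
    and U_w_law: "\<And>k. distr M S (\<omega>s k) = distr M S \<omega>"
    and U_indep: "indep_random_variables M
                    (Pi\<^sub>M UNIV (\<lambda>_. borel)) (\<lambda>p k. v k p)
                    (Pi\<^sub>M UNIV (\<lambda>_. S)) (\<lambda>p k. \<omega>s k p)"
    and r_range: "0 \<le> r" "r < 1"
    and x0: "x0 \<in> X"
    and xbar_def: "\<And>k p. xbar k p = weighted_average \<gamma> r
                    (zsol_iterate X f y \<gamma> \<eta> x0 (\<lambda>j. \<omega>s j p) (\<lambda>j. v j p)) k"
  shows
    "(a = 1/2 \<and> 1/2 \<le> b \<and> b < 1 \<and> r < 2 * (1 - b) \<longrightarrow>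
       (\<forall>K::nat. real K \<ge> 2 powr (1 / (1 - r)) - 1 \<longrightarrow>
         (\<integral>p. F (xbar K p) \<partial>M) - fstar
           \<le> (2 - r) * (D / \<gamma>0 + L0\<^sup>2 * n\<^sup>2 * \<gamma>0 / (1 - r)) * (1 / sqrt (real K + 1))
             + (2 - r) * (\<eta>0 * L0 / (1 - 0.5 * r - b)) * (1 / (real K + 1) powr b)))
     \<and> (\<forall>\<delta>. a = 1/2 \<and> 0 < \<delta> \<and> \<delta> \<le> 1/2 \<and> b = 1 - \<delta> \<and> r = 0 \<longrightarrow>
       (\<forall>K::nat. K \<ge> 1 \<longrightarrow>
         (\<integral>p. F (xbar K p) \<partial>M) - fstar
           \<le> 2 * (D / \<gamma>0 + L0\<^sup>2 * n\<^sup>2 * \<gamma>0) * (1 / sqrt (real K + 1))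
             + (2 * \<eta>0 * L0 / \<delta>) * (1 / (real K + 1) powr (1 - \<delta>))))
     \<and> (a = 1/2 \<and> b = 1/2 \<and> r = 0 \<and> \<gamma>0 = sqrt D / (n * L0) \<and> \<eta>0 \<le> sqrt D * n \<longrightarrow>
       (\<forall>\<epsilon>>0. \<forall>K::nat. real K \<ge> 64 * n\<^sup>2 * L0\<^sup>2 * D / \<epsilon>\<^sup>2 \<longrightarrow>
         (\<integral>p. F (xbar K p) \<partial>M) - fstar \<le> \<epsilon>))
     \<and> (1/2 < a \<and> a \<le> 1 \<and> b > 1 - a \<longrightarrow>
       (\<exists>xstar. xstar \<in> borel_measurable M \<and> (\<forall>p\<in>space M. xstar p \<in> Xstar) \<and>
         (AE p in M. (\<lambda>k. (norm (xbar k p - xstar p))\<^sup>2) \<longlonglongrightarrow> 0)))"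
proof -
  define Q where "Q = distr M S \<omega>"
  define h where "h = (\<lambda>z w. f z (y z w) w)"
  define E where "E = enlargement X \<eta>0"
  define x where "x = (\<lambda>k p. zsol_iterate X f y \<gamma> \<eta> x0 (\<lambda>j. \<omega>s j p) (\<lambda>j. v j p) k)"
  interpret prob_space M by (rule prob)
  note [measurable] = rv
  have sets_Q [measurable_cong]: "sets Q = sets S" and space_Q: "space Q = space S" by (auto simp: Q_def)
  have cX: "compact X" using B2_X by (simp add: compact_eq_bounded_closed)
  have X_E: "X \<subseteq> E"
    using cball_subset_enlargement[of _ X 0 \<eta>0] eta0_pos by (auto simp: E_def)
  have hm: "h z \<in> borel_measurable S" if "z \<in> E" for z
    using f_meas[of z] that by (simp add: h_def[abs_def] E_def)
  \<comment> \<open>For b \<ge> 0 the radii never exceed \<eta>0, so all query points stay in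
    \<open>E\<close>. The rates have b \<ge> 1/2, and the convergence claim has b > 1 - a \<ge>
    0.\<close>
  have scheme: "zeroth_order_scheme M Q X E h L0\<omega> L0 F \<gamma> \<eta> v \<omega>s x x0" if b: "0 \<le> b"
  proof (intro zeroth_order_scheme.intro zeroth_order_scheme_axioms.intro)
    show "prob_space M" by fact
    show "prob_space Q" unfolding Q_def by (rule prob_space_distr) fact
    show "X \<noteq> {}" "compact X" "convex X" by fact+
    show "closed E" unfolding E_def by (rule compact_imp_closed[OF compact_enlargement[OF cX]])
    show "cball z (\<eta> k) \<subseteq> E" if "z \<in> X" for z k
    proof -
      have "1 \<le> real (k + 1) powr b" using b by (intro ge_one_powr_ge_zero) auto
      then have "\<eta> k \<le> \<eta>0" unfolding eta_def using eta0_pos by (simp add: field_simps)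
      then show ?thesis unfolding E_def by (rule cball_subset_enlargement[OF that])
    qed
    show "\<gamma> k > 0" "\<eta> k > 0" for k using gamma0_pos eta0_pos by (auto simp: gamma_def eta_def)
    show "h z \<in> borel_measurable Q" if "z \<in> E" for z using hm[OF that] by measurable
    show "integrable Q (h z)" if "z \<in> X" for z
      unfolding Q_def using f_int[OF that] hm[of z] X_E that by (subst integrable_distr_eq) (auto simp: h_def)
    show "(L0\<omega> w)-lipschitz_on E (\<lambda>z. h z w)" if "w \<in> space Q" for w
      using B1_lip[of w] that by (simp add: h_def E_def space_Q)
    show "L0\<omega> \<in> borel_measurable Q" using B1_meas by measurable
    show "integrable Q (\<lambda>w. (L0\<omega> w)\<^sup>2)"
      unfolding Q_def using B1_int B1_meas by (subst integrable_distr_eq) auto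
    show "L0 = sqrt (\<integral>w. (L0\<omega> w)\<^sup>2 \<partial>Q)"
      unfolding Q_def L0_def using B1_meas by (subst integral_distr) auto
    show "F z = (\<integral>w. h z w \<partial>Q)" if "z \<in> E" for z
      unfolding Q_def F_def implicit_objective_def using hm[OF that] by (subst integral_distr) (auto simp: h_def)
    show "convex_on E F" using C by (simp add: E_def)
    have "indep_sets (noise_sets v S \<omega>s) UNIV" by (rule indep_sets_noise) fact+
    then show "indep_sets (noise_sets v Q \<omega>s) UNIV" unfolding noise_sets_def sets_Q .
    show "v k \<in> borel_measurable M" for k using U_v_indep by (auto simp: indep_vars_def2)
    show "\<omega>s k \<in> measurable M Q" for k using U_w_indep by (auto simp: indep_vars_def2 Q_def)
    show "norm (v k p) = \<eta> k" if "p \<in> space M" for k p using U_v_sphere[OF that, of k] by simp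
    show "distr M borel (v k) = uniform_sphere (\<eta> k)" for k by fact
    have "distr M Q (\<omega>s k) = distr M S (\<omega>s k)" for k by (rule distr_cong) (auto simp: sets_Q)
    then show "distr M Q (\<omega>s k) = Q" for k by (simp add: U_w_law Q_def)
    show "x0 \<in> X" by fact
    show "x 0 p = x0" for p by (simp add: x_def)
    show "x (Suc k) p = closest_point X (x k p - \<gamma> k *\<^sub>R zo_gradient (\<lambda>z. h z (\<omega>s k p)) (\<eta> k) (x k p) (v k p))" for k p
      by (simp add: x_def h_def Let_def)
  qed
  have xb: "weighted_average \<gamma> r (\<lambda>j. x j p) K = xbar K p" for K p
    by (simp add: x_def xbar_def)
  have Xs: "zeroth_order_scheme.Xs X F = Xstar" "zeroth_order_scheme.fs X F = fstar" if "0 \<le> b"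
    using zeroth_order_scheme.Xs_def[OF scheme[OF that]] zeroth_order_scheme.fs_def[OF scheme[OF that]]
    by (simp_all add: Xstar_def fstar_def)
  have D0: "0 \<le> D" if "0 \<le> b"
    using zeroth_order_scheme.half_sq_radius_nonneg[OF scheme[OF that]] that by (simp add: Xs D_def)
  have L00: "0 \<le> L0" by (simp add: L0_def)
  have n0: "n > 0" by (simp add: n_def)
  have rate: "(\<integral>p. F (xbar K p) \<partial>M) - fstar \<le> (D / \<gamma>0 + L0\<^sup>2 * n\<^sup>2 * \<gamma>0 / (1 - r)) * (1 / sqrt (real K + 1))
      + \<eta>0 * L0 / (1 - r / 2 - b) * (1 / (real K + 1) powr b)"
    if "a = 1/2" "0 \<le> b" "r / 2 + b < 1" for K
    using zeroth_order_scheme.expected_gap_rate[OF scheme[OF that(2)], of \<gamma>0 \<eta>0 b r K] that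
      gamma_def eta_def gamma0_pos eta0_pos r_range
    by (simp add: xb Xs D_def n_def)
  have partA: "(\<integral>p. F (xbar K p) \<partial>M) - fstar
           \<le> (2 - r) * (D / \<gamma>0 + L0\<^sup>2 * n\<^sup>2 * \<gamma>0 / (1 - r)) * (1 / sqrt (real K + 1))
             + (2 - r) * (\<eta>0 * L0 / (1 - 0.5 * r - b)) * (1 / (real K + 1) powr b)"
    if "a = 1/2" "1/2 \<le> b" "r < 2 * (1 - b)" for K
  proof -
    have b: "0 \<le> b" "r / 2 + b < 1" using that by auto
    let ?R = "(D / \<gamma>0 + L0\<^sup>2 * n\<^sup>2 * \<gamma>0 / (1 - r)) * (1 / sqrt (real K + 1))
      + \<eta>0 * L0 / (1 - r / 2 - b) * (1 / (real K + 1) powr b)"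
    have R: "0 \<le> ?R"
      using D0[OF b(1)] L00 gamma0_pos eta0_pos r_range b by (intro add_nonneg_nonneg mult_nonneg_nonneg divide_nonneg_nonneg) auto
    \<comment> \<open>The bound \<open>rate\<close> is ?R itself. The factor 2 - r exceeds 1 because
      r < 1, and ?R is nonnegative.\<close>
    have "1 * ?R \<le> (2 - r) * ?R" using r_range by (intro mult_right_mono R) auto
    also have "\<dots> = (2 - r) * (D / \<gamma>0 + L0\<^sup>2 * n\<^sup>2 * \<gamma>0 / (1 - r)) * (1 / sqrt (real K + 1))
             + (2 - r) * (\<eta>0 * L0 / (1 - 0.5 * r - b)) * (1 / (real K + 1) powr b)"
    proof -
      have "c * (u * s + z * t) = c * u * s + c * z * t" for c u s z t :: real by (simp add: distrib_left)
      moreover have "0.5 * r = r / 2" by simp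
      ultimately show ?thesis by (simp only:)
    qed
    finally show ?thesis using order_trans[OF rate[OF that(1) b, of K]] by (simp only: mult_1)
  qed
  have partA': "(\<integral>p. F (xbar K p) \<partial>M) - fstar
           \<le> 2 * (D / \<gamma>0 + L0\<^sup>2 * n\<^sup>2 * \<gamma>0) * (1 / sqrt (real K + 1))
             + (2 * \<eta>0 * L0 / \<delta>) * (1 / (real K + 1) powr (1 - \<delta>))"
    if "a = 1/2" "0 < \<delta>" "\<delta> \<le> 1/2" "b = 1 - \<delta>" "r = 0" for K \<delta>
    using partA[of K] that by simp
  have partB: "(\<integral>p. F (xbar K p) \<partial>M) - fstar \<le> \<epsilon>"
    if "a = 1/2" "b = 1/2" "r = 0" and g: "\<gamma>0 = sqrt D / (n * L0)" and e: "\<eta>0 \<le> sqrt D * n"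
      and \<epsilon>: "\<epsilon> > 0" and K: "real K \<ge> 64 * n\<^sup>2 * L0\<^sup>2 * D / \<epsilon>\<^sup>2" for K \<epsilon>
  proof -
    \<comment> \<open>With x / 0 = 0, a vanishing L0 or D would make \<gamma>0 = sqrt D / (n * L0)
      equal to 0, against \<gamma>0 > 0.\<close>
    have L: "L0 > 0" using g gamma0_pos L00 by (cases "L0 = 0") auto
    have D: "D > 0" using g gamma0_pos D0 that(2) by (cases "D = 0") auto
    let ?s = "sqrt (real K + 1)" and ?c = "n * L0 * sqrt D"
    have "sqrt D * sqrt D = D" using D by simp
    \<comment> \<open>This \<gamma>0 minimizes D / \<gamma>0 + L0^2 n^2 \<gamma>0; both terms then
      equal ?c.\<close>
    then have c: "D / \<gamma>0 = ?c" "L0\<^sup>2 * n\<^sup>2 * \<gamma>0 = ?c"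
      using L n0 D unfolding g by (simp_all add: field_simps power2_eq_square)
    \<comment> \<open>The bound on \<eta>0 keeps the smoothing error below the sum of the other two
      terms, so the total is at most 4 ?c / ?s.\<close>
    have "\<eta>0 * L0 / (1 - 1/2) \<le> 2 * ?c"
      using mult_right_mono[OF e, of L0] L by (simp add: mult_ac)
    then have c': "\<eta>0 * L0 / (1 - 1/2) * (1 / ?s) \<le> 2 * ?c * (1 / ?s)" by (intro mult_right_mono) auto
    have s: "(real K + 1) powr (1/2) = ?s" by (simp add: powr_half_sqrt)
    have "(\<integral>p. F (xbar K p) \<partial>M) - fstar \<le> (D / \<gamma>0 + L0\<^sup>2 * n\<^sup>2 * \<gamma>0) * (1 / ?s) + \<eta>0 * L0 / (1 - 1/2) * (1 / ?s)"
      using rate[OF that(1), of K] unfolding that(2,3) s by simp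
    also have "\<dots> \<le> (?c + ?c) * (1 / ?s) + 2 * ?c * (1 / ?s)"
      unfolding c by (intro add_left_mono c')
    also have "\<dots> = 4 * ?c / ?s"
      by simp
    also have "\<dots> \<le> \<epsilon>"
    proof -
      \<comment> \<open>Since 64 = 8^2, the threshold on K yields 8 ?c \<le> \<epsilon> ?s, from
        which 4 ?c \<le> \<epsilon> ?s follows.\<close>
      have "(8 * ?c)\<^sup>2 = 64 * n\<^sup>2 * L0\<^sup>2 * D" using D by (simp add: power_mult_distrib)
      also have "\<dots> \<le> real K * \<epsilon>\<^sup>2" using K \<epsilon> by (simp add: pos_divide_le_eq)
      also have "\<dots> \<le> \<epsilon>\<^sup>2 * (real K + 1)" by (simp add: algebra_simps)
      also have "\<dots> = (\<epsilon> * ?s)\<^sup>2" by (simp add: power_mult_distrib)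
      finally have "8 * ?c \<le> \<epsilon> * ?s" by (rule power2_le_imp_le) (use \<epsilon> in simp)
      moreover have "0 \<le> ?c" using n0 L D by simp
      ultimately have "4 * ?c \<le> \<epsilon> * ?s" by linarith
      then show ?thesis by (simp add: pos_divide_le_eq)
    qed
    finally show ?thesis .
  qed
  have partC: "\<exists>xstar. xstar \<in> borel_measurable M \<and> (\<forall>p\<in>space M. xstar p \<in> Xstar) \<and>
         (AE p in M. (\<lambda>k. (norm (xbar k p - xstar p))\<^sup>2) \<longlonglongrightarrow> 0)"
    if a: "1/2 < a" "a \<le> 1" and ab: "b > 1 - a"
  proof -
    have b: "0 \<le> b" using a ab by simp
    have g: "\<gamma> k powr s = \<gamma>0 powr s * real (k + 1) powr (- (a * s))" for k s
      unfolding gamma_def by (rule step_powr[OF gamma0_pos])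
    have gpos: "\<gamma> k > 0" for k using gamma0_pos by (simp add: gamma_def)
    have sq: "\<gamma> k powr 2 = (\<gamma> k)\<^sup>2" for k
      using powr_realpow[OF gpos, of k 2] by simp
    have "summable (\<lambda>k. \<gamma> k powr 2)"
      unfolding g by (intro summable_mult) (simp only: summable_step_powr_iff, use a in simp)
    then have s1: "summable (\<lambda>k. (\<gamma> k)\<^sup>2)" unfolding sq .
    have ge: "\<gamma> k * \<eta> k = (\<gamma>0 * \<eta>0) * real (k + 1) powr (- (a + b))" for k
      unfolding gamma_def eta_def minus_add_distrib powr_add powr_minus_divide by simp
    have s2: "summable (\<lambda>k. \<gamma> k * \<eta> k)"
      unfolding ge by (rule summable_mult) (simp only: summable_step_powr_iff, use ab in simp)
    \<comment> \<open>Applied with s = 1 for the step sizes and with s = r for the averaging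
      weights; in both cases a * s \<le> 1.\<close>
    have s3: "\<not> summable (\<lambda>k. \<gamma> k powr s)" if "0 \<le> s" "s \<le> 1" for s
    proof
      assume "summable (\<lambda>k. \<gamma> k powr s)"
      then have "summable (\<lambda>k. real (k + 1) powr (- (a * s)))"
        unfolding g using gamma0_pos by (simp only: summable_cmult_iff) simp
      then have "- (a * s) < -1" unfolding summable_step_powr_iff .
      moreover have "a * s \<le> 1" using a that by (simp add: mult_le_one)
      ultimately show False by simp
    qed
    have s4: "\<not> summable \<gamma>" using s3[of 1] by (simp add: gpos less_imp_le)
    from zeroth_order_scheme.average_converges[OF scheme[OF b] s1 s2 s4 s3[of r]] r_range
    show ?thesis by (auto simp: xb Xs[OF b])
  qed
  show ?thesis
  proof (intro conjI impI allI, goal_cases)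
    case (1 K)
    then show ?case by (elim conjE) (rule partA; assumption)
  next
    case (2 \<delta> K)
    then show ?case by (elim conjE) (rule partA'; assumption)
  next
    case (3 \<epsilon> K)
    then show ?case by (elim conjE) (rule partB; assumption)
  next
    case 4
    then show ?case by (elim conjE) (rule partC; assumption)
  qed
qed

end
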